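(* Let $N\ge 2$, let $\mathcal{H}_A,\mathcal{H}_{B_1},\dots,\mathcal{H}_{B_{N-1}}$ be state spaces of finitely many qubits each, let $\mathcal{H}_{all}=\mathcal{H}_A\otimes\mathcal{H}_{B_1}\otimes\cdots\otimes\mathcal{H}_{B_{N-1}}$, let $\mathcal{H}_E$ be a Hilbert space, and let $\mathcal{X},\mathcal{Y}_1,\dots,\mathcal{Y}_{N-1}$ be finite sets. For every family $\{U_{x,y_1,\dots,y_{N-1}}\}$ of unitaries on $\mathcal{H}_{all}$ (indexed by $x\in\mathcal{X}$, $y_p\in\mathcal{Y}_p$) and for every $\varepsilon>0$, given sufficiently many pairwise shared EPR pairs, there exist families $\{\mathcal{A}_x\}$, $\{\mathcal{B}^1_{y_1}\},\dots,\{\mathcal{B}^{N-1}_{y_{N-1}}\}$ of local operations, acting on the respective sides of Alice and of the users $\mathcal{U}_1,\dots,\mathcal{U}_{N-1}$, with the following property. For any initial state $|\psi\rangle\in\mathcal{H}_{all}\otimes\mathcal{H}_E$ and for every $x\in\mathcal{X}$ and $(y_1,\dots,y_{N-1})\in\mathcal{Y}_1\times\cdots\times\mathcal{Y}_{N-1}$, the joint execution $\mathcal{A}_x\otimes\mathcal{B}^1_{y_1}\otimes\cdots\otimes\mathcal{B}^{N-1}_{y_{N-1}}$ transforms $|\psi\rangle$ into a state $|\varphi'\rangle$ and provides classical outputs $k$ to Alice and $\ell_p$ to $\mathcal{U}_p$ ($p=1,\dots,N-1$), such that the following holds except with probability $\varepsilon$: the state $|\varphi'\rangle$ coincides with $|\varphi\rangle=(U_{x,y_1,\dots,y_{N-1}}\otimes\mathbb{I})|\psi\rangle$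 up to local qubit-wise operations on the systems $A$ and $B_p$, $p=1,\dots,N-1$, that are determined by $k$ and $\{\ell_p\}$.
   Context: There are $N$ parties: Alice, who holds system $A$ and classical input $x$, and users $\mathcal{U}_p$, $p=1,\dots,N-1$, who hold system $B_p$ and classical input $y_p$. An EPR pair is the two-qubit state $(|0\rangle|0\rangle+|1\rangle|1\rangle)/\sqrt2$; "pairwise shared" means that each pair of parties shares finitely many EPR pairs, one qubit of each pair held by each of the two parties. Each party's local operation acts on its own system and its own halves of the EPR pairs; there is no communication. $\mathbb{I}$ is the identity on $\mathcal{H}_E$. The number of EPR pairs and the operations may depend on the family of unitaries and on $\varepsilon$ but not on $|\psi\rangle$. "Coincides up to local qubit-wise operations determined by $k$ and $\{\ell_p\}$" means $|\varphi\rangle=(V^A\otimes V^{B_1}\otimes\cdots\otimes V^{B_{N-1}}\otimes\mathbb{I})|\varphi'\rangle$, where each $V^A$, $V^{B_p}$ is taken from a fixed family (independent of $|\psi\rangle$) indexed by $(k,\ell_1,\dots,\ell_{N-1})$ of unitaries that act qubit-wise (tensor products of one-qubit unitaries) on the corresponding system. After the execution, $A$ and $B_p$ denote the output registers (of the same qubit sizes) held by Alice and $\mathcal{U}_p$. *)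

theory Defs
  imports "HOL-Analysis.Analysis"
begin

section \<open>Complex Hilbert spaces\<close>

text \<open>The inner product is linear in its second argument.\<close>

class complex_hilbert = banach +
  fixes scaleC :: "complex \<Rightarrow> 'a \<Rightarrow> 'a" (infixr "*\<^sub>C" 75)
    and cinner :: "'a \<Rightarrow> 'a \<Rightarrow> complex"
  assumes scaleC_add_right: "a *\<^sub>C (x + y) = a *\<^sub>C x + a *\<^sub>C y"
    and scaleC_add_left: "(a + b) *\<^sub>C x = a *\<^sub>C x + b *\<^sub>C x"
    and scaleC_scaleC: "a *\<^sub>C b *\<^sub>C x = (a * b) *\<^sub>C x"
    and scaleC_of_real: "complex_of_real r *\<^sub>C x = r *\<^sub>R x"
    and cinner_commute: "cinner x y = cnj (cinner y x)"
    and cinner_add_right: "cinner x (y + z) = cinner x y + cinner x z"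
    and cinner_scaleC_right: "cinner x (a *\<^sub>C y) = a * cinner x y"
    and cinner_self: "cinner x x = complex_of_real ((norm x)\<^sup>2)"

instantiation complex :: complex_hilbert
begin

definition scaleC_complex :: "complex \<Rightarrow> complex \<Rightarrow> complex"
  where "scaleC_complex a x = a * x"

definition cinner_complex :: "complex \<Rightarrow> complex \<Rightarrow> complex"
  where "cinner_complex x y = cnj x * y"

instance
  by standard
    (simp_all only: scaleC_complex_def cinner_complex_def complex_norm_square scaleR_conv_of_real,
      simp_all add: algebra_simps)

end


section \<open>Vectors and operators over finite computational bases\<close>

text \<open>
  If \<open>D\<close> is a finite set labelling the computational basis of a finite-dimensional space
  \<open>\<complex>\<^sup>D\<close>, a vector of \<open>\<complex>\<^sup>D \<otimes> H\<close> is a function \<open>\<psi> :: 'b \<Rightarrow> 'e\<close> on \<open>D\<close>, standing for the sum of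
  \<open>|b\<rangle> \<otimes> \<psi> b\<close> over \<open>b \<in> D\<close>; values outside \<open>D\<close> are irrelevant.  An operator from \<open>\<complex>\<^sup>D\<close> to \<open>\<complex>\<^sup>R\<close> is
  its matrix \<open>T :: 'r \<Rightarrow> 'b \<Rightarrow> complex\<close>, row (output) index first.
\<close>

definition apply_op :: "'b set \<Rightarrow> ('r \<Rightarrow> 'b \<Rightarrow> complex) \<Rightarrow> ('b \<Rightarrow> 'e) \<Rightarrow> 'r \<Rightarrow> 'e::complex_hilbert"
  \<comment> \<open>This is \<open>(T \<otimes> I) \<psi>\<close>.\<close>
  where "apply_op D T \<psi> = (\<lambda>r. \<Sum>b\<in>D. T r b *\<^sub>C \<psi> b)"

definition sq_norm :: "'b set \<Rightarrow> ('b \<Rightarrow> 'e::complex_hilbert) \<Rightarrow> real"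
  where "sq_norm D \<psi> = (\<Sum>b\<in>D. (norm (\<psi> b))\<^sup>2)"

definition unitary_on :: "'b set \<Rightarrow> ('b \<Rightarrow> 'b \<Rightarrow> complex) \<Rightarrow> bool"
  where "unitary_on D T \<longleftrightarrow>
    (\<forall>i\<in>D. \<forall>j\<in>D. (\<Sum>r\<in>D. cnj (T r i) * T r j) = (if i = j then 1 else 0)) \<and>
    (\<forall>i\<in>D. \<forall>j\<in>D. (\<Sum>r\<in>D. T i r * cnj (T j r)) = (if i = j then 1 else 0))"

definition bits :: "'q set \<Rightarrow> ('q \<Rightarrow> bool) set"
  \<comment> \<open>The computational basis of a register whose qubits are labelled by \<open>S\<close>.\<close>
  where "bits S = (S \<rightarrow>\<^sub>E UNIV)"


section \<open>The parties' systems\<close>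

text \<open>
  The parties are numbered \<open>0, \<dots>, N - 1\<close>: party \<open>0\<close> is Alice, with system \<open>A\<close>, and party \<open>p \<ge> 1\<close>
  is the user \<open>U\<^sub>p\<close>, with system \<open>B\<^sub>p\<close>.  The system of party \<open>p\<close> consists of \<open>n p\<close> qubits.
\<close>

definition parties :: "'c \<Rightarrow> (nat \<Rightarrow> 'c) \<Rightarrow> nat \<Rightarrow> 'c"
  where "parties a b p = (if p = 0 then a else b p)"

type_synonym sys = "nat \<Rightarrow> bool"        \<comment> \<open>basis label of the system of one party\<close>
type_synonym all_sys = "nat \<Rightarrow> sys"      \<comment> \<open>basis label of \<open>H_all\<close>\<close>
type_synonym ebits = "nat \<times> nat \<Rightarrow> bool"  \<comment> \<open>basis label of the EPR halves of one party\<close>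
type_synonym kraus = "sys \<Rightarrow> sys \<times> ebits \<Rightarrow> complex"

definition sys_basis :: "nat \<Rightarrow> (nat \<Rightarrow> nat) \<Rightarrow> all_sys set"
  where "sys_basis N n = PiE {..<N} (\<lambda>p. bits {..<n p})"

definition tensor :: "nat \<Rightarrow> (nat \<Rightarrow> 'r \<Rightarrow> 'b \<Rightarrow> complex) \<Rightarrow> (nat \<Rightarrow> 'r) \<Rightarrow> (nat \<Rightarrow> 'b) \<Rightarrow> complex"
  where "tensor N T r b = (\<Prod>p<N. T p (r p) (b p))"


section \<open>Pairwise shared EPR pairs\<close>

text \<open>
  Parties \<open>p < q\<close> share \<open>m p q\<close> EPR pairs (\<open>m p q\<close> is only used for \<open>p < q\<close>).  The half of the
  \<open>i\<close>-th pair shared by \<open>p\<close> and \<open>q\<close> that is held by \<open>p\<close> is labelled \<open>(q, i)\<close> on the side of \<open>p\<close>,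
  and the other half is labelled \<open>(p, i)\<close> on the side of \<open>q\<close>.
\<close>

definition epr :: "bool \<Rightarrow> bool \<Rightarrow> complex"
  where "epr a b = (if a = b then 1 / complex_of_real (sqrt 2) else 0)"

definition halves :: "nat \<Rightarrow> (nat \<Rightarrow> nat \<Rightarrow> nat) \<Rightarrow> nat \<Rightarrow> (nat \<times> nat) set"
  where "halves N m p = {(q, i). q < N \<and> q \<noteq> p \<and> i < m (min p q) (max p q)}"

definition ebit_basis :: "nat \<Rightarrow> (nat \<Rightarrow> nat \<Rightarrow> nat) \<Rightarrow> (nat \<Rightarrow> ebits) set"
  where "ebit_basis N m = PiE {..<N} (\<lambda>p. bits (halves N m p))"

definition epr_pairs :: "nat \<Rightarrow> (nat \<Rightarrow> nat \<Rightarrow> nat) \<Rightarrow> (nat \<Rightarrow> ebits) \<Rightarrow> complex"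
  where "epr_pairs N m h = (\<Prod>p<N. \<Prod>q\<in>{p<..<N}. \<Prod>i<m p q. epr (h p (q, i)) (h q (p, i)))"


section \<open>Local operations and their joint execution\<close>

text \<open>
  A local operation of party \<open>p\<close> is a quantum instrument with one Kraus operator \<open>M k\<close> for each
  classical outcome \<open>k\<close> in a finite set \<open>K\<close>.  It maps the system of \<open>p\<close> and its EPR halves to an
  output register of \<open>n p\<close> qubits.
\<close>

definition local_operation ::
    "nat \<Rightarrow> (nat \<Rightarrow> nat) \<Rightarrow> (nat \<Rightarrow> nat \<Rightarrow> nat) \<Rightarrow> nat \<Rightarrow> nat set \<Rightarrow> (nat \<Rightarrow> kraus) \<Rightarrow> bool"
  where "local_operation N n m p K M \<longleftrightarrow>
    finite K \<and>
    (let D = bits {..<n p} \<times> bits (halves N m p) in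
      \<forall>i\<in>D. \<forall>j\<in>D. (\<Sum>k\<in>K. \<Sum>r\<in>bits {..<n p}. cnj (M k r i) * M k r j) = (if i = j then 1 else 0))"

definition joint_execution ::
    "nat \<Rightarrow> (nat \<Rightarrow> nat) \<Rightarrow> (nat \<Rightarrow> nat \<Rightarrow> nat) \<Rightarrow> (nat \<Rightarrow> nat \<Rightarrow> kraus) \<Rightarrow> (all_sys \<Rightarrow> 'e) \<Rightarrow> (nat \<Rightarrow> nat) \<Rightarrow>
      all_sys \<Rightarrow> 'e::complex_hilbert"
  \<comment> \<open>The unnormalised state left on the output registers and \<open>H_E\<close> when each party \<open>p\<close> obtains
      the outcome \<open>\<kappa> p\<close>.\<close>
  where "joint_execution N n m M \<psi> \<kappa> =
    apply_op (sys_basis N n \<times> ebit_basis N m)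
      (\<lambda>r (b, h). tensor N (\<lambda>p. M p (\<kappa> p)) r (\<lambda>p. (b p, h p)))
      (\<lambda>(b, h). epr_pairs N m h *\<^sub>C \<psi> b)"

definition outcome_prob ::
    "nat \<Rightarrow> (nat \<Rightarrow> nat) \<Rightarrow> (nat \<Rightarrow> nat \<Rightarrow> nat) \<Rightarrow> (nat \<Rightarrow> nat \<Rightarrow> kraus) \<Rightarrow> (all_sys \<Rightarrow> 'e::complex_hilbert) \<Rightarrow>
      (nat \<Rightarrow> nat) \<Rightarrow> real"
  where "outcome_prob N n m M \<psi> \<kappa> = sq_norm (sys_basis N n) (joint_execution N n m M \<psi> \<kappa>)"

definition outcome_state ::
    "nat \<Rightarrow> (nat \<Rightarrow> nat) \<Rightarrow> (nat \<Rightarrow> nat \<Rightarrow> nat) \<Rightarrow> (nat \<Rightarrow> nat \<Rightarrow> kraus) \<Rightarrow> (all_sys \<Rightarrow> 'e) \<Rightarrow> (nat \<Rightarrow> nat) \<Rightarrow>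
      all_sys \<Rightarrow> 'e::complex_hilbert"
  where "outcome_state N n m M \<psi> \<kappa> =
    (\<lambda>r. (1 / sqrt (outcome_prob N n m M \<psi> \<kappa>)) *\<^sub>R joint_execution N n m M \<psi> \<kappa> r)"


section \<open>Qubit-wise corrections\<close>

text \<open>
  For \<open>n \<ge> 1\<close> the phase \<open>c\<close> is redundant, since it can be absorbed in one of the factors.  For
  \<open>n = 0\<close> it makes the qubit-wise unitaries all unitaries of the one-dimensional space \<open>\<complex>\<close>.
\<close>

definition qubitwise_unitary :: "nat \<Rightarrow> (sys \<Rightarrow> sys \<Rightarrow> complex) \<Rightarrow> bool"
  where "qubitwise_unitary n V \<longleftrightarrow>
    (\<exists>c v. cmod c = 1 \<and> (\<forall>i<n. unitary_on UNIV (v i :: bool \<Rightarrow> bool \<Rightarrow> complex)) \<and>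
      (\<forall>r\<in>bits {..<n}. \<forall>b\<in>bits {..<n}. V r b = c * (\<Prod>i<n. v i (r i) (b i))))"

definition coincides_up_to ::
    "nat \<Rightarrow> (nat \<Rightarrow> nat) \<Rightarrow> (nat \<Rightarrow> sys \<Rightarrow> sys \<Rightarrow> complex) \<Rightarrow> (all_sys \<Rightarrow> 'e) \<Rightarrow>
      (all_sys \<Rightarrow> 'e::complex_hilbert) \<Rightarrow> bool"
  where "coincides_up_to N n V \<phi> \<phi>' \<longleftrightarrow>
    (\<forall>r\<in>sys_basis N n. \<phi> r = apply_op (sys_basis N n) (tensor N V) \<phi>' r)"

end

theory Submission
  imports Defs
begin

text \<open>
  The users teleport their systems to Alice, who then holds the state up to Pauli errors known to
  the users. The parties now work in rounds. In a round Alice has one register for every possible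
  value of the data known to the users (inputs and all outcomes so far), with the state in a
  default register. All registers are teleported to one user after the other and back; each user
  permutes them so that the state ends up in the register labelled by the true data. There Alice
  can apply the unitary that is still missing, because the label tells her what it is, and a
  second pass returns the state to the default register. If the Pauli errors on the register of
  the state are trivial during the first pass, the result is correct up to Pauli operators. This
  has a probability that depends only on the dimension of the state, not on the number of
  registers, since errors on other registers do no harm. Otherwise some other unitary, known
  jointly by the parties, has been applied; the next round undoes it. If the state was already
  correct, the unitary to be applied is the identity and Pauli errors keep it correct. Hence the
  failure probability decays geometrically in the number of rounds. Finally Alice teleports the
  systems back.

  No party ever needs to know whether a round succeeded, and the default contents of the other
  registers only contribute scalars to the joint Kraus operators.
\<close>

section \<open>Matrices, tensor products and error bases\<close>

text \<open>Without communication, what a party does later can depend only on its own input and its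
  own earlier outcomes. An error that precedes the wanted unitary does harm: the unitary turns it
  into a nonlocal operator, which no local correction removes. An error that follows it is a Pauli
  operator and can be left to the final corrections. This is why only the first pass of a round must
  be free of errors, and only on the register of the state. A visit to a user consists of two
  teleportations, each without error on that register with probability
  \<open>1 / (card D)^2\<close>, whence \<open>\<eta> = 1 / (card D)^4\<close>; a pass makes
  \<open>N - 1\<close> visits. The register labels contain all earlier outcomes, so their number
  grows from round to round, and a success bound that depended on it would not give geometric decay.
  Every joint Kraus operator that arises is a scalar times a unitary. Hence the distribution of the
  outcomes is the same for all states, failure probabilities are sums of squared moduli of these
  scalars, and the corrections can be chosen from the outcomes alone.\<close>

definition mat_mult :: "'b set \<Rightarrow> ('a \<Rightarrow> 'b \<Rightarrow> complex) \<Rightarrow> ('b \<Rightarrow> 'c \<Rightarrow> complex) \<Rightarrow> 'a \<Rightarrow> 'c \<Rightarrow> complex"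
  where "mat_mult B S T = (\<lambda>r c. \<Sum>x\<in>B. S r x * T x c)"

definition adj :: "('a \<Rightarrow> 'b \<Rightarrow> complex) \<Rightarrow> 'b \<Rightarrow> 'a \<Rightarrow> complex"
  where "adj T = (\<lambda>r c. cnj (T c r))"

definition id_mat :: "'b \<Rightarrow> 'b \<Rightarrow> complex"
  where "id_mat r c = (if r = c then 1 else 0)"

definition isometry_on :: "'b set \<Rightarrow> 'c set \<Rightarrow> ('c \<Rightarrow> 'b \<Rightarrow> complex) \<Rightarrow> bool"
  where "isometry_on B B' T \<longleftrightarrow> (\<forall>i\<in>B. \<forall>j\<in>B. (\<Sum>r\<in>B'. cnj (T r i) * T r j) = id_mat i j)"

definition tens :: "'i set \<Rightarrow> ('i \<Rightarrow> 'r \<Rightarrow> 'b \<Rightarrow> complex) \<Rightarrow> ('i \<Rightarrow> 'r) \<Rightarrow> ('i \<Rightarrow> 'b) \<Rightarrow> complex"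
  where "tens I T r b = (\<Prod>i\<in>I. T i (r i) (b i))"

lemma unitary_on_iff: "unitary_on D T \<longleftrightarrow> isometry_on D D T \<and> isometry_on D D (adj T)"
  by (simp add: unitary_on_def isometry_on_def adj_def id_mat_def)

lemma unitary_onD: "unitary_on D T \<Longrightarrow> isometry_on D D T"
  by (simp add: unitary_on_iff)

lemma isometry_onD: "isometry_on B B' T \<Longrightarrow> i \<in> B \<Longrightarrow> j \<in> B \<Longrightarrow> (\<Sum>r\<in>B'. cnj (T r i) * T r j) = id_mat i j"
  by (simp add: isometry_on_def)

lemma isometry_on_cong:
  assumes "\<And>r b. r \<in> B' \<Longrightarrow> b \<in> B \<Longrightarrow> S r b = T r b"
  shows "isometry_on B B' S \<longleftrightarrow> isometry_on B B' T"
  unfolding isometry_on_def using assms by (intro ball_cong refl arg_cong2[where f="(=)"] sum.cong) auto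

lemma unitary_on_cong:
  assumes "\<And>r b. r \<in> B \<Longrightarrow> b \<in> B \<Longrightarrow> S r b = T r b"
  shows "unitary_on B S \<longleftrightarrow> unitary_on B T"
  unfolding unitary_on_iff using assms by (intro arg_cong2[where f="(\<and>)"] isometry_on_cong) (auto simp: adj_def)

lemma sum_id_mat:
  assumes "finite A" "a \<in> A"
  shows "(\<Sum>x\<in>A. id_mat x a * F x) = F a" "(\<Sum>x\<in>A. F x * id_mat x a) = F a"
proof -
  have "(\<Sum>x\<in>A. id_mat x a * F x) = (\<Sum>x\<in>A. if x = a then F a else 0)"
    by (intro sum.cong refl) (auto simp: id_mat_def)
  then show "(\<Sum>x\<in>A. id_mat x a * F x) = F a" using assms by simp
  then show "(\<Sum>x\<in>A. F x * id_mat x a) = F a" by (simp add: mult.commute)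
qed

lemma mat_mult_id_mat_left: "finite B \<Longrightarrow> r \<in> B \<Longrightarrow> mat_mult B id_mat T r c = T r c"
  by (simp add: mat_mult_def id_mat_def if_distrib[where f="\<lambda>x. x * _"] cong: if_cong)

lemma mat_mult_id_mat_right: "finite B \<Longrightarrow> c \<in> B \<Longrightarrow> mat_mult B T id_mat r c = T r c"
  by (simp add: mat_mult_def id_mat_def if_distrib[where f="\<lambda>x. _ * x"] cong: if_cong)

lemma mat_mult_assoc: "mat_mult B (mat_mult A R S) T = mat_mult A R (mat_mult B S T)"
  by (intro ext) (simp add: mat_mult_def sum_distrib_left sum_distrib_right mult.assoc, rule sum.swap)

lemma mat_mult_cong:
  assumes "\<And>x. x \<in> B \<Longrightarrow> S r x = S' r x" "\<And>x. x \<in> B \<Longrightarrow> T x c = T' x c"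
  shows "mat_mult B S T r c = mat_mult B S' T' r c"
  unfolding mat_mult_def using assms by (intro sum.cong) auto

lemma adj_adj: "adj (adj T) = T"
  by (simp add: adj_def)

lemma adj_mat_mult: "adj (mat_mult B S T) = mat_mult B (adj T) (adj S)"
  by (simp add: adj_def mat_mult_def mult.commute)

lemma isometry_on_mat_mult:
  assumes "finite B" "isometry_on A B T" "isometry_on B C S"
  shows "isometry_on A C (mat_mult B S T)"
  unfolding isometry_on_def
proof (intro ballI)
  fix i j assume ij: "i \<in> A" "j \<in> A"
  have "(\<Sum>r\<in>C. cnj (mat_mult B S T r i) * mat_mult B S T r j)
      = (\<Sum>r\<in>C. \<Sum>x\<in>B. \<Sum>y\<in>B. cnj (T x i) * T y j * (cnj (S r x) * S r y))"
    unfolding mat_mult_def cnj_sum sum_product by (intro sum.cong refl) (simp add: mult_ac)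
  also have "\<dots> = (\<Sum>x\<in>B. \<Sum>y\<in>B. cnj (T x i) * T y j * (\<Sum>r\<in>C. cnj (S r x) * S r y))"
    by (subst sum.swap, intro sum.cong refl, subst sum.swap, simp add: sum_distrib_left)
  also have "\<dots> = (\<Sum>x\<in>B. \<Sum>y\<in>B. cnj (T x i) * T y j * id_mat x y)"
    using assms(3) by (intro sum.cong refl) (simp add: isometry_onD)
  also have "\<dots> = (\<Sum>x\<in>B. cnj (T x i) * T x j)"
    using assms(1) by (intro sum.cong refl) (simp add: id_mat_def if_distrib[where f="\<lambda>x. _ * x"] cong: if_cong)
  finally show "(\<Sum>r\<in>C. cnj (mat_mult B S T r i) * mat_mult B S T r j) = id_mat i j"
    using ij assms(2) by (simp add: isometry_onD)
qed

lemma unitary_on_mat_mult: "finite B \<Longrightarrow> unitary_on B S \<Longrightarrow> unitary_on B T \<Longrightarrow> unitary_on B (mat_mult B S T)"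
  unfolding unitary_on_iff adj_mat_mult by (auto intro: isometry_on_mat_mult)

lemma unitary_on_adj: "unitary_on B S \<Longrightarrow> unitary_on B (adj S)"
  by (auto simp: unitary_on_iff adj_adj)

lemma isometry_on_id_mat: "finite B \<Longrightarrow> isometry_on B B id_mat"
  by (auto simp: isometry_on_def id_mat_def if_distrib[where f="\<lambda>x. _ * x"] cong: if_cong)

lemma unitary_on_id_mat: "finite B \<Longrightarrow> unitary_on B id_mat"
proof -
  have "adj id_mat = (id_mat :: 'a \<Rightarrow> _)" by (auto simp: adj_def id_mat_def fun_eq_iff)
  then show "finite B \<Longrightarrow> ?thesis" by (simp add: unitary_on_iff isometry_on_id_mat)
qed

lemma mat_mult_adj_left: "unitary_on B T \<Longrightarrow> r \<in> B \<Longrightarrow> c \<in> B \<Longrightarrow> mat_mult B (adj T) T r c = id_mat r c"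
  by (simp add: mat_mult_def adj_def isometry_onD[OF unitary_onD])

text \<open>Members of a \<open>PiE\<close> set agree outside \<open>I\<close>, so distinct ones
  differ at some \<open>i \<in> I\<close>, which gives a factor 0.\<close>

lemma tens_id_mat: "finite I \<Longrightarrow> r \<in> PiE I A \<Longrightarrow> b \<in> PiE I B \<Longrightarrow> tens I (\<lambda>i. id_mat) r b = id_mat r b"
  by (cases "r = b") (auto simp: tens_def id_mat_def PiE_iff extensional_def fun_eq_iff, metis)

lemma tens_cong: "(\<And>i. i \<in> I \<Longrightarrow> T i (r i) (b i) = T' i (r i) (b i)) \<Longrightarrow> tens I T r b = tens I T' r b"
  unfolding tens_def by (rule prod.cong) auto

lemma mat_mult_tens:
  assumes "finite I" "\<And>i. i \<in> I \<Longrightarrow> finite (B i)"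
  shows "mat_mult (PiE I B) (tens I S) (tens I T) r b = tens I (\<lambda>i. mat_mult (B i) (S i) (T i)) r b"
  using assms by (simp add: mat_mult_def tens_def prod_sum_PiE prod.distrib)

lemma adj_tens: "adj (tens I T) = tens I (\<lambda>i. adj (T i))"
  by (simp add: adj_def tens_def fun_eq_iff)

lemma isometry_on_tens:
  assumes "finite I" "\<And>i. i \<in> I \<Longrightarrow> finite (B i)" "\<And>i. i \<in> I \<Longrightarrow> isometry_on (A i) (B i) (T i)"
  shows "isometry_on (PiE I A) (PiE I B) (tens I T)"
  unfolding isometry_on_def
proof (intro ballI)
  fix r b assume rb: "r \<in> PiE I A" "b \<in> PiE I A"
  have "(\<Sum>x\<in>PiE I B. cnj (tens I T x r) * tens I T x b) = mat_mult (PiE I B) (tens I (\<lambda>i. adj (T i))) (tens I T) r b"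
    by (simp add: mat_mult_def tens_def adj_def)
  also have "\<dots> = tens I (\<lambda>i. id_mat) r b"
    using assms(1,2) isometry_onD[OF assms(3)] rb
    by (subst mat_mult_tens) (auto simp: PiE_iff mat_mult_def adj_def intro!: tens_cong)
  also have "\<dots> = id_mat r b" using assms rb by (intro tens_id_mat)
  finally show "(\<Sum>x\<in>PiE I B. cnj (tens I T x r) * tens I T x b) = id_mat r b" .
qed

lemma unitary_on_tens:
  assumes "finite I" "\<And>i. i \<in> I \<Longrightarrow> finite (B i)" "\<And>i. i \<in> I \<Longrightarrow> unitary_on (B i) (T i)"
  shows "unitary_on (PiE I B) (tens I T)"
  using assms by (auto simp: unitary_on_iff adj_tens intro!: isometry_on_tens)

text \<open>
  The identity is required to be among the elements: on this outcome teleportation needs no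
  correction.
\<close>

definition error_basis :: "'b set \<Rightarrow> 'k set \<Rightarrow> ('k \<Rightarrow> 'b \<Rightarrow> 'b \<Rightarrow> complex) \<Rightarrow> bool"
  where "error_basis B Q P \<longleftrightarrow> finite B \<and> B \<noteq> {} \<and> finite Q \<and> (\<forall>k\<in>Q. unitary_on B (P k)) \<and>
    (\<forall>r\<in>B. \<forall>c\<in>B. \<forall>r'\<in>B. \<forall>c'\<in>B.
      (\<Sum>k\<in>Q. cnj (P k r c) * P k r' c') = of_nat (card B) * id_mat r r' * id_mat c c') \<and>
    (\<exists>k\<in>Q. \<forall>r\<in>B. \<forall>c\<in>B. P k r c = id_mat r c)"

lemma error_basisD:
  assumes "error_basis B Q P"
  shows "finite B" "B \<noteq> {}" "finite Q" "card B > 0"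
    and "\<And>k. k \<in> Q \<Longrightarrow> unitary_on B (P k)"
    and "\<And>r c r' c'. \<lbrakk>r \<in> B; c \<in> B; r' \<in> B; c' \<in> B\<rbrakk> \<Longrightarrow>
      (\<Sum>k\<in>Q. cnj (P k r c) * P k r' c') = of_nat (card B) * id_mat r r' * id_mat c c'"
  using assms by (auto simp: error_basis_def card_gt_0_iff)

text \<open>Sum the completeness relation over its diagonal \<open>r = r'\<close>,
  \<open>c = c'\<close> and compare with unitarity, by which every element has squared
  Hilbert-Schmidt norm \<open>card B\<close>. The count turns numbers of outcomes into
  probabilities.\<close>

lemma error_basis_card:
  assumes "error_basis B Q P"
  shows "card Q = (card B)\<^sup>2"
proof -
  note E = error_basisD[OF assms]
  have "(\<Sum>k\<in>Q. \<Sum>c\<in>B. \<Sum>r\<in>B. cnj (P k r c) * P k r c) = (\<Sum>k\<in>Q. \<Sum>c\<in>B. 1)"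
    using E by (intro sum.cong refl) (simp add: isometry_onD[OF unitary_onD] id_mat_def)
  also have "\<dots> = of_nat (card Q * card B)" by simp
  finally have "of_nat (card Q * card B) = (\<Sum>k\<in>Q. \<Sum>c\<in>B. \<Sum>r\<in>B. cnj (P k r c) * P k r c)" ..
  also have "\<dots> = (\<Sum>c\<in>B. \<Sum>r\<in>B. \<Sum>k\<in>Q. cnj (P k r c) * P k r c)"
    by (subst sum.swap, intro sum.cong refl, rule sum.swap)
  also have "\<dots> = (\<Sum>c\<in>B. \<Sum>r\<in>B. of_nat (card B))"
    using E by (intro sum.cong refl) (simp add: id_mat_def)
  also have "\<dots> = of_nat ((card B)\<^sup>2 * card B)" by (simp add: power2_eq_square)
  finally have "card Q * card B = (card B)\<^sup>2 * card B" by (simp only: of_nat_eq_iff)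
  then show ?thesis using E by simp
qed

text \<open>Classical outcomes are natural numbers, so an error basis is relabelled by naturals
  before it is used for a measurement in a protocol.\<close>

lemma error_basis_reindex:
  assumes "error_basis B Q P" "bij_betw h Q' Q"
  shows "error_basis B Q' (P \<circ> h)"
proof -
  have *: "(\<Sum>k\<in>Q'. cnj (P (h k) r c) * P (h k) r' c') = (\<Sum>k\<in>Q. cnj (P k r c) * P k r' c')" for r c r' c'
    using assms(2) by (rule sum.reindex_bij_betw)
  show ?thesis
    using assms bij_betw_finite[OF assms(2)] unfolding error_basis_def o_def *
    by (auto simp: bij_betw_def)
qed

lemma error_basis_tens:
  assumes "finite I" "\<And>i. i \<in> I \<Longrightarrow> error_basis (B i) (Q i) (P i)"
  shows "error_basis (PiE I B) (PiE I Q) (\<lambda>k. tens I (\<lambda>i. P i (k i)))"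
  unfolding error_basis_def
proof (intro conjI ballI)
  note E = error_basisD[OF assms(2)]
  show "finite (PiE I B)" "finite (PiE I Q)" using assms E by (auto intro: finite_PiE)
  show "PiE I B \<noteq> {}" using E by (simp add: PiE_eq_empty_iff)
  show "unitary_on (PiE I B) (tens I (\<lambda>i. P i (k i)))" if "k \<in> PiE I Q" for k
    using that assms(1) E(1) E(5) by (intro unitary_on_tens) (auto simp: PiE_iff)
  show "(\<Sum>k\<in>PiE I Q. cnj (tens I (\<lambda>i. P i (k i)) r c) * tens I (\<lambda>i. P i (k i)) r' c')
      = of_nat (card (PiE I B)) * id_mat r r' * id_mat c c'"
    if "r \<in> PiE I B" "c \<in> PiE I B" "r' \<in> PiE I B" "c' \<in> PiE I B" for r c r' c'
  proof -
    have "(\<Sum>k\<in>PiE I Q. cnj (tens I (\<lambda>i. P i (k i)) r c) * tens I (\<lambda>i. P i (k i)) r' c')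
        = (\<Prod>i\<in>I. \<Sum>k\<in>Q i. cnj (P i k (r i) (c i)) * P i k (r' i) (c' i))"
      using assms E by (simp add: tens_def prod_sum_PiE prod.distrib)
    also have "\<dots> = (\<Prod>i\<in>I. of_nat (card (B i)) * id_mat (r i) (r' i) * id_mat (c i) (c' i))"
      using that E by (intro prod.cong refl) (auto simp: PiE_iff)
    also have "\<dots> = of_nat (card (PiE I B)) * tens I (\<lambda>i. id_mat) r r' * tens I (\<lambda>i. id_mat) c c'"
      using assms by (simp add: card_PiE prod.distrib tens_def)
    finally show ?thesis using that assms by (simp add: tens_id_mat)
  qed
  obtain e where e: "\<And>i. i \<in> I \<Longrightarrow> e i \<in> Q i" "\<And>i r c. i \<in> I \<Longrightarrow> r \<in> B i \<Longrightarrow> c \<in> B i \<Longrightarrow> P i (e i) r c = id_mat r c"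
    using assms(2) unfolding error_basis_def by metis
  show "\<exists>k\<in>PiE I Q. \<forall>r\<in>PiE I B. \<forall>c\<in>PiE I B. tens I (\<lambda>i. P i (k i)) r c = id_mat r c"
  proof (intro bexI[of _ "restrict e I"] ballI)
    fix r c assume "r \<in> PiE I B" "c \<in> PiE I B"
    then have "tens I (\<lambda>i. P i (restrict e I i)) r c = tens I (\<lambda>i. id_mat) r c"
      using e by (intro tens_cong) (auto simp: PiE_iff)
    then show "tens I (\<lambda>i. P i (restrict e I i)) r c = id_mat r c"
      using \<open>r \<in> PiE I B\<close> \<open>c \<in> PiE I B\<close> assms by (simp add: tens_id_mat)
  qed (use e in auto)
qed

text \<open>This is X^a Z^b for \<open>k = (a, b)\<close>: a phase flip followed by a bit
  flip.\<close>

definition pauli :: "bool \<times> bool \<Rightarrow> bool \<Rightarrow> bool \<Rightarrow> complex"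
  where "pauli k r c = (if r = (c \<noteq> fst k) then if c \<and> snd k then -1 else 1 else 0)"

lemma error_basis_pauli: "error_basis UNIV UNIV pauli"
proof -
  have "pauli (False, False) r c = id_mat r c" for r c by (simp add: pauli_def id_mat_def)
  moreover have "unitary_on UNIV (pauli k)" for k
    by (cases k) (simp add: unitary_on_def pauli_def UNIV_bool split: if_splits)
  moreover have "(\<Sum>k\<in>UNIV. cnj (pauli k r c) * pauli k r' c') = of_nat (card (UNIV :: bool set)) * id_mat r r' * id_mat c c'"
    for r c r' c'
    by (cases r; cases c; cases r'; cases c')
      (simp_all add: UNIV_Times_UNIV[symmetric] sum.cartesian_product[symmetric] UNIV_bool pauli_def id_mat_def del: UNIV_Times_UNIV)
  ultimately show ?thesis unfolding error_basis_def by (auto simp: finite_prod)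
qed

section \<open>Protocols in which Alice holds the quantum state\<close>

text \<open>
  The users only measure their halves of a maximally entangled state with label sets \<open>E q\<close> shared
  with Alice, so that they contribute the scalars \<open>\<beta>\<close>.  Party \<open>p\<close> has inputs in \<open>K p\<close> and outcomes in
  \<open>K' p\<close>; an outcome records the input, which \<open>f p\<close> recovers.  \<open>J \<kappa>\<close> is the joint Kraus operator.
\<close>

definition central :: "nat \<Rightarrow> 'b set \<Rightarrow> 'c set \<Rightarrow> (nat \<Rightarrow> nat set) \<Rightarrow> (nat \<Rightarrow> nat set) \<Rightarrow> (nat \<Rightarrow> nat \<Rightarrow> nat) \<Rightarrow>
    ((nat \<Rightarrow> nat) \<Rightarrow> 'c \<Rightarrow> 'b \<Rightarrow> complex) \<Rightarrow> bool"
  where "central N B B' K K' f J \<longleftrightarrow> (\<exists>(E :: nat \<Rightarrow> nat set) \<alpha> \<beta>.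
    (\<forall>p<N. finite (K p) \<and> finite (K' p) \<and> f p \<in> K' p \<rightarrow> K p) \<and>
    (\<forall>q\<in>{1..<N}. \<exists>l. card (E q) = 2 ^ l) \<and>
    (\<forall>i\<in>K 0. \<forall>b\<in>B. \<forall>b'\<in>B. \<forall>s\<in>PiE {1..<N} E. \<forall>s'\<in>PiE {1..<N} E.
      (\<Sum>k | k \<in> K' 0 \<and> f 0 k = i. \<Sum>r\<in>B'. cnj (\<alpha> k r b s) * \<alpha> k r b' s') = id_mat b b' * id_mat s s') \<and>
    (\<forall>q\<in>{1..<N}. \<forall>i\<in>K q. \<forall>e\<in>E q. \<forall>e'\<in>E q.
      (\<Sum>k | k \<in> K' q \<and> f q k = i. cnj (\<beta> q k e) * \<beta> q k e') = id_mat e e') \<and>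
    (\<forall>\<kappa>\<in>PiE {..<N} K'. \<forall>r\<in>B'. \<forall>b\<in>B. J \<kappa> r b =
      (\<Sum>s\<in>PiE {1..<N} E. \<alpha> (\<kappa> 0) r b s *
        (\<Prod>q=1..<N. \<beta> q (\<kappa> q) (s q) / complex_of_real (sqrt (card (E q)))))))"

text \<open>What a family of outcomes records about the inputs. The restriction to
  \<open>{..<N}\<close> makes it a member of a \<open>PiE\<close> set, so that agreement of all
  inputs is equality of functions.\<close>

definition joint_input :: "nat \<Rightarrow> (nat \<Rightarrow> nat \<Rightarrow> nat) \<Rightarrow> (nat \<Rightarrow> nat) \<Rightarrow> nat \<Rightarrow> nat"
  where "joint_input N f \<kappa> = (\<lambda>p\<in>{..<N}. f p (\<kappa> p))"

lemma joint_input_in: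
  "(\<And>p. p < N \<Longrightarrow> f p \<in> K' p \<rightarrow> K p) \<Longrightarrow> \<kappa> \<in> PiE {..<N} K' \<Longrightarrow> joint_input N f \<kappa> \<in> PiE {..<N} K"
  by (auto simp: joint_input_def PiE_iff Pi_iff)

lemma joint_input_comp: "joint_input N f (joint_input N g \<kappa>) = joint_input N (\<lambda>p. f p \<circ> g p) \<kappa>"
  by (auto simp: joint_input_def)

lemma centralD:
  assumes "central N B B' K K' f J" "p < N"
  shows "finite (K p)" "finite (K' p)" "f p \<in> K' p \<rightarrow> K p"
  using assms by (auto simp: central_def)

lemma centralE:
  assumes "central N B B' K K' f J"
  obtains E \<alpha> \<beta> where
    "\<And>p. p < N \<Longrightarrow> finite (K p) \<and> finite (K' p) \<and> f p \<in> K' p \<rightarrow> K p"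
    "\<And>q. q \<in> {1..<N} \<Longrightarrow> \<exists>l. card (E q :: nat set) = 2 ^ l"
    "\<And>i b b' s s'. i \<in> K 0 \<Longrightarrow> b \<in> B \<Longrightarrow> b' \<in> B \<Longrightarrow> s \<in> PiE {1..<N} E \<Longrightarrow> s' \<in> PiE {1..<N} E \<Longrightarrow>
      (\<Sum>k | k \<in> K' 0 \<and> f 0 k = i. \<Sum>r\<in>B'. cnj (\<alpha> k r b s) * \<alpha> k r b' s') = id_mat b b' * id_mat s s'"
    "\<And>q i e e'. q \<in> {1..<N} \<Longrightarrow> i \<in> K q \<Longrightarrow> e \<in> E q \<Longrightarrow> e' \<in> E q \<Longrightarrow>
      (\<Sum>k | k \<in> K' q \<and> f q k = i. cnj (\<beta> q k e) * \<beta> q k e') = id_mat e e'"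
    "\<And>\<kappa> r b. \<kappa> \<in> PiE {..<N} K' \<Longrightarrow> r \<in> B' \<Longrightarrow> b \<in> B \<Longrightarrow> J \<kappa> r b =
      (\<Sum>s\<in>PiE {1..<N} E. \<alpha> (\<kappa> 0) r b s * (\<Prod>q=1..<N. \<beta> q (\<kappa> q) (s q) / complex_of_real (sqrt (card (E q)))))"
  using assms unfolding central_def by (elim exE conjE) (rule that; simp)

lemma central_cong:
  assumes "central N B B' K K' f J"
    and "\<And>\<kappa> r b. \<kappa> \<in> PiE {..<N} K' \<Longrightarrow> r \<in> B' \<Longrightarrow> b \<in> B \<Longrightarrow> J' \<kappa> r b = J \<kappa> r b"
  shows "central N B B' K K' f J'"
  using assms(1) by (simp add: central_def assms(2) cong: ball_cong)

text \<open>Conditioning on the past: \<open>g\<close> sends an outcome to the earlier one that it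
  records, and \<open>R\<close> is a condition on the earlier one.\<close>

lemma sum_fibers:
  assumes "finite S" "finite T" "g ` S \<subseteq> T"
  shows "(\<Sum>x | x \<in> S \<and> R (g x). F x) = (\<Sum>y | y \<in> T \<and> R y. \<Sum>x | x \<in> S \<and> g x = y. F x)"
proof -
  have "(\<Sum>y | y \<in> T \<and> R y. \<Sum>x | x \<in> {x \<in> S. R (g x)} \<and> g x = y. F x) = sum F {x \<in> S. R (g x)}"
    using assms by (intro sum.group) auto
  also have "(\<Sum>y | y \<in> T \<and> R y. \<Sum>x | x \<in> {x \<in> S. R (g x)} \<and> g x = y. F x)
      = (\<Sum>y | y \<in> T \<and> R y. \<Sum>x | x \<in> S \<and> g x = y. F x)"
    by (intro sum.cong) auto
  finally show ?thesis by simp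
qed

text \<open>Serves to merge two supplies of entanglement by pairing their labels. Labels in
  \<open>central\<close> are natural numbers, hence \<open>prod_encode\<close>.\<close>

lemma sum_PiE_encode:
  "(\<Sum>s\<in>PiE I (\<lambda>q. prod_encode ` (E q \<times> E' q)). G s)
    = (\<Sum>s\<in>PiE I E. \<Sum>s'\<in>PiE I E'. G (\<lambda>q\<in>I. prod_encode (s q, s' q)))"
  unfolding sum.cartesian_product
proof (rule sum.reindex_bij_witness[where
        j="\<lambda>s. (\<lambda>q\<in>I. fst (prod_decode (s q)), \<lambda>q\<in>I. snd (prod_decode (s q)))" and
        i="\<lambda>(s, s'). \<lambda>q\<in>I. prod_encode (s q, s' q)"])
  fix s assume s: "s \<in> PiE I (\<lambda>q. prod_encode ` (E q \<times> E' q))"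
  then have eq: "(\<lambda>q\<in>I. prod_encode ((\<lambda>q\<in>I. fst (prod_decode (s q))) q, (\<lambda>q\<in>I. snd (prod_decode (s q))) q)) = s"
    by (auto simp: PiE_iff extensional_def fun_eq_iff)
  show "(case (\<lambda>q\<in>I. fst (prod_decode (s q)), \<lambda>q\<in>I. snd (prod_decode (s q))) of
      (s, s') \<Rightarrow> \<lambda>q\<in>I. prod_encode (s q, s' q)) = s"
    unfolding prod.case by (rule eq)
  show "(case (\<lambda>q\<in>I. fst (prod_decode (s q)), \<lambda>q\<in>I. snd (prod_decode (s q))) of
      (s, s') \<Rightarrow> G (\<lambda>q\<in>I. prod_encode (s q, s' q))) = G s"
    unfolding prod.case by (rule arg_cong[OF eq])
  show "(\<lambda>q\<in>I. fst (prod_decode (s q)), \<lambda>q\<in>I. snd (prod_decode (s q))) \<in> PiE I E \<times> PiE I E'"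
    using s by (force simp: PiE_iff)
qed (auto simp: PiE_iff extensional_def fun_eq_iff)

lemma sum_encode_fiber:
  assumes "i \<in> K"
  shows "(\<Sum>k | k \<in> prod_encode ` (K \<times> Q) \<and> fst (prod_decode k) = i. F k) = (\<Sum>j\<in>Q. F (prod_encode (i, j)))"
  by (rule sum.reindex_bij_witness[where j="\<lambda>k. snd (prod_decode k)" and i="\<lambda>j. prod_encode (i, j)"])
    (use assms in auto)

text \<open>An instrument of Alice alone. Each user has the one-element label set \<open>{0}\<close>
  of size \<open>2 ^ 0\<close>, contributes the scalar 1, and has its input as its only
  outcome.\<close>

lemma central_alice:
  assumes "N > 0" "\<And>p. p < N \<Longrightarrow> finite (K p)" "finite A" "g \<in> A \<rightarrow> K 0"
    and L: "\<And>i b b'. i \<in> K 0 \<Longrightarrow> b \<in> B \<Longrightarrow> b' \<in> B \<Longrightarrow>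
      (\<Sum>k | k \<in> A \<and> g k = i. \<Sum>r\<in>B'. cnj (L k r b) * L k r b') = id_mat b b'"
  shows "central N B B' K (K(0 := A)) ((\<lambda>p. id)(0 := g)) (\<lambda>\<kappa>. L (\<kappa> 0))"
  unfolding central_def
proof (intro exI[of _ "\<lambda>q. {0}"] exI[of _ "\<lambda>k r b s. L k r b"]
    exI[of _ "\<lambda>q k e. 1"] conjI ballI allI impI)
  show "\<exists>l. card {0::nat} = 2 ^ l" by (intro exI[of _ 0]) simp
next
  fix i b b' and s s' :: "nat \<Rightarrow> nat"
  assume *: "i \<in> K 0" "b \<in> B" "b' \<in> B" "s \<in> PiE {1..<N} (\<lambda>q. {0})" "s' \<in> PiE {1..<N} (\<lambda>q. {0})"
  then have "s = s'" by (auto simp: PiE_iff extensional_def fun_eq_iff)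
  with * L show "(\<Sum>k | k \<in> (K(0 := A)) 0 \<and> ((\<lambda>p. id)(0 := g)) 0 k = i. \<Sum>r\<in>B'. cnj (L k r b) * L k r b')
      = id_mat b b' * id_mat s s'"
    by simp (simp add: id_mat_def)
next
  fix q i and e e' :: nat
  assume *: "q \<in> {1..<N}" "i \<in> K q" "e \<in> {0}" "e' \<in> {0}"
  then have "{k \<in> K q. k = i} = {i}" by auto
  with * show "(\<Sum>k | k \<in> (K(0 := A)) q \<and> ((\<lambda>p. id)(0 := g)) q k = i. cnj 1 * 1) = id_mat e e'"
    by (simp add: id_mat_def)
qed (use assms in \<open>auto split: if_splits\<close>)

text \<open>An isometry is an instrument with a single outcome, so the outcome of Alice is just her
  input.\<close>

lemma central_alice_isometry:
  assumes "N > 0" "\<And>p. p < N \<Longrightarrow> finite (K p)" "\<And>i. i \<in> K 0 \<Longrightarrow> isometry_on B B' (L i)"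
  shows "central N B B' K K (\<lambda>p. id) (\<lambda>\<kappa>. L (\<kappa> 0))"
proof -
  have "(\<Sum>k | k \<in> K 0 \<and> id k = i. \<Sum>r\<in>B'. cnj (L k r b) * L k r b') = id_mat b b'"
    if "i \<in> K 0" "b \<in> B" "b' \<in> B" for i b b'
  proof -
    have "{k. k \<in> K 0 \<and> id k = i} = {i}" using that by auto
    then show ?thesis using isometry_onD[OF assms(3), OF that] by simp
  qed
  then have "central N B B' K (K(0 := K 0)) ((\<lambda>p. id)(0 := id)) (\<lambda>\<kappa>. L (\<kappa> 0))"
    using assms by (intro central_alice) auto
  then show ?thesis by (simp add: fun_upd_idem)
qed

lemma joint_input_id: "\<kappa> \<in> PiE {..<N} K \<Longrightarrow> joint_input N (\<lambda>p. id) \<kappa> = \<kappa>"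
  by (auto simp: joint_input_def PiE_iff extensional_def fun_eq_iff)

text \<open>The law of total probability for composed protocols: \<open>R\<close> is a condition on
  the outcomes of the first protocol, \<open>S\<close> on those of the second.\<close>

lemma sum_joint_input_comp:
  assumes g: "\<And>p. p < N \<Longrightarrow> finite (K' p) \<and> finite (K'' p) \<and> g p \<in> K'' p \<rightarrow> K' p"
  shows "(\<Sum>\<kappa> | \<kappa> \<in> PiE {..<N} K'' \<and> joint_input N (\<lambda>p. f p \<circ> g p) \<kappa> = z \<and> R (joint_input N g \<kappa>) \<and> S \<kappa>. F \<kappa>)
    = (\<Sum>\<kappa>' | \<kappa>' \<in> PiE {..<N} K' \<and> joint_input N f \<kappa>' = z \<and> R \<kappa>'.
        \<Sum>\<kappa> | \<kappa> \<in> PiE {..<N} K'' \<and> joint_input N g \<kappa> = \<kappa>' \<and> S \<kappa>. F \<kappa>)"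
proof -
  let ?S = "{\<kappa> \<in> PiE {..<N} K''. S \<kappa>}" and ?R = "\<lambda>\<kappa>'. joint_input N f \<kappa>' = z \<and> R \<kappa>'"
  have fin: "finite (PiE {..<N} K'')" "finite (PiE {..<N} K')"
    using g by (auto intro!: finite_PiE)
  have "(\<Sum>\<kappa> | \<kappa> \<in> ?S \<and> ?R (joint_input N g \<kappa>). F \<kappa>)
      = (\<Sum>\<kappa>' | \<kappa>' \<in> PiE {..<N} K' \<and> ?R \<kappa>'. \<Sum>\<kappa> | \<kappa> \<in> ?S \<and> joint_input N g \<kappa> = \<kappa>'. F \<kappa>)"
    using fin joint_input_in[of N g K'' K'] g by (intro sum_fibers) auto
  also have "{\<kappa>. \<kappa> \<in> ?S \<and> ?R (joint_input N g \<kappa>)} = {\<kappa>. \<kappa> \<in> PiE {..<N} K'' \<and>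
      joint_input N (\<lambda>p. f p \<circ> g p) \<kappa> = z \<and> R (joint_input N g \<kappa>) \<and> S \<kappa>}"
    by (auto simp: joint_input_comp)
  also have "(\<Sum>\<kappa>' | \<kappa>' \<in> PiE {..<N} K' \<and> ?R \<kappa>'. \<Sum>\<kappa> | \<kappa> \<in> ?S \<and> joint_input N g \<kappa> = \<kappa>'. F \<kappa>)
    = (\<Sum>\<kappa>' | \<kappa>' \<in> PiE {..<N} K' \<and> joint_input N f \<kappa>' = z \<and> R \<kappa>'.
        \<Sum>\<kappa> | \<kappa> \<in> PiE {..<N} K'' \<and> joint_input N g \<kappa> = \<kappa>' \<and> S \<kappa>. F \<kappa>)"
    by (intro sum.cong) auto
  finally show ?thesis .
qed

text \<open>The outcomes of the first protocol are the inputs of the second, so each party adapts to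
  its own past and to nothing else. A product of maximally entangled states is maximally entangled:
  the labels \<open>E q \<times> E' q\<close> serve both protocols, and the normalisation factors
  accordingly. Alice keeps the register \<open>B\<close> in between, so her Kraus operators are
  composed as matrices, while the scalars of the users are multiplied.\<close>

lemma central_comp:
  assumes 1: "central N A B K K' f J" and 2: "central N B C K' K'' g J'"
    and "N > 0" "finite B"
  shows "central N A C K K'' (\<lambda>p. f p \<circ> g p) (\<lambda>\<kappa>. mat_mult B (J' \<kappa>) (J (joint_input N g \<kappa>)))"
proof -
  let ?I = "{1..<N}"
  obtain E \<alpha> \<beta> where
    f: "\<And>p. p < N \<Longrightarrow> finite (K p) \<and> finite (K' p) \<and> f p \<in> K' p \<rightarrow> K p" and
    E: "\<And>q. q \<in> ?I \<Longrightarrow> \<exists>l. card (E q :: nat set) = 2 ^ l" and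
    \<alpha>: "\<And>i b b' s s'. i \<in> K 0 \<Longrightarrow> b \<in> A \<Longrightarrow> b' \<in> A \<Longrightarrow> s \<in> PiE ?I E \<Longrightarrow> s' \<in> PiE ?I E \<Longrightarrow>
      (\<Sum>k | k \<in> K' 0 \<and> f 0 k = i. \<Sum>r\<in>B. cnj (\<alpha> k r b s) * \<alpha> k r b' s') = id_mat b b' * id_mat s s'" and
    \<beta>: "\<And>q i e e'. q \<in> ?I \<Longrightarrow> i \<in> K q \<Longrightarrow> e \<in> E q \<Longrightarrow> e' \<in> E q \<Longrightarrow>
      (\<Sum>k | k \<in> K' q \<and> f q k = i. cnj (\<beta> q k e) * \<beta> q k e') = id_mat e e'" and
    J: "\<And>\<kappa> r b. \<kappa> \<in> PiE {..<N} K' \<Longrightarrow> r \<in> B \<Longrightarrow> b \<in> A \<Longrightarrow> J \<kappa> r b =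
      (\<Sum>s\<in>PiE ?I E. \<alpha> (\<kappa> 0) r b s * (\<Prod>q\<in>?I. \<beta> q (\<kappa> q) (s q) / complex_of_real (sqrt (card (E q)))))"
    using 1 by (elim centralE) blast
  obtain E' \<alpha>' \<beta>' where
    g: "\<And>p. p < N \<Longrightarrow> finite (K' p) \<and> finite (K'' p) \<and> g p \<in> K'' p \<rightarrow> K' p" and
    E': "\<And>q. q \<in> ?I \<Longrightarrow> \<exists>l. card (E' q :: nat set) = 2 ^ l" and
    \<alpha>': "\<And>i b b' s s'. i \<in> K' 0 \<Longrightarrow> b \<in> B \<Longrightarrow> b' \<in> B \<Longrightarrow> s \<in> PiE ?I E' \<Longrightarrow> s' \<in> PiE ?I E' \<Longrightarrow>
      (\<Sum>k | k \<in> K'' 0 \<and> g 0 k = i. \<Sum>r\<in>C. cnj (\<alpha>' k r b s) * \<alpha>' k r b' s') = id_mat b b' * id_mat s s'" and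
    \<beta>': "\<And>q i e e'. q \<in> ?I \<Longrightarrow> i \<in> K' q \<Longrightarrow> e \<in> E' q \<Longrightarrow> e' \<in> E' q \<Longrightarrow>
      (\<Sum>k | k \<in> K'' q \<and> g q k = i. cnj (\<beta>' q k e) * \<beta>' q k e') = id_mat e e'" and
    J': "\<And>\<kappa> r b. \<kappa> \<in> PiE {..<N} K'' \<Longrightarrow> r \<in> C \<Longrightarrow> b \<in> B \<Longrightarrow> J' \<kappa> r b =
      (\<Sum>s\<in>PiE ?I E'. \<alpha>' (\<kappa> 0) r b s * (\<Prod>q\<in>?I. \<beta>' q (\<kappa> q) (s q) / complex_of_real (sqrt (card (E' q)))))"
    using 2 by (elim centralE) blast
  let ?E = "\<lambda>q. prod_encode ` (E q \<times> E' q)"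
  let ?fs = "\<lambda>s. \<lambda>q\<in>?I. fst (prod_decode (s q))" and ?sn = "\<lambda>s. \<lambda>q\<in>?I. snd (prod_decode (s q))"
  have cardE: "card (?E q) = card (E q) * card (E' q)" for q
    by (subst card_image) (auto simp: inj_on_def card_cartesian_product)
  show ?thesis
    unfolding central_def
  proof (intro exI[of _ ?E] conjI ballI allI impI
      exI[of _ "\<lambda>k. \<lambda>r b s. mat_mult B (\<lambda>r x. \<alpha>' k r x (?sn s)) (\<lambda>x b. \<alpha> (g 0 k) x b (?fs s)) r b"]
      exI[of _ "\<lambda>q k e. \<beta> q (g q k) (fst (prod_decode e)) * \<beta>' q k (snd (prod_decode e))"])
    fix p assume "p < N"
    with f g show "finite (K p)" "finite (K'' p)" "f p \<circ> g p \<in> K'' p \<rightarrow> K p" by (auto simp: Pi_iff)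
  next
    fix q assume "q \<in> ?I"
    then obtain l l' where "card (E q) = 2 ^ l" "card (E' q) = 2 ^ l'" using E E' by metis
    then show "\<exists>l. card (?E q) = 2 ^ l" unfolding cardE by (intro exI[of _ "l + l'"]) (simp add: power_add)
  next
    fix q i e e' assume *: "q \<in> ?I" "i \<in> K q" "e \<in> ?E q" "e' \<in> ?E q"
    then obtain a b a' b' where e: "e = prod_encode (a, b)" "e' = prod_encode (a', b')"
      and ab: "a \<in> E q" "b \<in> E' q" "a' \<in> E q" "b' \<in> E' q" by auto
    \<comment> \<open>Completeness is obtained in two stages. For a fixed outcome \<open>k'\<close>
      of the first protocol, the second one sums to an identity matrix; then the first one is
      summed. The same order is used for Alice below.\<close>
    have "(\<Sum>k | k \<in> K'' q \<and> f q (g q k) = i. cnj (\<beta> q (g q k) a * \<beta>' q k b) * (\<beta> q (g q k) a' * \<beta>' q k b'))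
      = (\<Sum>k' | k' \<in> K' q \<and> f q k' = i. \<Sum>k | k \<in> K'' q \<and> g q k = k'.
          cnj (\<beta> q (g q k) a * \<beta>' q k b) * (\<beta> q (g q k) a' * \<beta>' q k b'))"
      using * g[of q] by (intro sum_fibers) auto
    also have "\<dots> = (\<Sum>k' | k' \<in> K' q \<and> f q k' = i. cnj (\<beta> q k' a) * \<beta> q k' a' *
        (\<Sum>k | k \<in> K'' q \<and> g q k = k'. cnj (\<beta>' q k b) * \<beta>' q k b'))"
      unfolding sum_distrib_left by (intro sum.cong refl) (auto simp: mult_ac)
    also have "\<dots> = (\<Sum>k' | k' \<in> K' q \<and> f q k' = i. cnj (\<beta> q k' a) * \<beta> q k' a' * id_mat b b')"
      using * ab by (intro sum.cong refl) (simp add: \<beta>')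
    also have "\<dots> = id_mat a a' * id_mat b b'"
      using * ab by (simp add: sum_distrib_right[symmetric] \<beta>)
    also have "\<dots> = id_mat e e'" by (simp add: e id_mat_def)
    finally show "(\<Sum>k | k \<in> K'' q \<and> (f q \<circ> g q) k = i.
        cnj (\<beta> q (g q k) (fst (prod_decode e)) * \<beta>' q k (snd (prod_decode e))) *
        (\<beta> q (g q k) (fst (prod_decode e')) * \<beta>' q k (snd (prod_decode e')))) = id_mat e e'"
      by (simp add: e)
  next
    fix i b b' s s' assume *: "i \<in> K 0" "b \<in> A" "b' \<in> A" "s \<in> PiE ?I ?E" "s' \<in> PiE ?I ?E"
    have s: "?fs s \<in> PiE ?I E" "?sn s \<in> PiE ?I E'" "?fs s' \<in> PiE ?I E" "?sn s' \<in> PiE ?I E'"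
      using *(4,5) by (force simp: PiE_iff)+
    have "?fs s = ?fs s' \<Longrightarrow> ?sn s = ?sn s' \<Longrightarrow> s q = s' q" if "q \<in> ?I" for q
      using that by (metis (no_types, lifting) restrict_apply' prod_decode_inverse prod.collapse)
    then have ids: "id_mat (?fs s) (?fs s') * id_mat (?sn s) (?sn s') = id_mat s s'"
      using PiE_ext[OF *(4,5)] by (auto simp: id_mat_def simp del: restrict_apply)
    define a where "a k x = \<alpha> k x b (?fs s)" for k x
    define a' where "a' k x = \<alpha> k x b' (?fs s')" for k x
    have "(\<Sum>k | k \<in> K'' 0 \<and> f 0 (g 0 k) = i. \<Sum>r\<in>C.
        cnj (\<Sum>x\<in>B. \<alpha>' k r x (?sn s) * a (g 0 k) x) * (\<Sum>x\<in>B. \<alpha>' k r x (?sn s') * a' (g 0 k) x))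
      = (\<Sum>k' | k' \<in> K' 0 \<and> f 0 k' = i. \<Sum>k | k \<in> K'' 0 \<and> g 0 k = k'. \<Sum>r\<in>C.
        cnj (\<Sum>x\<in>B. \<alpha>' k r x (?sn s) * a (g 0 k) x) * (\<Sum>x\<in>B. \<alpha>' k r x (?sn s') * a' (g 0 k) x))"
      using g[of 0] \<open>N > 0\<close> by (intro sum_fibers) auto
    also have "\<dots> = (\<Sum>k' | k' \<in> K' 0 \<and> f 0 k' = i. \<Sum>x\<in>B. \<Sum>y\<in>B. cnj (a k' x) * a' k' y *
        (\<Sum>k | k \<in> K'' 0 \<and> g 0 k = k'. \<Sum>r\<in>C. cnj (\<alpha>' k r x (?sn s)) * \<alpha>' k r y (?sn s')))"
    proof (intro sum.cong refl)
      fix k'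
      have "(\<Sum>k | k \<in> K'' 0 \<and> g 0 k = k'. \<Sum>r\<in>C.
          cnj (\<Sum>x\<in>B. \<alpha>' k r x (?sn s) * a (g 0 k) x) * (\<Sum>x\<in>B. \<alpha>' k r x (?sn s') * a' (g 0 k) x))
        = (\<Sum>k | k \<in> K'' 0 \<and> g 0 k = k'. \<Sum>r\<in>C. \<Sum>x\<in>B. \<Sum>y\<in>B.
          cnj (a k' x) * a' k' y * (cnj (\<alpha>' k r x (?sn s)) * \<alpha>' k r y (?sn s')))"
        unfolding cnj_sum sum_product by (intro sum.cong refl) (auto simp: mult_ac)
      also have "\<dots> = (\<Sum>x\<in>B. \<Sum>y\<in>B. \<Sum>k | k \<in> K'' 0 \<and> g 0 k = k'. \<Sum>r\<in>C.
          cnj (a k' x) * a' k' y * (cnj (\<alpha>' k r x (?sn s)) * \<alpha>' k r y (?sn s')))"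
        by (subst (2) sum.swap, subst sum.swap, intro sum.cong refl, subst (2) sum.swap, subst sum.swap, rule refl)
      finally show "(\<Sum>k | k \<in> K'' 0 \<and> g 0 k = k'. \<Sum>r\<in>C.
          cnj (\<Sum>x\<in>B. \<alpha>' k r x (?sn s) * a (g 0 k) x) * (\<Sum>x\<in>B. \<alpha>' k r x (?sn s') * a' (g 0 k) x))
        = (\<Sum>x\<in>B. \<Sum>y\<in>B. cnj (a k' x) * a' k' y *
        (\<Sum>k | k \<in> K'' 0 \<and> g 0 k = k'. \<Sum>r\<in>C. cnj (\<alpha>' k r x (?sn s)) * \<alpha>' k r y (?sn s')))"
        by (simp only: sum_distrib_left)
    qed
    also have "\<dots> = (\<Sum>k' | k' \<in> K' 0 \<and> f 0 k' = i. \<Sum>x\<in>B. \<Sum>y\<in>B. cnj (a k' x) * a' k' y *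
        (id_mat x y * id_mat (?sn s) (?sn s')))"
      using s by (intro sum.cong refl) (simp add: \<alpha>')
    also have "\<dots> = (\<Sum>k' | k' \<in> K' 0 \<and> f 0 k' = i. \<Sum>x\<in>B. cnj (a k' x) * a' k' x) * id_mat (?sn s) (?sn s')"
      unfolding sum_distrib_right using \<open>finite B\<close>
      by (intro sum.cong refl) (simp add: id_mat_def if_distrib[where f="\<lambda>x. _ * x"] cong: if_cong)
    also have "\<dots> = id_mat b b' * id_mat s s'"
      unfolding a_def a'_def using * s by (simp add: \<alpha> ids[symmetric])
    finally show "(\<Sum>k | k \<in> K'' 0 \<and> (f 0 \<circ> g 0) k = i. \<Sum>r\<in>C.
        cnj (mat_mult B (\<lambda>r x. \<alpha>' k r x (?sn s)) (\<lambda>x b. \<alpha> (g 0 k) x b (?fs s)) r b) *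
        mat_mult B (\<lambda>r x. \<alpha>' k r x (?sn s')) (\<lambda>x b. \<alpha> (g 0 k) x b (?fs s')) r b') = id_mat b b' * id_mat s s'"
      by (simp add: mat_mult_def a_def a'_def)
  next
    fix \<kappa> r b assume *: "\<kappa> \<in> PiE {..<N} K''" "r \<in> C" "b \<in> A"
    have \<kappa>': "joint_input N g \<kappa> \<in> PiE {..<N} K'" using g by (intro joint_input_in[OF _ *(1)]) auto
    define c where "c q = complex_of_real (sqrt (card (E q)))" for q
    define c' where "c' q = complex_of_real (sqrt (card (E' q)))" for q
    have "(\<Sum>s\<in>PiE ?I ?E. mat_mult B (\<lambda>r x. \<alpha>' (\<kappa> 0) r x (?sn s)) (\<lambda>x b. \<alpha> (g 0 (\<kappa> 0)) x b (?fs s)) r b *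
        (\<Prod>q\<in>?I. \<beta> q (g q (\<kappa> q)) (fst (prod_decode (s q))) * \<beta>' q (\<kappa> q) (snd (prod_decode (s q))) /
          complex_of_real (sqrt (card (?E q)))))
      = (\<Sum>s\<in>PiE ?I E. \<Sum>s'\<in>PiE ?I E'.
          mat_mult B (\<lambda>r x. \<alpha>' (\<kappa> 0) r x s') (\<lambda>x b. \<alpha> (g 0 (\<kappa> 0)) x b s) r b *
          ((\<Prod>q\<in>?I. \<beta> q (g q (\<kappa> q)) (s q) / c q) * (\<Prod>q\<in>?I. \<beta>' q (\<kappa> q) (s' q) / c' q)))"
      unfolding sum_PiE_encode
    proof (intro sum.cong refl arg_cong2[where f="(*)"])
      fix s s' assume s: "s \<in> PiE ?I E" "s' \<in> PiE ?I E'"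
      have fs: "?fs (\<lambda>q\<in>?I. prod_encode (s q, s' q)) = s" and sn: "?sn (\<lambda>q\<in>?I. prod_encode (s q, s' q)) = s'"
        using s by (auto simp: fun_eq_iff PiE_iff extensional_def)
      show "mat_mult B (\<lambda>r x. \<alpha>' (\<kappa> 0) r x (?sn (\<lambda>q\<in>?I. prod_encode (s q, s' q))))
            (\<lambda>x b. \<alpha> (g 0 (\<kappa> 0)) x b (?fs (\<lambda>q\<in>?I. prod_encode (s q, s' q)))) r b
          = mat_mult B (\<lambda>r x. \<alpha>' (\<kappa> 0) r x s') (\<lambda>x b. \<alpha> (g 0 (\<kappa> 0)) x b s) r b"
        unfolding fs sn ..
      show "(\<Prod>q\<in>?I. \<beta> q (g q (\<kappa> q)) (fst (prod_decode ((\<lambda>q\<in>?I. prod_encode (s q, s' q)) q))) *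
            \<beta>' q (\<kappa> q) (snd (prod_decode ((\<lambda>q\<in>?I. prod_encode (s q, s' q)) q))) /
            complex_of_real (sqrt (card (?E q))))
          = (\<Prod>q\<in>?I. \<beta> q (g q (\<kappa> q)) (s q) / c q) * (\<Prod>q\<in>?I. \<beta>' q (\<kappa> q) (s' q) / c' q)"
        unfolding prod.distrib[symmetric] cardE
        by (intro prod.cong refl) (simp add: real_sqrt_mult c_def c'_def)
    qed
    \<comment> \<open>Exchanging the finite sums separates the two contractions, which meet only in
      the middle index \<open>x\<close>.\<close>
    also have "\<dots> = (\<Sum>x\<in>B. (\<Sum>s'\<in>PiE ?I E'. \<alpha>' (\<kappa> 0) r x s' * (\<Prod>q\<in>?I. \<beta>' q (\<kappa> q) (s' q) / c' q)) *
        (\<Sum>s\<in>PiE ?I E. \<alpha> (g 0 (\<kappa> 0)) x b s * (\<Prod>q\<in>?I. \<beta> q (g q (\<kappa> q)) (s q) / c q)))"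
    proof -
      define F where "F s s' x = \<alpha>' (\<kappa> 0) r x s' * (\<Prod>q\<in>?I. \<beta>' q (\<kappa> q) (s' q) / c' q) *
        (\<alpha> (g 0 (\<kappa> 0)) x b s * (\<Prod>q\<in>?I. \<beta> q (g q (\<kappa> q)) (s q) / c q))" for s s' x
      have "(\<Sum>s\<in>PiE ?I E. \<Sum>s'\<in>PiE ?I E'. \<Sum>x\<in>B. F s s' x) = (\<Sum>s\<in>PiE ?I E. \<Sum>x\<in>B. \<Sum>s'\<in>PiE ?I E'. F s s' x)"
        by (intro sum.cong refl) (rule sum.swap)
      also have "\<dots> = (\<Sum>x\<in>B. \<Sum>s\<in>PiE ?I E. \<Sum>s'\<in>PiE ?I E'. F s s' x)"
        by (rule sum.swap)
      also have "\<dots> = (\<Sum>x\<in>B. \<Sum>s'\<in>PiE ?I E'. \<Sum>s\<in>PiE ?I E. F s s' x)"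
        by (rule sum.cong[OF refl], rule sum.swap)
      finally have swap: "(\<Sum>s\<in>PiE ?I E. \<Sum>s'\<in>PiE ?I E'. \<Sum>x\<in>B. F s s' x)
        = (\<Sum>x\<in>B. \<Sum>s'\<in>PiE ?I E'. \<Sum>s\<in>PiE ?I E. F s s' x)" .
      have "mat_mult B (\<lambda>r x. \<alpha>' (\<kappa> 0) r x s') (\<lambda>x b. \<alpha> (g 0 (\<kappa> 0)) x b s) r b *
          ((\<Prod>q\<in>?I. \<beta> q (g q (\<kappa> q)) (s q) / c q) * (\<Prod>q\<in>?I. \<beta>' q (\<kappa> q) (s' q) / c' q)) = (\<Sum>x\<in>B. F s s' x)"
        for s s'
        unfolding mat_mult_def F_def sum_distrib_right by (intro sum.cong refl) (simp only: mult_ac)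
      then show ?thesis
        unfolding sum_product F_def[symmetric] by (simp only: swap)
    qed
    also have "\<dots> = mat_mult B (J' \<kappa>) (J (joint_input N g \<kappa>)) r b"
      unfolding mat_mult_def
    proof (intro sum.cong refl arg_cong2[where f="(*)"])
      fix x assume "x \<in> B"
      show "(\<Sum>s'\<in>PiE ?I E'. \<alpha>' (\<kappa> 0) r x s' * (\<Prod>q\<in>?I. \<beta>' q (\<kappa> q) (s' q) / c' q)) = J' \<kappa> r x"
        using * \<open>x \<in> B\<close> by (simp add: J' c'_def)
      show "(\<Sum>s\<in>PiE ?I E. \<alpha> (g 0 (\<kappa> 0)) x b s * (\<Prod>q\<in>?I. \<beta> q (g q (\<kappa> q)) (s q) / c q)) = J (joint_input N g \<kappa>) x b"
        using * \<open>x \<in> B\<close> \<kappa>' \<open>N > 0\<close> by (simp add: J c_def joint_input_def)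
    qed
    finally show "mat_mult B (J' \<kappa>) (J (joint_input N g \<kappa>)) r b =
        (\<Sum>s\<in>PiE ?I ?E. mat_mult B (\<lambda>r x. \<alpha>' (\<kappa> 0) r x (?sn s)) (\<lambda>x b. \<alpha> (g 0 (\<kappa> 0)) x b (?fs s)) r b *
        (\<Prod>q\<in>?I. \<beta> q (g q (\<kappa> q)) (fst (prod_decode (s q))) * \<beta>' q (\<kappa> q) (snd (prod_decode (s q))) /
          complex_of_real (sqrt (card (?E q)))))" ..
  qed
qed

text \<open>Teleportation to user \<open>p\<close>, the action of \<open>\<Gamma> i\<close> there
  and teleportation back, compressed into one measurement on each side. A label is a pair
  \<open>(f, g)\<close> of basis elements: through \<open>f\<close> the data leaves Alice, on
  \<open>g\<close> it returns. Alice measures her register together with \<open>f\<close> in the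
  error basis and keeps \<open>g\<close> as her new register. The user measures both of its halves
  at once, with \<open>\<Gamma> i\<close> built into the measured vectors. The data therefore
  undergoes an error, \<open>\<Gamma> i\<close> and a second error.\<close>

lemma central_teleport:
  assumes p: "p \<in> {1..<N}" and K: "\<And>q. q < N \<Longrightarrow> finite (K q)"
    and P: "error_basis B Q P" "card B = 2 ^ l"
    and \<Gamma>: "\<And>i. i \<in> K p \<Longrightarrow> isometry_on B B (\<Gamma> i)"
  shows "central N B B K (\<lambda>q. if q = 0 \<or> q = p then prod_encode ` (K q \<times> Q) else K q)
    (\<lambda>q. if q = 0 \<or> q = p then fst \<circ> prod_decode else id)
    (\<lambda>\<kappa> r b. mat_mult B (mat_mult B (P (snd (prod_decode (\<kappa> p)))) (\<Gamma> (fst (prod_decode (\<kappa> p)))))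
      (P (snd (prod_decode (\<kappa> 0)))) r b / (of_nat (card B))\<^sup>2)"
proof -
  let ?I = "{1..<N}"
  note eb = error_basisD[OF P(1)]
  define M where "M = card B"
  \<comment> \<open>Division by \<open>c\<close> turns the completeness relation of the error basis
    into that of a measurement, as \<open>c * c\<close> cancels its factor
    \<open>card B\<close>.\<close>
  define c where "c = complex_of_real (sqrt (real M))"
  have c: "cnj c = c" "c * c = of_nat M" "c \<noteq> 0"
    using eb by (simp_all add: c_def M_def of_real_mult[symmetric] del: of_real_mult)
  have M: "M > 0" using eb by (simp add: M_def)
  have "card (B \<times> B) = M * M" by (simp add: M_def card_cartesian_product)
  then obtain \<phi> where \<phi>: "bij_betw \<phi> {..<M * M} (B \<times> B)"
    using ex_bij_betw_nat_finite[of "B \<times> B"] eb(1) by (auto simp: lessThan_atLeast0)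
  have \<phi>B: "fst (\<phi> e) \<in> B" "snd (\<phi> e) \<in> B" if "e < M * M" for e
    using that bij_betwE[OF \<phi>] by (auto simp: mem_Times_iff)
  have \<phi>inj: "id_mat (fst (\<phi> e)) (fst (\<phi> e')) * id_mat (snd (\<phi> e)) (snd (\<phi> e')) = id_mat e e'"
    if "e < M * M" "e' < M * M" for e e'
    using that bij_betw_imp_inj_on[OF \<phi>] by (auto simp: id_mat_def inj_on_def prod_eq_iff)
  \<comment> \<open>Two registers of size \<open>M\<close> are linked to \<open>p\<close>, one for
    each direction; the other users are idle and get the trivial label set.\<close>
  define E where "E q = (if q = p then {..<M * M} else {0})" for q
  have sE: "s p < M * M" if "s \<in> PiE ?I E" for s
    using PiE_mem[OF that p] by (simp add: E_def)
  have sE_inj: "s = s'" if "s \<in> PiE ?I E" "s' \<in> PiE ?I E" "s p = s' p" for s s'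
  proof (rule PiE_ext[OF that(1,2)])
    fix q assume "q \<in> ?I"
    then show "s q = s' q"
      using PiE_mem[OF that(1), of q] PiE_mem[OF that(2), of q] that(3) by (cases "q = p") (simp_all add: E_def)
  qed
  show ?thesis
    unfolding central_def
  proof (intro exI[of _ E] conjI ballI allI impI
      exI[of _ "\<lambda>k r b s. P (snd (prod_decode k)) (fst (\<phi> (s p))) b * id_mat r (snd (\<phi> (s p))) / c"]
      exI[of _ "\<lambda>q k e. if q = p then mat_mult B (P (snd (prod_decode k))) (\<Gamma> (fst (prod_decode k))) (snd (\<phi> e)) (fst (\<phi> e)) / c else 1"])
    fix q assume "q \<in> ?I"
    show "\<exists>l. card (E q) = 2 ^ l"
    proof (cases "q = p")
      case True
      then show ?thesis by (intro exI[of _ "l + l"]) (simp add: E_def M_def P(2) power_add)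
    next
      case False
      then show ?thesis by (intro exI[of _ 0]) (simp add: E_def)
    qed
  next
    fix i b b' s s' assume *: "i \<in> K 0" "b \<in> B" "b' \<in> B" "s \<in> PiE ?I E" "s' \<in> PiE ?I E"
    define f where "f = fst (\<phi> (s p))" define g where "g = snd (\<phi> (s p))"
    define f' where "f' = fst (\<phi> (s' p))" define g' where "g' = snd (\<phi> (s' p))"
    have fg: "f \<in> B" "g \<in> B" "f' \<in> B" "g' \<in> B"
      using \<phi>B sE * by (auto simp: f_def g_def f'_def g'_def)
    have "id_mat f f' * id_mat g g' = id_mat (s p) (s' p)"
      unfolding f_def g_def f'_def g'_def using * sE by (intro \<phi>inj) auto
    also have "\<dots> = id_mat s s'" using sE_inj *(4,5) by (auto simp: id_mat_def)
    finally have ids: "id_mat f f' * id_mat g g' = id_mat s s'" .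
    have "(\<Sum>j\<in>Q. \<Sum>r\<in>B. cnj (P j f b * id_mat r g / c) * (P j f' b' * id_mat r g' / c))
      = (\<Sum>j\<in>Q. cnj (P j f b) * P j f' b' * id_mat g g' / of_nat M)"
    proof (intro sum.cong refl)
      fix j
      have "(\<Sum>r\<in>B. cnj (P j f b * id_mat r g / c) * (P j f' b' * id_mat r g' / c))
        = (\<Sum>r\<in>B. if r = g then cnj (P j f b) * P j f' b' * id_mat g g' / of_nat M else 0)"
        by (intro sum.cong refl) (auto simp: id_mat_def c)
      then show "(\<Sum>r\<in>B. cnj (P j f b * id_mat r g / c) * (P j f' b' * id_mat r g' / c))
        = cnj (P j f b) * P j f' b' * id_mat g g' / of_nat M"
        using fg eb(1) by simp
    qed
    also have "\<dots> = (\<Sum>j\<in>Q. cnj (P j f b) * P j f' b') * id_mat g g' / of_nat M"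
      by (simp add: sum_distrib_right sum_divide_distrib)
    also have "\<dots> = id_mat b b' * id_mat s s'"
      using fg * M eb(6) by (simp add: ids[symmetric] M_def)
    finally show "(\<Sum>k | k \<in> (if (0::nat) = 0 \<or> 0 = p then prod_encode ` (K 0 \<times> Q) else K 0) \<and>
        (if (0::nat) = 0 \<or> 0 = p then fst \<circ> prod_decode else id) k = i.
      \<Sum>r\<in>B. cnj (P (snd (prod_decode k)) (fst (\<phi> (s p))) b * id_mat r (snd (\<phi> (s p))) / c) *
        (P (snd (prod_decode k)) (fst (\<phi> (s' p))) b' * id_mat r (snd (\<phi> (s' p))) / c)) = id_mat b b' * id_mat s s'"
      using *(1) by (simp add: sum_encode_fiber f_def g_def f'_def g'_def)
  next
    fix q i e e' assume *: "q \<in> ?I" "i \<in> K q" "e \<in> E q" "e' \<in> E q"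
    show "(\<Sum>k | k \<in> (if q = 0 \<or> q = p then prod_encode ` (K q \<times> Q) else K q) \<and>
        (if q = 0 \<or> q = p then fst \<circ> prod_decode else id) k = i.
      cnj (if q = p then mat_mult B (P (snd (prod_decode k))) (\<Gamma> (fst (prod_decode k))) (snd (\<phi> e)) (fst (\<phi> e)) / c else 1) *
      (if q = p then mat_mult B (P (snd (prod_decode k))) (\<Gamma> (fst (prod_decode k))) (snd (\<phi> e')) (fst (\<phi> e')) / c else 1))
      = id_mat e e'"
    proof (cases "q = p")
      case False
      moreover have "{k \<in> K q. k = i} = {i}" using * by auto
      ultimately show ?thesis using * by (simp add: E_def id_mat_def)
    next
      case True
      with * have e: "e < M * M" "e' < M * M" "i \<in> K p" by (simp_all add: E_def)
      define f where "f = fst (\<phi> e)" define g where "g = snd (\<phi> e)"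
      define f' where "f' = fst (\<phi> e')" define g' where "g' = snd (\<phi> e')"
      have fg: "f \<in> B" "g \<in> B" "f' \<in> B" "g' \<in> B"
        using \<phi>B e by (auto simp: f_def g_def f'_def g'_def)
      have "(\<Sum>j\<in>Q. cnj (mat_mult B (P j) (\<Gamma> i) g f / c) * (mat_mult B (P j) (\<Gamma> i) g' f' / c))
        = (\<Sum>j\<in>Q. \<Sum>x\<in>B. \<Sum>y\<in>B. cnj (\<Gamma> i x f) * \<Gamma> i y f' * (cnj (P j g x) * P j g' y) / of_nat M)"
      proof (intro sum.cong refl)
        fix j
        have "cnj (mat_mult B (P j) (\<Gamma> i) g f / c) * (mat_mult B (P j) (\<Gamma> i) g' f' / c)
          = cnj (mat_mult B (P j) (\<Gamma> i) g f) * mat_mult B (P j) (\<Gamma> i) g' f' / of_nat M"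
          by (simp add: c)
        also have "\<dots> = (\<Sum>x\<in>B. \<Sum>y\<in>B. cnj (\<Gamma> i x f) * \<Gamma> i y f' * (cnj (P j g x) * P j g' y) / of_nat M)"
          unfolding mat_mult_def cnj_sum sum_product sum_divide_distrib by (intro sum.cong refl) (simp add: mult_ac)
        finally show "cnj (mat_mult B (P j) (\<Gamma> i) g f / c) * (mat_mult B (P j) (\<Gamma> i) g' f' / c)
          = (\<Sum>x\<in>B. \<Sum>y\<in>B. cnj (\<Gamma> i x f) * \<Gamma> i y f' * (cnj (P j g x) * P j g' y) / of_nat M)" .
      qed
      also have "\<dots> = (\<Sum>x\<in>B. \<Sum>y\<in>B. cnj (\<Gamma> i x f) * \<Gamma> i y f' * (\<Sum>j\<in>Q. cnj (P j g x) * P j g' y) / of_nat M)"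
        by (subst sum.swap, intro sum.cong refl, subst sum.swap) (simp add: sum_distrib_left sum_divide_distrib)
      also have "\<dots> = (\<Sum>x\<in>B. \<Sum>y\<in>B. cnj (\<Gamma> i x f) * \<Gamma> i y f' * (id_mat g g' * id_mat x y))"
        using fg M by (intro sum.cong refl) (simp add: eb(6) M_def)
      also have "\<dots> = (\<Sum>x\<in>B. cnj (\<Gamma> i x f) * \<Gamma> i x f') * id_mat g g'"
        unfolding sum_distrib_right using eb(1)
        by (intro sum.cong refl) (simp add: id_mat_def if_distrib[where f="\<lambda>x. _ * x"] cong: if_cong)
      also have "\<dots> = id_mat f f' * id_mat g g'"
        using fg \<Gamma>[OF e(3)] by (simp add: isometry_onD)
      also have "\<dots> = id_mat e e'"
        unfolding f_def g_def f'_def g'_def using e by (intro \<phi>inj)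
      finally show ?thesis
        using True p e(3) by (simp add: sum_encode_fiber f_def g_def f'_def g'_def)
    qed
  next
    fix \<kappa> r b assume *: "\<kappa> \<in> PiE {..<N} (\<lambda>q. if q = 0 \<or> q = p then prod_encode ` (K q \<times> Q) else K q)" "r \<in> B" "b \<in> B"
    define k where "k = snd (prod_decode (\<kappa> 0))"
    define S where "S = mat_mult B (P (snd (prod_decode (\<kappa> p)))) (\<Gamma> (fst (prod_decode (\<kappa> p))))"
    have card1: "card (E p) = M * M" by (simp add: E_def)
    \<comment> \<open>The scalar \<open>1 / M^2\<close> is made up of a factor \<open>1 / c\<close>
      from each of the two measurements and \<open>1 / M\<close> from the entangled state on
      \<open>M * M\<close> labels.\<close>
    have "(\<Sum>s\<in>PiE ?I E. P k (fst (\<phi> (s p))) b * id_mat r (snd (\<phi> (s p))) / c *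
        (\<Prod>q\<in>?I. (if q = p then mat_mult B (P (snd (prod_decode (\<kappa> q)))) (\<Gamma> (fst (prod_decode (\<kappa> q)))) (snd (\<phi> (s q))) (fst (\<phi> (s q))) / c else 1) /
          complex_of_real (sqrt (card (E q)))))
      = (\<Sum>s\<in>PiE ?I E. S (snd (\<phi> (s p))) (fst (\<phi> (s p))) * P k (fst (\<phi> (s p))) b * id_mat r (snd (\<phi> (s p))) / (of_nat M)\<^sup>2)"
    proof (intro sum.cong refl)
      fix s
      have "(\<Prod>q\<in>?I. (if q = p then mat_mult B (P (snd (prod_decode (\<kappa> q)))) (\<Gamma> (fst (prod_decode (\<kappa> q)))) (snd (\<phi> (s q))) (fst (\<phi> (s q))) / c else 1) /
          complex_of_real (sqrt (card (E q)))) = (\<Prod>q\<in>?I. if q = p then S (snd (\<phi> (s p))) (fst (\<phi> (s p))) / c / of_nat M else 1)"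
        by (intro prod.cong refl) (auto simp: S_def E_def real_sqrt_mult)
      also have "\<dots> = S (snd (\<phi> (s p))) (fst (\<phi> (s p))) / c / of_nat M" using p by simp
      finally show "P k (fst (\<phi> (s p))) b * id_mat r (snd (\<phi> (s p))) / c *
        (\<Prod>q\<in>?I. (if q = p then mat_mult B (P (snd (prod_decode (\<kappa> q)))) (\<Gamma> (fst (prod_decode (\<kappa> q)))) (snd (\<phi> (s q))) (fst (\<phi> (s q))) / c else 1) /
          complex_of_real (sqrt (card (E q))))
        = S (snd (\<phi> (s p))) (fst (\<phi> (s p))) * P k (fst (\<phi> (s p))) b * id_mat r (snd (\<phi> (s p))) / (of_nat M)\<^sup>2"
        using c M by (simp add: power2_eq_square mult_ac)
    qed
    also have "\<dots> = (\<Sum>e<M * M. S (snd (\<phi> e)) (fst (\<phi> e)) * P k (fst (\<phi> e)) b * id_mat r (snd (\<phi> e)) / (of_nat M)\<^sup>2)"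
    proof (rule sum.reindex_bij_witness[where j="\<lambda>s. s p" and i="\<lambda>e. \<lambda>q\<in>?I. if q = p then e else 0"])
      fix e assume "e \<in> {..<M * M}"
      with p show "(\<lambda>q\<in>?I. if q = p then e else 0) \<in> PiE ?I E" by (auto simp: E_def)
    next
      fix s assume s: "s \<in> PiE ?I E"
      then have "(\<lambda>q\<in>?I. if q = p then s p else 0) \<in> PiE ?I E"
        using sE[OF s] by (auto simp: E_def)
      then show "(\<lambda>q\<in>?I. if q = p then s p else 0) = s" using s p by (intro sE_inj) auto
    qed (use p sE in auto)
    also have "\<dots> = (\<Sum>(f, g)\<in>B \<times> B. S g f * P k f b * id_mat r g / (of_nat M)\<^sup>2)"
      using sum.reindex_bij_betw[OF \<phi>, of "\<lambda>(f, g). S g f * P k f b * id_mat r g / (of_nat M)\<^sup>2"]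
      by (simp add: case_prod_beta)
    also have "\<dots> = mat_mult B S (P k) r b / (of_nat M)\<^sup>2"
      unfolding sum.cartesian_product[symmetric] mat_mult_def sum_divide_distrib
    proof (intro sum.cong refl)
      fix f
      have "(\<Sum>g\<in>B. S g f * P k f b * id_mat r g / (of_nat M)\<^sup>2) = (\<Sum>g\<in>B. if g = r then S r f * P k f b / (of_nat M)\<^sup>2 else 0)"
        by (intro sum.cong refl) (auto simp: id_mat_def)
      then show "(\<Sum>g\<in>B. S g f * P k f b * id_mat r g / (of_nat M)\<^sup>2) = S r f * P k f b / (of_nat M)\<^sup>2"
        using * eb(1) by simp
    qed
    finally show "mat_mult B (mat_mult B (P (snd (prod_decode (\<kappa> p)))) (\<Gamma> (fst (prod_decode (\<kappa> p)))))
      (P (snd (prod_decode (\<kappa> 0)))) r b / (of_nat (card B))\<^sup>2 =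
      (\<Sum>s\<in>PiE ?I E. P (snd (prod_decode (\<kappa> 0))) (fst (\<phi> (s p))) b * id_mat r (snd (\<phi> (s p))) / c *
        (\<Prod>q\<in>?I. (if q = p then mat_mult B (P (snd (prod_decode (\<kappa> q)))) (\<Gamma> (fst (prod_decode (\<kappa> q)))) (snd (\<phi> (s q))) (fst (\<phi> (s q))) / c else 1) /
          complex_of_real (sqrt (card (E q)))))"
      by (simp add: k_def S_def M_def)
  qed (use K p eb(3) in \<open>auto split: if_splits\<close>)
qed

section \<open>Routing data through registers\<close>

text \<open>The content of register \<open>c\<close> suffers \<open>T c\<close> and ends up in
  register \<open>\<pi> c\<close>. Errors are indexed by the place where the content starts, so that
  they can be followed along a route.\<close>

definition perm_tens :: "'c set \<Rightarrow> ('c \<Rightarrow> 'c) \<Rightarrow> ('c \<Rightarrow> 'd \<Rightarrow> 'd \<Rightarrow> complex) \<Rightarrow> ('c \<Rightarrow> 'd) \<Rightarrow> ('c \<Rightarrow> 'd) \<Rightarrow> complex"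
  where "perm_tens C \<pi> T m' m = (\<Prod>c\<in>C. T c (m' (\<pi> c)) (m c))"

lemma perm_tens_id: "(\<And>c. c \<in> C \<Longrightarrow> \<pi> c = c) \<Longrightarrow> perm_tens C \<pi> T m' m = tens C T m' m"
  by (simp add: perm_tens_def tens_def)

lemma perm_tens_eq_tens: "perm_tens C \<pi> T m' m = tens C T (\<lambda>c\<in>C. m' (\<pi> c)) m"
  by (simp add: perm_tens_def tens_def)

lemma sum_PiE_permute:
  assumes "bij_betw \<pi> C C"
  shows "(\<Sum>x\<in>C \<rightarrow>\<^sub>E D. F (\<lambda>c\<in>C. x (\<pi> c))) = (\<Sum>x\<in>C \<rightarrow>\<^sub>E D. F x)"
proof (rule sum.reindex_bij_witness[where j="\<lambda>x. \<lambda>c\<in>C. x (\<pi> c)" and i="\<lambda>x. \<lambda>c\<in>C. x (inv_into C \<pi> c)"])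
  have \<pi>: "\<pi> c \<in> C" "inv_into C \<pi> c \<in> C" "inv_into C \<pi> (\<pi> c) = c" "\<pi> (inv_into C \<pi> c) = c" if "c \<in> C" for c
    using assms that bij_betwE[OF bij_betw_inv_into[OF assms]] bij_betwE[OF assms]
    by (auto simp: bij_betw_inv_into_left bij_betw_inv_into_right)
  fix x assume "x \<in> C \<rightarrow>\<^sub>E D"
  then show "(\<lambda>c\<in>C. (\<lambda>c\<in>C. x (\<pi> c)) (inv_into C \<pi> c)) = x" "(\<lambda>c\<in>C. (\<lambda>c\<in>C. x (inv_into C \<pi> c)) (\<pi> c)) = x"
    "(\<lambda>c\<in>C. x (\<pi> c)) \<in> C \<rightarrow>\<^sub>E D" "(\<lambda>c\<in>C. x (inv_into C \<pi> c)) \<in> C \<rightarrow>\<^sub>E D"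
    using \<pi> by (auto simp: PiE_iff extensional_def fun_eq_iff)
qed simp

text \<open>Follow the content that starts in \<open>c\<close>: the second operator finds it in
  \<open>\<pi> c\<close> and acts on it by \<open>T' (\<pi> c)\<close>. Reindexing the intermediate
  sum along \<open>\<pi>\<close> leaves an ordinary product of tensor products.\<close>

lemma mat_mult_perm_tens:
  assumes "finite C" "finite D" "bij_betw \<pi> C C"
  shows "mat_mult (C \<rightarrow>\<^sub>E D) (perm_tens C \<pi>' T') (perm_tens C \<pi> T) m' m = perm_tens C (\<pi>' \<circ> \<pi>) (\<lambda>c. mat_mult D (T' (\<pi> c)) (T c)) m' m"
proof -
  have "perm_tens C \<pi>' T' m' x = tens C (T' \<circ> \<pi>) (\<lambda>c. m' (\<pi>' (\<pi> c))) (\<lambda>c\<in>C. x (\<pi> c))" for x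
    unfolding perm_tens_def tens_def
    using prod.reindex_bij_betw[OF assms(3), of "\<lambda>c. T' c (m' (\<pi>' c)) (x c)"] by simp
  then have "mat_mult (C \<rightarrow>\<^sub>E D) (perm_tens C \<pi>' T') (perm_tens C \<pi> T) m' m
    = (\<Sum>x\<in>C \<rightarrow>\<^sub>E D. tens C (T' \<circ> \<pi>) (\<lambda>c. m' (\<pi>' (\<pi> c))) (\<lambda>c\<in>C. x (\<pi> c)) * tens C T (\<lambda>c\<in>C. x (\<pi> c)) m)"
    by (simp add: mat_mult_def perm_tens_eq_tens[of C \<pi>])
  also have "\<dots> = mat_mult (C \<rightarrow>\<^sub>E D) (tens C (T' \<circ> \<pi>)) (tens C T) (\<lambda>c. m' (\<pi>' (\<pi> c))) m"
    unfolding mat_mult_def by (rule sum_PiE_permute[OF assms(3)])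
  finally show ?thesis
    using assms by (simp add: mat_mult_tens) (simp add: perm_tens_def tens_def)
qed

lemma isometry_on_perm_tens:
  assumes "finite C" "finite D" "bij_betw \<pi> C C" "\<And>c. c \<in> C \<Longrightarrow> isometry_on D D (T c)"
  shows "isometry_on (C \<rightarrow>\<^sub>E D) (C \<rightarrow>\<^sub>E D) (perm_tens C \<pi> T)"
  unfolding isometry_on_def
proof (intro ballI)
  fix i j assume "i \<in> C \<rightarrow>\<^sub>E D" "j \<in> C \<rightarrow>\<^sub>E D"
  moreover have "(\<Sum>r\<in>C \<rightarrow>\<^sub>E D. cnj (perm_tens C \<pi> T r i) * perm_tens C \<pi> T r j)
      = (\<Sum>r\<in>C \<rightarrow>\<^sub>E D. cnj (tens C T r i) * tens C T r j)"
    unfolding perm_tens_eq_tens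
    by (rule sum_PiE_permute[OF assms(3), where F="\<lambda>x. cnj (tens C T x i) * tens C T x j"])
  moreover have "isometry_on (C \<rightarrow>\<^sub>E D) (C \<rightarrow>\<^sub>E D) (tens C T)" using assms by (intro isometry_on_tens) auto
  ultimately show "(\<Sum>r\<in>C \<rightarrow>\<^sub>E D. cnj (perm_tens C \<pi> T r i) * perm_tens C \<pi> T r j) = id_mat i j"
    by (simp add: isometry_onD)
qed

text \<open>
  Registers are labelled by the possible joint inputs of the users.  A user moves the data along
  its own coordinate of the label, from the default value to its actual input.
\<close>

definition swap_coord :: "(nat \<Rightarrow> nat) \<Rightarrow> nat \<Rightarrow> nat \<Rightarrow> (nat \<Rightarrow> nat) \<Rightarrow> nat \<Rightarrow> nat"
  where "swap_coord k0 p i c = c(p := Transposition.transpose (k0 p) i (c p))"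

definition route :: "nat \<Rightarrow> (nat \<Rightarrow> nat) \<Rightarrow> nat \<Rightarrow> (nat \<Rightarrow> nat) \<Rightarrow> (nat \<Rightarrow> nat) \<Rightarrow> nat \<Rightarrow> nat"
  where "route N k0 q z c = (\<lambda>p\<in>{1..<N}. if p < q then Transposition.transpose (k0 p) (z p) (c p) else c p)"

lemma transpose_in: "a \<in> A \<Longrightarrow> b \<in> A \<Longrightarrow> x \<in> A \<Longrightarrow> Transposition.transpose a b x \<in> A"
  by (auto simp: Transposition.transpose_def)

lemma swap_coord_bij:
  assumes "p \<in> {1..<N}" "k0 \<in> PiE {1..<N} R" "i \<in> R p"
  shows "bij_betw (swap_coord k0 p i) (PiE {1..<N} R) (PiE {1..<N} R)"
proof (rule bij_betwI[where g="swap_coord k0 p i"])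
  have "swap_coord k0 p i c \<in> PiE {1..<N} R" if "c \<in> PiE {1..<N} R" for c
    using that assms by (auto simp: swap_coord_def PiE_iff extensional_def intro!: transpose_in)
  then show "swap_coord k0 p i \<in> PiE {1..<N} R \<rightarrow> PiE {1..<N} R" by auto
  then show "swap_coord k0 p i \<in> PiE {1..<N} R \<rightarrow> PiE {1..<N} R" .
qed (simp_all add: swap_coord_def)

lemma route_one: "c \<in> PiE {1..<N} R \<Longrightarrow> route N k0 1 z c = c"
  by (auto simp: route_def PiE_iff extensional_def fun_eq_iff)

text \<open>\<open>route\<close> with parameter \<open>q\<close> describes the state of affairs
  before the visit to \<open>q\<close>, whence its strict \<open>p < q\<close>. Different users
  change different coordinates, so each can act on its own input alone.\<close>

lemma swap_coord_route: "q \<in> {1..<N} \<Longrightarrow> swap_coord k0 q (z q) (route N k0 q z c) = route N k0 (Suc q) z c"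
  by (auto simp: route_def swap_coord_def fun_eq_iff)

lemma route_in:
  assumes "k0 \<in> PiE {1..<N} R" "\<And>p. p \<in> {1..<N} \<Longrightarrow> z p \<in> R p" "c \<in> PiE {1..<N} R"
  shows "route N k0 q z c \<in> PiE {1..<N} R"
  using assms by (auto simp: route_def PiE_iff intro!: transpose_in)

text \<open>Every coordinate is changed by a transposition, so a repeated pass restores all labels.
  The second pass of a round brings the state home in this way.\<close>

lemma route_route: "c \<in> PiE {1..<N} R \<Longrightarrow> route N k0 q z (route N k0 q z c) = c"
  by (auto simp: route_def PiE_iff extensional_def fun_eq_iff)

lemma route_bij:
  assumes "k0 \<in> PiE {1..<N} R" "\<And>p. p \<in> {1..<N} \<Longrightarrow> z p \<in> R p"
  shows "bij_betw (route N k0 q z) (PiE {1..<N} R) (PiE {1..<N} R)"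
  using route_in[OF assms] route_route[of _ N R]
  by (intro bij_betwI[where g="route N k0 q z"]) auto

text \<open>The state starts in register \<open>k0\<close>; after a complete pass the label of its
  register spells out the data of the users.\<close>

lemma route_start: "route N k0 N z k0 = (\<lambda>p\<in>{1..<N}. z p)"
  by (auto simp: route_def fun_eq_iff)

lemma route_cong: "(\<And>p. p \<in> {1..<N} \<Longrightarrow> z p = z' p) \<Longrightarrow> route N k0 q z c = route N k0 q z' c"
  by (auto simp: route_def fun_eq_iff)

text \<open>The entries at other registers are free, so a prescribed entry at \<open>c\<close>
  occurs in the fraction \<open>1 / card Q\<close> of all error families, however large
  \<open>C\<close> is. This is the source of the bound that does not depend on the number of
  registers.\<close>

lemma card_PiE_fixed:
  assumes "finite C" "c \<in> C" "e \<in> Q"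
  shows "card {k \<in> C \<rightarrow>\<^sub>E Q. k c = e} * card Q = card (C \<rightarrow>\<^sub>E Q)"
proof -
  have "{k \<in> C \<rightarrow>\<^sub>E Q. k c = e} = PiE C (\<lambda>x. if x = c then {e} else Q)"
    using assms by (auto simp: PiE_iff extensional_def split: if_splits)
  then have "card {k \<in> C \<rightarrow>\<^sub>E Q. k c = e} = (\<Prod>x\<in>C. card (if x = c then {e} else Q))"
    using assms by (simp add: card_PiE)
  also have "\<dots> = (\<Prod>x\<in>C - {c}. card Q)"
    using assms by (subst prod.remove[of _ c]) (auto intro!: prod.cong)
  also have "\<dots> * card Q = (\<Prod>x\<in>C. card Q)"
    using assms by (simp only: prod.remove[of C c] mult.commute)
  finally show ?thesis using assms by (simp add: card_PiE)
qed

text \<open>Given the joint input \<open>z\<close>, only Alice and \<open>p\<close> learn something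
  new, one element of \<open>A\<close> each. Sums over outcomes thereby become counts of
  pairs.\<close>

lemma bij_betw_two_outcomes:
  fixes A :: "nat set"
  assumes p: "p \<in> {1..<N}" and z: "z \<in> PiE {..<N} K"
  shows "bij_betw (\<lambda>x. \<lambda>q\<in>{..<N}. if q = 0 then prod_encode (z 0, fst x)
      else if q = p then prod_encode (z p, snd x) else z q) (A \<times> A)
    {\<kappa> \<in> PiE {..<N} (\<lambda>q. if q = 0 \<or> q = p then prod_encode ` (K q \<times> A) else K q).
      joint_input N (\<lambda>q. if q = 0 \<or> q = p then fst \<circ> prod_decode else id) \<kappa> = z}"
    (is "bij_betw ?F _ {\<kappa> \<in> PiE _ ?K'. joint_input N ?f \<kappa> = z}")
proof (rule bij_betwI[where g="\<lambda>\<kappa>. (snd (prod_decode (\<kappa> 0)), snd (prod_decode (\<kappa> p)))"])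
  have zK: "z q \<in> K q" if "q < N" for q using z that by auto
  have "?F x \<in> PiE {..<N} ?K'" "joint_input N ?f (?F x) = z" if x: "x \<in> A \<times> A" for x
  proof -
    show "?F x \<in> PiE {..<N} ?K'"
    proof (rule PiE_I)
      fix q assume "q \<in> {..<N}"
      then show "?F x q \<in> ?K' q" using x zK by (cases "q = 0"; cases "q = p") auto
    qed simp
    show "joint_input N ?f (?F x) = z"
      using z by (intro extensionalityI[of _ "{..<N}"]) (auto simp: joint_input_def PiE_iff)
  qed
  then show "?F \<in> A \<times> A \<rightarrow> {\<kappa> \<in> PiE {..<N} ?K'. joint_input N ?f \<kappa> = z}" by blast
  show "(\<lambda>\<kappa>. (snd (prod_decode (\<kappa> 0)), snd (prod_decode (\<kappa> p)))) \<in>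
      {\<kappa> \<in> PiE {..<N} ?K'. joint_input N ?f \<kappa> = z} \<rightarrow> A \<times> A"
  proof
    fix \<kappa> assume "\<kappa> \<in> {\<kappa> \<in> PiE {..<N} ?K'. joint_input N ?f \<kappa> = z}"
    then have "\<kappa> \<in> PiE {..<N} ?K'" by blast
    then have "\<kappa> 0 \<in> ?K' 0" "\<kappa> p \<in> ?K' p" by (rule PiE_mem, use p in simp)+
    then show "(snd (prod_decode (\<kappa> 0)), snd (prod_decode (\<kappa> p))) \<in> A \<times> A" by auto
  qed
  show "(snd (prod_decode (?F x 0)), snd (prod_decode (?F x p))) = x" for x
    using p by simp
  show "?F (snd (prod_decode (\<kappa> 0)), snd (prod_decode (\<kappa> p))) = \<kappa>"
    if "\<kappa> \<in> {\<kappa> \<in> PiE {..<N} ?K'. joint_input N ?f \<kappa> = z}" for \<kappa>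
  proof (rule extensionalityI[of _ "{..<N}"])
    have \<kappa>: "\<kappa> \<in> PiE {..<N} ?K'" "joint_input N ?f \<kappa> = z" using that by blast+
    then show "\<kappa> \<in> extensional {..<N}" by (simp add: PiE_iff)
    fix q assume q: "q \<in> {..<N}"
    have "?f q (\<kappa> q) = z q" unfolding \<kappa>(2)[symmetric] using q by (simp add: joint_input_def)
    moreover have "prod_encode (z q, snd (prod_decode (\<kappa> q))) = \<kappa> q" if "fst (prod_decode (\<kappa> q)) = z q"
      unfolding that[symmetric] by simp
    ultimately show "?F (snd (prod_decode (\<kappa> 0)), snd (prod_decode (\<kappa> p))) q = \<kappa> q"
      using q by (cases "q = 0"; cases "q = p") auto
  qed simp
qed

text \<open>\<open>L\<close> stands for the operators that the final corrections can undo. It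
  contains the error basis and is closed under products, so it absorbs whatever errors come after
  the wanted unitary; its unitarity keeps the operator applied so far invertible for later rounds.
  That \<open>card D\<close> is a power of 2 allows EPR pairs to carry the registers.\<close>

locale local_corrections =
  fixes N :: nat and D :: "'d set" and Q :: "'k set" and P :: "'k \<Rightarrow> 'd \<Rightarrow> 'd \<Rightarrow> complex"
    and L :: "('d \<Rightarrow> 'd \<Rightarrow> complex) \<Rightarrow> bool"
  assumes N: "N > 0" and P: "error_basis D Q P" and card_D: "\<exists>l. card D = 2 ^ l"
    and L_P: "k \<in> Q \<Longrightarrow> L (P k)"
    and L_mat_mult: "L S \<Longrightarrow> L T \<Longrightarrow> L (mat_mult D S T)"
    and L_cong: "L S \<Longrightarrow> (\<And>r b. r \<in> D \<Longrightarrow> b \<in> D \<Longrightarrow> T r b = S r b) \<Longrightarrow> L T"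
    and L_unitary: "L S \<Longrightarrow> unitary_on D S"
begin

lemma finite_D: "finite D" and D_ne: "D \<noteq> {}" and finite_Q: "finite Q"
  using error_basisD[OF P] by auto

lemma L_id_mat: "L id_mat"
proof -
  obtain k where "k \<in> Q" "\<forall>r\<in>D. \<forall>c\<in>D. P k r c = id_mat r c" using P unfolding error_basis_def by blast
  then show ?thesis by (intro L_cong[OF L_P[of k]]) auto
qed

definition is_id :: "('d \<Rightarrow> 'd \<Rightarrow> complex) \<Rightarrow> bool"
  where "is_id T \<longleftrightarrow> (\<forall>r\<in>D. \<forall>b\<in>D. T r b = id_mat r b)"

lemma is_id_mat_mult: "is_id S \<Longrightarrow> is_id T \<Longrightarrow> is_id (mat_mult D S T)"
  unfolding is_id_def
proof (intro ballI)
  fix r b assume *: "\<forall>r\<in>D. \<forall>b\<in>D. S r b = id_mat r b" "\<forall>r\<in>D. \<forall>b\<in>D. T r b = id_mat r b" "r \<in> D" "b \<in> D"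
  then have "mat_mult D S T r b = mat_mult D id_mat id_mat r b" by (intro mat_mult_cong) auto
  then show "mat_mult D S T r b = id_mat r b" using * finite_D by (simp add: mat_mult_id_mat_left)
qed

text \<open>The probability that a given content is teleported to a user and back without error:
  each of the two outcomes on its register is one of \<open>(card D)^2\<close> equally likely
  ones.\<close>

definition \<eta> :: real
  where "\<eta> = 1 / (card D) ^ 4"

lemma \<eta>: "0 < \<eta>" "\<eta> \<le> 1"
  using error_basisD[OF P] by (auto simp: \<eta>_def)

text \<open>
  In a routing, \<open>n\<close> counts teleportations.  The lower bound on the probability that the data suffers
  no error is independent of the number of registers.
\<close>

definition routing :: "(nat \<Rightarrow> nat) set \<Rightarrow> nat \<Rightarrow> (nat \<Rightarrow> nat set) \<Rightarrow> (nat \<Rightarrow> nat set) \<Rightarrow> (nat \<Rightarrow> nat \<Rightarrow> nat) \<Rightarrow>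
    ((nat \<Rightarrow> nat) \<Rightarrow> (nat \<Rightarrow> nat) \<Rightarrow> nat \<Rightarrow> nat) \<Rightarrow> ((nat \<Rightarrow> nat) \<Rightarrow> complex) \<Rightarrow>
    ((nat \<Rightarrow> nat) \<Rightarrow> (nat \<Rightarrow> nat) \<Rightarrow> 'd \<Rightarrow> 'd \<Rightarrow> complex) \<Rightarrow> bool"
  where "routing C n K K' f \<pi> a T \<longleftrightarrow>
    central N (C \<rightarrow>\<^sub>E D) (C \<rightarrow>\<^sub>E D) K K' f
      (\<lambda>\<kappa> m' m. a \<kappa> * perm_tens C (\<pi> (joint_input N f \<kappa>)) (T \<kappa>) m' m) \<and>
    (\<forall>\<kappa>\<in>PiE {..<N} K'. \<forall>c\<in>C. L (T \<kappa> c)) \<and>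
    (\<forall>z\<in>PiE {..<N} K. (\<Sum>\<kappa> | \<kappa> \<in> PiE {..<N} K' \<and> joint_input N f \<kappa> = z. (cmod (a \<kappa>))\<^sup>2) = 1) \<and>
    (\<forall>z\<in>PiE {..<N} K. \<forall>c\<in>C.
      (\<Sum>\<kappa> | \<kappa> \<in> PiE {..<N} K' \<and> joint_input N f \<kappa> = z \<and> is_id (T \<kappa> c). (cmod (a \<kappa>))\<^sup>2) \<ge> \<eta> ^ n)"

lemma routingD:
  assumes "routing C n K K' f \<pi> a T"
  shows "central N (C \<rightarrow>\<^sub>E D) (C \<rightarrow>\<^sub>E D) K K' f
      (\<lambda>\<kappa> m' m. a \<kappa> * perm_tens C (\<pi> (joint_input N f \<kappa>)) (T \<kappa>) m' m)"
    and "\<And>\<kappa> c. \<kappa> \<in> PiE {..<N} K' \<Longrightarrow> c \<in> C \<Longrightarrow> L (T \<kappa> c)"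
    and "\<And>z. z \<in> PiE {..<N} K \<Longrightarrow>
      (\<Sum>\<kappa> | \<kappa> \<in> PiE {..<N} K' \<and> joint_input N f \<kappa> = z. (cmod (a \<kappa>))\<^sup>2) = 1"
    and "\<And>z c. z \<in> PiE {..<N} K \<Longrightarrow> c \<in> C \<Longrightarrow>
      (\<Sum>\<kappa> | \<kappa> \<in> PiE {..<N} K' \<and> joint_input N f \<kappa> = z \<and> is_id (T \<kappa> c). (cmod (a \<kappa>))\<^sup>2) \<ge> \<eta> ^ n"
  using assms unfolding routing_def by blast+

section \<open>Elementary routings and their composition\<close>

lemma routing_id:
  assumes "\<And>p. p < N \<Longrightarrow> finite (K p)" "finite C" "\<And>z c. c \<in> C \<Longrightarrow> \<pi> z c = c"
  shows "routing C 0 K K (\<lambda>p. id) \<pi> (\<lambda>\<kappa>. 1) (\<lambda>\<kappa> c. id_mat)"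
  unfolding routing_def
proof (intro conjI ballI)
  have "central N (C \<rightarrow>\<^sub>E D) (C \<rightarrow>\<^sub>E D) K K (\<lambda>p. id) (\<lambda>\<kappa>. id_mat)"
    using assms finite_D N by (intro central_alice_isometry isometry_on_id_mat finite_PiE)
  then show "central N (C \<rightarrow>\<^sub>E D) (C \<rightarrow>\<^sub>E D) K K (\<lambda>p. id)
      (\<lambda>\<kappa> m' m. 1 * perm_tens C (\<pi> (joint_input N (\<lambda>p. id) \<kappa>)) (\<lambda>c. id_mat) m' m)"
  proof (rule central_cong)
    fix \<kappa> m' m assume "m' \<in> C \<rightarrow>\<^sub>E D" "m \<in> C \<rightarrow>\<^sub>E D"
    then have "tens C (\<lambda>c. id_mat) m' m = id_mat m' m" by (rule tens_id_mat[OF assms(2)])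
    then show "1 * perm_tens C (\<pi> (joint_input N (\<lambda>p. id) \<kappa>)) (\<lambda>c. id_mat) m' m = id_mat m' m"
      by (simp add: perm_tens_id[of C "\<pi> _", OF assms(3)])
  qed
  fix z assume z: "z \<in> PiE {..<N} K"
  have s: "{\<kappa>. \<kappa> \<in> PiE {..<N} K \<and> joint_input N (\<lambda>p. id) \<kappa> = z} = {z}"
  proof (intro set_eqI iffI)
    fix \<kappa> assume "\<kappa> \<in> {\<kappa>. \<kappa> \<in> PiE {..<N} K \<and> joint_input N (\<lambda>p. id) \<kappa> = z}"
    then show "\<kappa> \<in> {z}" using joint_input_id[of \<kappa> N K] by simp
  next
    fix \<kappa> assume "\<kappa> \<in> {z}"
    then show "\<kappa> \<in> {\<kappa>. \<kappa> \<in> PiE {..<N} K \<and> joint_input N (\<lambda>p. id) \<kappa> = z}"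
      using joint_input_id[OF z] z by simp
  qed
  show "(\<Sum>\<kappa> | \<kappa> \<in> PiE {..<N} K \<and> joint_input N (\<lambda>p. id) \<kappa> = z. (cmod 1)\<^sup>2) = 1"
    unfolding s by simp
  fix c assume "c \<in> C"
  have "is_id id_mat" by (simp add: is_id_def)
  then show "(\<Sum>\<kappa> | \<kappa> \<in> PiE {..<N} K \<and> joint_input N (\<lambda>p. id) \<kappa> = z \<and> is_id id_mat. (cmod 1)\<^sup>2) \<ge> \<eta> ^ 0"
    using s by simp
qed (rule L_id_mat)

text \<open>The error bound of the second routing holds for every outcome of the first and for every
  register, in particular for the register where the content then is; so the bounds multiply. The
  hypothesis on \<open>\<pi>''\<close> expresses that the combined permutation is determined by the
  original inputs, although the second one is steered by inputs that also record outcomes.\<close>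

lemma routing_comp:
  assumes 1: "routing C n K K' f \<pi> a T" and 2: "routing C n' K' K'' g \<pi>' a' T'"
    and C: "finite C" "\<And>z. z \<in> PiE {..<N} K \<Longrightarrow> bij_betw (\<pi> z) C C"
    and \<pi>'': "\<And>\<kappa>' c. \<kappa>' \<in> PiE {..<N} K' \<Longrightarrow> c \<in> C \<Longrightarrow> \<pi>' \<kappa>' (\<pi> (joint_input N f \<kappa>') c) = \<pi>'' (joint_input N f \<kappa>') c"
  shows "routing C (n + n') K K'' (\<lambda>p. f p \<circ> g p)
    (\<lambda>z. \<pi>'' z) (\<lambda>\<kappa>. a' \<kappa> * a (joint_input N g \<kappa>))
    (\<lambda>\<kappa> c. mat_mult D (T' \<kappa> (\<pi> (joint_input N (\<lambda>p. f p \<circ> g p) \<kappa>) c)) (T (joint_input N g \<kappa>) c))"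
proof -
  let ?M = "C \<rightarrow>\<^sub>E D" and ?fg = "\<lambda>p. f p \<circ> g p"
  let ?T = "\<lambda>\<kappa> c. mat_mult D (T' \<kappa> (\<pi> (joint_input N ?fg \<kappa>) c)) (T (joint_input N g \<kappa>) c)"
  note r1 = routingD[OF 1] and r2 = routingD[OF 2]
  note c1 = centralD[OF r1(1)] and c2 = centralD[OF r2(1)]
  have g_in: "joint_input N g \<kappa> \<in> PiE {..<N} K'" if "\<kappa> \<in> PiE {..<N} K''" for \<kappa>
    using that c2(3) by (intro joint_input_in[where K'=K'']) auto
  have f_in: "joint_input N f \<kappa> \<in> PiE {..<N} K" if "\<kappa> \<in> PiE {..<N} K'" for \<kappa>
    using that c1(3) by (intro joint_input_in[where K'=K']) auto
  have fin: "finite ?M" using C finite_D by (intro finite_PiE)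
  have g: "finite (K' p) \<and> finite (K'' p) \<and> g p \<in> K'' p \<rightarrow> K' p" if "p < N" for p using c2 that by auto
  have "central N ?M ?M K K'' ?fg
      (\<lambda>\<kappa>. mat_mult ?M (\<lambda>m' m. a' \<kappa> * perm_tens C (\<pi>' (joint_input N g \<kappa>)) (T' \<kappa>) m' m)
        (\<lambda>m' m. a (joint_input N g \<kappa>) * perm_tens C (\<pi> (joint_input N f (joint_input N g \<kappa>))) (T (joint_input N g \<kappa>)) m' m))"
    by (rule central_comp[OF r1(1) r2(1) N fin])
  then have "central N ?M ?M K K'' ?fg
      (\<lambda>\<kappa> m' m. a' \<kappa> * a (joint_input N g \<kappa>) * perm_tens C (\<pi>'' (joint_input N ?fg \<kappa>)) (?T \<kappa>) m' m)"
  proof (rule central_cong)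
    fix \<kappa> m' m assume \<kappa>: "\<kappa> \<in> PiE {..<N} K''"
    let ?\<kappa> = "joint_input N g \<kappa>"
    have "mat_mult ?M (\<lambda>m' m. a' \<kappa> * perm_tens C (\<pi>' ?\<kappa>) (T' \<kappa>) m' m)
        (\<lambda>m' m. a ?\<kappa> * perm_tens C (\<pi> (joint_input N f ?\<kappa>)) (T ?\<kappa>) m' m) m' m
      = a' \<kappa> * a ?\<kappa> * mat_mult ?M (perm_tens C (\<pi>' ?\<kappa>) (T' \<kappa>)) (perm_tens C (\<pi> (joint_input N f ?\<kappa>)) (T ?\<kappa>)) m' m"
      unfolding mat_mult_def sum_distrib_left by (simp add: mult_ac)
    also have "\<dots> = a' \<kappa> * a ?\<kappa> * perm_tens C (\<pi>' ?\<kappa> \<circ> \<pi> (joint_input N f ?\<kappa>)) (?T \<kappa>) m' m"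
      by (subst mat_mult_perm_tens[OF C(1) finite_D C(2)[OF f_in[OF g_in[OF \<kappa>]]]]) (simp add: joint_input_comp)
    also have "perm_tens C (\<pi>' ?\<kappa> \<circ> \<pi> (joint_input N f ?\<kappa>)) (?T \<kappa>) m' m
      = perm_tens C (\<pi>'' (joint_input N ?fg \<kappa>)) (?T \<kappa>) m' m"
      unfolding perm_tens_def using \<pi>''[OF g_in[OF \<kappa>]] by (intro prod.cong) (auto simp: joint_input_comp)
    finally show "a' \<kappa> * a ?\<kappa> * perm_tens C (\<pi>'' (joint_input N ?fg \<kappa>)) (?T \<kappa>) m' m
      = mat_mult ?M (\<lambda>m' m. a' \<kappa> * perm_tens C (\<pi>' ?\<kappa>) (T' \<kappa>) m' m)
        (\<lambda>m' m. a ?\<kappa> * perm_tens C (\<pi> (joint_input N f ?\<kappa>)) (T ?\<kappa>) m' m) m' m" ..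
  qed
  moreover have "L (?T \<kappa> c)" if "\<kappa> \<in> PiE {..<N} K''" "c \<in> C" for \<kappa> c
  proof -
    have "\<pi> (joint_input N ?fg \<kappa>) c \<in> C"
      using bij_betwE[OF C(2)[OF f_in[OF g_in[OF that(1)]]]] that(2) by (simp add: joint_input_comp)
    then show ?thesis by (intro L_mat_mult r1(2) r2(2) g_in that)
  qed
  moreover have "(\<Sum>\<kappa> | \<kappa> \<in> PiE {..<N} K'' \<and> joint_input N ?fg \<kappa> = z. (cmod (a' \<kappa> * a (joint_input N g \<kappa>)))\<^sup>2) = 1"
    if z: "z \<in> PiE {..<N} K" for z
  proof -
    have "(\<Sum>\<kappa> | \<kappa> \<in> PiE {..<N} K'' \<and> joint_input N ?fg \<kappa> = z \<and> True \<and> True. (cmod (a' \<kappa> * a (joint_input N g \<kappa>)))\<^sup>2)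
      = (\<Sum>\<kappa>' | \<kappa>' \<in> PiE {..<N} K' \<and> joint_input N f \<kappa>' = z \<and> True.
        \<Sum>\<kappa> | \<kappa> \<in> PiE {..<N} K'' \<and> joint_input N g \<kappa> = \<kappa>' \<and> True. (cmod (a' \<kappa> * a (joint_input N g \<kappa>)))\<^sup>2)"
      by (rule sum_joint_input_comp[where R="\<lambda>_. True" and S="\<lambda>_. True"]) (rule g)
    also have "\<dots> = (\<Sum>\<kappa>' | \<kappa>' \<in> PiE {..<N} K' \<and> joint_input N f \<kappa>' = z. (cmod (a \<kappa>'))\<^sup>2 *
        (\<Sum>\<kappa> | \<kappa> \<in> PiE {..<N} K'' \<and> joint_input N g \<kappa> = \<kappa>'. (cmod (a' \<kappa>))\<^sup>2))"
      unfolding sum_distrib_left by (intro sum.cong) (auto simp: norm_mult power_mult_distrib)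
    also have "\<dots> = (\<Sum>\<kappa>' | \<kappa>' \<in> PiE {..<N} K' \<and> joint_input N f \<kappa>' = z. (cmod (a \<kappa>'))\<^sup>2)"
      by (intro sum.cong refl) (simp add: r2(3))
    finally show ?thesis using r1(3)[OF z] by simp
  qed
  moreover have "(\<Sum>\<kappa> | \<kappa> \<in> PiE {..<N} K'' \<and> joint_input N ?fg \<kappa> = z \<and> is_id (?T \<kappa> c).
      (cmod (a' \<kappa> * a (joint_input N g \<kappa>)))\<^sup>2) \<ge> \<eta> ^ (n + n')"
    if z: "z \<in> PiE {..<N} K" and c: "c \<in> C" for z c
  proof -
    have \<pi>c: "\<pi> z c \<in> C" using C(2)[OF z] c bij_betwE by blast
    have fin'': "finite (PiE {..<N} K'')" using c2 by (auto intro!: finite_PiE)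
    have "\<eta> ^ n * \<eta> ^ n' \<le> (\<Sum>\<kappa>' | \<kappa>' \<in> PiE {..<N} K' \<and> joint_input N f \<kappa>' = z \<and> is_id (T \<kappa>' c). (cmod (a \<kappa>'))\<^sup>2) * \<eta> ^ n'"
      using \<eta> by (intro mult_right_mono r1(4)[OF z c]) auto
    also have "\<dots> = (\<Sum>\<kappa>' | \<kappa>' \<in> PiE {..<N} K' \<and> joint_input N f \<kappa>' = z \<and> is_id (T \<kappa>' c). (cmod (a \<kappa>'))\<^sup>2 * \<eta> ^ n')"
      by (rule sum_distrib_right)
    also have "\<dots> \<le> (\<Sum>\<kappa>' | \<kappa>' \<in> PiE {..<N} K' \<and> joint_input N f \<kappa>' = z \<and> is_id (T \<kappa>' c). (cmod (a \<kappa>'))\<^sup>2 *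
        (\<Sum>\<kappa> | \<kappa> \<in> PiE {..<N} K'' \<and> joint_input N g \<kappa> = \<kappa>' \<and> is_id (T' \<kappa> (\<pi> z c)). (cmod (a' \<kappa>))\<^sup>2))"
      by (intro sum_mono mult_left_mono r2(4)[OF _ \<pi>c]) auto
    also have "\<dots> = (\<Sum>\<kappa>' | \<kappa>' \<in> PiE {..<N} K' \<and> joint_input N f \<kappa>' = z \<and> is_id (T \<kappa>' c).
        \<Sum>\<kappa> | \<kappa> \<in> PiE {..<N} K'' \<and> joint_input N g \<kappa> = \<kappa>' \<and> is_id (T' \<kappa> (\<pi> z c)). (cmod (a' \<kappa> * a (joint_input N g \<kappa>)))\<^sup>2)"
      unfolding sum_distrib_left by (intro sum.cong) (auto simp: norm_mult power_mult_distrib)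
    also have "\<dots> = (\<Sum>\<kappa> | \<kappa> \<in> PiE {..<N} K'' \<and> joint_input N ?fg \<kappa> = z \<and> is_id (T (joint_input N g \<kappa>) c) \<and>
        is_id (T' \<kappa> (\<pi> z c)). (cmod (a' \<kappa> * a (joint_input N g \<kappa>)))\<^sup>2)"
      by (rule sum_joint_input_comp[symmetric, where R="\<lambda>\<kappa>'. is_id (T \<kappa>' c)"]) (rule g)
    \<comment> \<open>Two nontrivial errors may cancel, hence an inequality.\<close>
    also have "\<dots> \<le> (\<Sum>\<kappa> | \<kappa> \<in> PiE {..<N} K'' \<and> joint_input N ?fg \<kappa> = z \<and> is_id (?T \<kappa> c).
        (cmod (a' \<kappa> * a (joint_input N g \<kappa>)))\<^sup>2)"
      using fin'' by (intro sum_mono2) (auto intro: is_id_mat_mult)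
    finally show ?thesis by (simp add: power_add)
  qed
  ultimately show ?thesis unfolding routing_def by (intro conjI ballI)
qed

text \<open>All registers together are teleported to \<open>p\<close>, permuted there and teleported
  back. With \<open>M\<close> the dimension of all registers, each of the \<open>M^4\<close> pairs
  of error families has weight \<open>1 / M^4\<close>, so probabilities are relative frequencies of
  such pairs.\<close>

lemma routing_step:
  assumes K: "\<And>p. p < N \<Longrightarrow> finite (K p)" and p: "p \<in> {1..<N}" and C: "finite C"
    and \<pi>: "\<And>i. i \<in> K p \<Longrightarrow> bij_betw (\<pi> i) C C"
  obtains K' f a T where "routing C 1 K K' f (\<lambda>z. \<pi> (z p)) a T"
proof -
  let ?M = "C \<rightarrow>\<^sub>E D" and ?Q = "C \<rightarrow>\<^sub>E Q"
  have p0: "p \<noteq> 0" "p < N" using p by auto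
  have eb: "error_basis ?M ?Q (\<lambda>k. tens C (\<lambda>c. P (k c)))"
    using C P by (rule error_basis_tens)
  define M where "M = card ?M"
  have M: "M > 0" "card ?Q = M\<^sup>2" using error_basisD[OF eb] error_basis_card[OF eb] by (simp_all add: M_def)
  have finQ: "finite ?Q" using error_basisD[OF eb] by simp
  obtain h and A :: "nat set" where h: "bij_betw h A ?Q"
    using ex_bij_betw_nat_finite[OF finQ] by blast
  have eb': "error_basis ?M A (\<lambda>k. tens C (\<lambda>c. P (h k c)))"
    using error_basis_reindex[OF eb h] by (simp add: o_def)
  obtain l where "card D = 2 ^ l" using card_D by blast
  then have cM: "card ?M = 2 ^ (l * card C)" using C by (simp add: card_PiE power_mult)
  define K' where "K' q = (if q = 0 \<or> q = p then prod_encode ` (K q \<times> A) else K q)" for q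
  define f where "f q = (if q = 0 \<or> q = p then fst \<circ> prod_decode else id)" for q :: nat
  define k where "k \<kappa> = h (snd (prod_decode (\<kappa> (0::nat))))" for \<kappa>
  define l where "l \<kappa> = h (snd (prod_decode (\<kappa> p)))" for \<kappa>
  \<comment> \<open>The error on the way out meets the content in register \<open>c\<close>, the one
    on the way back in the register to which the user has moved it.\<close>
  define T where "T \<kappa> c = mat_mult D (mat_mult D (P (l \<kappa> (\<pi> (joint_input N f \<kappa> p) c))) id_mat) (P (k \<kappa> c))" for \<kappa> c
  define a where "a (\<kappa> :: nat \<Rightarrow> nat) = 1 / (of_nat M :: complex)\<^sup>2" for \<kappa>
  have fK': "f q \<in> K' q \<rightarrow> K q" for q by (auto simp: f_def K'_def)
  have fp: "joint_input N f \<kappa> p = fst (prod_decode (\<kappa> p))" for \<kappa>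
    using p by (simp add: joint_input_def f_def)
  have fpK: "joint_input N f \<kappa> p \<in> K p" if "\<kappa> \<in> PiE {..<N} K'" for \<kappa>
    using PiE_mem[OF joint_input_in[OF fK' that] lessThan_iff[THEN iffD2, OF p0(2)]] .
  have kl: "k \<kappa> \<in> ?Q" "l \<kappa> \<in> ?Q" if "\<kappa> \<in> PiE {..<N} K'" for \<kappa>
  proof -
    have "\<kappa> 0 \<in> K' 0" "\<kappa> p \<in> K' p" using PiE_mem[OF that] N p0 by simp_all
    then have "snd (prod_decode (\<kappa> 0)) \<in> A" "snd (prod_decode (\<kappa> p)) \<in> A"
      by (auto simp: K'_def)
    then show "k \<kappa> \<in> ?Q" "l \<kappa> \<in> ?Q" using bij_betwE[OF h] by (simp_all add: k_def l_def)
  qed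
  have "central N ?M ?M K K' f (\<lambda>\<kappa> r b. mat_mult ?M (mat_mult ?M (tens C (\<lambda>c. P (l \<kappa> c)))
      (perm_tens C (\<pi> (fst (prod_decode (\<kappa> p)))) (\<lambda>c. id_mat))) (tens C (\<lambda>c. P (k \<kappa> c))) r b / (of_nat (card ?M))\<^sup>2)"
    unfolding K'_def f_def l_def k_def
    using C finite_D \<pi> by (intro central_teleport[OF p K eb' cM] isometry_on_perm_tens isometry_on_id_mat) auto
  then have 1: "central N ?M ?M K K' f (\<lambda>\<kappa> m' m. a \<kappa> * perm_tens C (\<pi> (joint_input N f \<kappa> p)) (T \<kappa>) m' m)"
  proof (rule central_cong)
    fix \<kappa> m' m assume \<kappa>: "\<kappa> \<in> PiE {..<N} K'"
    let ?\<pi> = "\<pi> (joint_input N f \<kappa> p)"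
    have b: "bij_betw ?\<pi> C C" by (intro \<pi> fpK \<kappa>)
    have "mat_mult ?M (mat_mult ?M (tens C (\<lambda>c. P (l \<kappa> c))) (perm_tens C ?\<pi> (\<lambda>c. id_mat))) (tens C (\<lambda>c. P (k \<kappa> c))) m' m
      = mat_mult ?M (mat_mult ?M (perm_tens C id (\<lambda>c. P (l \<kappa> c))) (perm_tens C ?\<pi> (\<lambda>c. id_mat))) (perm_tens C id (\<lambda>c. P (k \<kappa> c))) m' m"
      by (intro mat_mult_cong) (simp_all add: perm_tens_id)
    also have "\<dots> = mat_mult ?M (perm_tens C ?\<pi> (\<lambda>c. mat_mult D (P (l \<kappa> (?\<pi> c))) id_mat)) (perm_tens C id (\<lambda>c. P (k \<kappa> c))) m' m"
      using C finite_D b by (intro mat_mult_cong) (auto simp: mat_mult_perm_tens)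
    also have "\<dots> = perm_tens C ?\<pi> (T \<kappa>) m' m"
      using C finite_D by (simp add: mat_mult_perm_tens T_def[abs_def])
    finally show "a \<kappa> * perm_tens C ?\<pi> (T \<kappa>) m' m = mat_mult ?M (mat_mult ?M (tens C (\<lambda>c. P (l \<kappa> c)))
      (perm_tens C (\<pi> (fst (prod_decode (\<kappa> p)))) (\<lambda>c. id_mat))) (tens C (\<lambda>c. P (k \<kappa> c))) m' m / (of_nat (card ?M))\<^sup>2"
      by (simp add: a_def M_def fp)
  qed
  have 2: "L (T \<kappa> c)" if "\<kappa> \<in> PiE {..<N} K'" "c \<in> C" for \<kappa> c
  proof -
    have "\<pi> (joint_input N f \<kappa> p) c \<in> C" using \<pi>[OF fpK[OF that(1)]] that(2) bij_betwE by blast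
    then show ?thesis unfolding T_def using kl[OF that(1)] that(2) by (intro L_mat_mult L_P L_id_mat) auto
  qed
  have sums: "(\<Sum>\<kappa> | \<kappa> \<in> PiE {..<N} K' \<and> joint_input N f \<kappa> = z \<and> R (k \<kappa>) (l \<kappa>). (cmod (a \<kappa>))\<^sup>2)
      = card {x \<in> ?Q \<times> ?Q. R (fst x) (snd x)} / (real M) ^ 4"
    if z: "z \<in> PiE {..<N} K" for z R
  proof -
    let ?S = "{\<kappa>. \<kappa> \<in> PiE {..<N} K' \<and> joint_input N f \<kappa> = z \<and> R (k \<kappa>) (l \<kappa>)}"
    let ?F = "\<lambda>x. \<lambda>q\<in>{..<N}. if q = 0 then prod_encode (z 0, fst x)
      else if q = p then prod_encode (z p, snd x) else z q"
    have F: "bij_betw ?F (A \<times> A) {\<kappa> \<in> PiE {..<N} K'. joint_input N f \<kappa> = z}"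
      unfolding K'_def f_def by (rule bij_betw_two_outcomes[OF p z])
    have klF: "k (?F x) = h (fst x)" "l (?F x) = h (snd x)" for x
      using N p0 by (simp_all add: k_def l_def)
    have b1: "bij_betw ?F {x \<in> A \<times> A. R (h (fst x)) (h (snd x))} ?S"
    proof (rule bij_betw_subset[OF F])
      show "?F ` {x \<in> A \<times> A. R (h (fst x)) (h (snd x))} = ?S"
      proof (intro set_eqI iffI)
        fix \<kappa> assume "\<kappa> \<in> ?F ` {x \<in> A \<times> A. R (h (fst x)) (h (snd x))}"
        then obtain x where x: "x \<in> A \<times> A" "R (h (fst x)) (h (snd x))" "\<kappa> = ?F x" by blast
        then have "R (k \<kappa>) (l \<kappa>)" by (simp only: klF)
        moreover have "\<kappa> \<in> {\<kappa> \<in> PiE {..<N} K'. joint_input N f \<kappa> = z}"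
          unfolding x(3) using bij_betwE[OF F] x(1) by blast
        ultimately show "\<kappa> \<in> ?S" by blast
      next
        fix \<kappa> assume \<kappa>: "\<kappa> \<in> ?S"
        then have "\<kappa> \<in> ?F ` (A \<times> A)" unfolding bij_betw_imp_surj_on[OF F] by blast
        then obtain x where x: "x \<in> A \<times> A" "\<kappa> = ?F x" by blast
        moreover have "R (k \<kappa>) (l \<kappa>)" using \<kappa> by blast
        ultimately have "R (h (fst x)) (h (snd x))" by (simp only: klF)
        with x show "\<kappa> \<in> ?F ` {x \<in> A \<times> A. R (h (fst x)) (h (snd x))}" by blast
      qed
    qed blast
    have b2: "bij_betw (map_prod h h) {x \<in> A \<times> A. R (h (fst x)) (h (snd x))} {x \<in> ?Q \<times> ?Q. R (fst x) (snd x)}"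
    proof (rule bij_betw_subset[OF bij_betw_map_prod[OF h h]])
      show "map_prod h h ` {x \<in> A \<times> A. R (h (fst x)) (h (snd x))} = {x \<in> ?Q \<times> ?Q. R (fst x) (snd x)}"
      proof (intro set_eqI iffI)
        fix x assume "x \<in> {x \<in> ?Q \<times> ?Q. R (fst x) (snd x)}"
        then have x: "fst x \<in> h ` A" "snd x \<in> h ` A" "R (fst x) (snd x)"
          unfolding bij_betw_imp_surj_on[OF h] by auto
        then obtain i j where "i \<in> A" "j \<in> A" "x = map_prod h h (i, j)" by (metis imageE map_prod_simp prod.collapse)
        then show "x \<in> map_prod h h ` {x \<in> A \<times> A. R (h (fst x)) (h (snd x))}" using x(3) by (intro image_eqI[of _ _ "(i, j)"]) auto
      qed (use bij_betwE[OF h] in auto)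
    qed blast
    have "card ?S = card {x \<in> ?Q \<times> ?Q. R (fst x) (snd x)}" by (rule trans[OF bij_betw_same_card[OF b1, symmetric] bij_betw_same_card[OF b2]])
    moreover have "(cmod (a \<kappa>))\<^sup>2 = 1 / (real M) ^ 4" for \<kappa>
      by (simp add: a_def norm_divide norm_power power_divide)
    ultimately show ?thesis by simp
  qed
  have 3: "(\<Sum>\<kappa> | \<kappa> \<in> PiE {..<N} K' \<and> joint_input N f \<kappa> = z. (cmod (a \<kappa>))\<^sup>2) = 1" if z: "z \<in> PiE {..<N} K" for z
    using sums[OF z, of "\<lambda>_ _. True"] M by (simp add: card_cartesian_product power2_eq_square power4_eq_xxxx)
  have 4: "(\<Sum>\<kappa> | \<kappa> \<in> PiE {..<N} K' \<and> joint_input N f \<kappa> = z \<and> is_id (T \<kappa> c). (cmod (a \<kappa>))\<^sup>2) \<ge> \<eta> ^ 1"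
    if z: "z \<in> PiE {..<N} K" and c: "c \<in> C" for z c
  proof -
    obtain e where e: "e \<in> Q" "is_id (P e)" using P unfolding error_basis_def is_id_def by blast
    have zp: "z p \<in> K p" using z p by auto
    then have c': "\<pi> (z p) c \<in> C" using \<pi> c bij_betwE by blast
    have fin: "finite (PiE {..<N} K')" using K bij_betw_finite[OF h] finQ by (auto intro!: finite_PiE simp: K'_def)
    have cQ: "card Q = (card D)\<^sup>2" using P by (rule error_basis_card)
    \<comment> \<open>The two families are prescribed independently, each in one register: a
      fraction \<open>(1 / card Q)^2\<close> of all pairs, which is \<open>\<eta>\<close> because
      \<open>card Q = (card D)^2\<close>.\<close>
    have prod: "{x \<in> ?Q \<times> ?Q. fst x c = e \<and> snd x (\<pi> (z p) c) = e} = {k \<in> ?Q. k c = e} \<times> {k \<in> ?Q. k (\<pi> (z p) c) = e}"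
      by auto
    have "card {x \<in> ?Q \<times> ?Q. fst x c = e \<and> snd x (\<pi> (z p) c) = e} * (card Q * card Q) = M\<^sup>2 * M\<^sup>2"
    proof -
      have "card {k \<in> ?Q. k c = e} * card {k \<in> ?Q. k (\<pi> (z p) c) = e} * (card Q * card Q)
        = (card {k \<in> ?Q. k c = e} * card Q) * (card {k \<in> ?Q. k (\<pi> (z p) c) = e} * card Q)"
        by (simp only: mult_ac)
      with prod show ?thesis
        unfolding card_PiE_fixed[OF C c e(1)] card_PiE_fixed[OF C c' e(1)] M(2) by (simp add: card_cartesian_product)
    qed
    then have "real (card {x \<in> ?Q \<times> ?Q. fst x c = e \<and> snd x (\<pi> (z p) c) = e}) * (real (card D)) ^ 4 = (real M) ^ 4"
      unfolding cQ by (drule_tac arg_cong[where f=real]) (simp add: power2_eq_square power4_eq_xxxx mult_ac)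
    then have "real (card {x \<in> ?Q \<times> ?Q. fst x c = e \<and> snd x (\<pi> (z p) c) = e}) / (real M) ^ 4 = \<eta>"
      using M(1) error_basisD(4)[OF P] by (simp add: \<eta>_def field_simps)
    then have "\<eta> = (\<Sum>\<kappa> | \<kappa> \<in> PiE {..<N} K' \<and> joint_input N f \<kappa> = z \<and> k \<kappa> c = e \<and> l \<kappa> (\<pi> (z p) c) = e. (cmod (a \<kappa>))\<^sup>2)"
      unfolding sums[OF z, of "\<lambda>k l. k c = e \<and> l (\<pi> (z p) c) = e"] by (rule sym)
    also have "\<dots> \<le> (\<Sum>\<kappa> | \<kappa> \<in> PiE {..<N} K' \<and> joint_input N f \<kappa> = z \<and> is_id (T \<kappa> c). (cmod (a \<kappa>))\<^sup>2)"
    proof (rule sum_mono2)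
      show "finite {\<kappa>. \<kappa> \<in> PiE {..<N} K' \<and> joint_input N f \<kappa> = z \<and> is_id (T \<kappa> c)}" using fin by simp
      have "is_id id_mat" by (simp add: is_id_def)
      then have "is_id (T \<kappa> c)" if "joint_input N f \<kappa> = z" "k \<kappa> c = e" "l \<kappa> (\<pi> (z p) c) = e" for \<kappa>
        unfolding T_def that by (intro is_id_mat_mult e(2))
      then show "{\<kappa>. \<kappa> \<in> PiE {..<N} K' \<and> joint_input N f \<kappa> = z \<and> k \<kappa> c = e \<and> l \<kappa> (\<pi> (z p) c) = e}
        \<subseteq> {\<kappa>. \<kappa> \<in> PiE {..<N} K' \<and> joint_input N f \<kappa> = z \<and> is_id (T \<kappa> c)}"
        by blast
    qed simp
    finally show ?thesis by simp
  qed
  have "routing C 1 K K' f (\<lambda>z. \<pi> (z p)) a T"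
    unfolding routing_def by (intro conjI ballI 1 2 3 4)
  then show ?thesis by (rule that)
qed

end

section \<open>Rounds\<close>

context local_corrections
begin

text \<open>One visit to each of the \<open>N - 1\<close> users. The function \<open>s\<close>
  extracts from a user's current input the value by which it routes. In the second pass of a round
  that input also records the first pass, and \<open>s\<close> is then the map that forgets
  this.\<close>

lemma routing_pass:
  assumes K: "\<And>p. p < N \<Longrightarrow> finite (K p)" and R: "\<And>p. p \<in> {1..<N} \<Longrightarrow> finite (R p)"
    and s: "\<And>p i. p \<in> {1..<N} \<Longrightarrow> i \<in> K p \<Longrightarrow> s p i \<in> R p" and k0: "k0 \<in> PiE {1..<N} R"
  shows "\<exists>K' f a T. routing (PiE {1..<N} R) (N - 1) K K' f (\<lambda>z. route N k0 N (\<lambda>p. s p (z p))) a T"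
proof -
  let ?C = "PiE {1..<N} R"
  have C: "finite ?C" using R by (intro finite_PiE) auto
  have "1 \<le> q \<Longrightarrow> q \<le> N \<Longrightarrow> \<exists>K' f a T. routing ?C (q - 1) K K' f (\<lambda>z. route N k0 q (\<lambda>p. s p (z p))) a T" for q
  proof (induction q rule: dec_induct)
    case base
    have "routing ?C 0 K K (\<lambda>p. id) (\<lambda>z. route N k0 1 (\<lambda>p. s p (z p))) (\<lambda>\<kappa>. 1) (\<lambda>\<kappa> c. id_mat)"
      by (rule routing_id[OF K C route_one])
    then show ?case unfolding diff_self_eq_0 by blast
  next
    case (step q)
    then obtain K' f a T where IH: "routing ?C (q - 1) K K' f (\<lambda>z. route N k0 q (\<lambda>p. s p (z p))) a T" by force
    note c = centralD[OF routingD(1)[OF IH]]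
    have q: "q \<in> {1..<N}" using step by auto
    have sR: "s p (f p i) \<in> R p" if "p \<in> {1..<N}" "i \<in> K' p" for p i
      using that c(3)[of p] by (intro s) auto
    \<comment> \<open>At this point a user's input is an element of \<open>K' q\<close>;
      \<open>f q\<close> recovers what the user held when the pass began.\<close>
    obtain K'' g b T' where st: "routing ?C 1 K' K'' g (\<lambda>z. swap_coord k0 q (s q (f q (z q)))) b T'"
      using routing_step[of K' q ?C "\<lambda>i. swap_coord k0 q (s q (f q i))"] c(2) q C swap_coord_bij[OF q k0 sR[OF q]] by blast
    have "routing ?C (q - 1 + 1) K K'' (\<lambda>p. f p \<circ> g p) (\<lambda>z. route N k0 (Suc q) (\<lambda>p. s p (z p)))
      (\<lambda>\<kappa>. b \<kappa> * a (joint_input N g \<kappa>))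
      (\<lambda>\<kappa> c. mat_mult D (T' \<kappa> (route N k0 q (\<lambda>p. s p (joint_input N (\<lambda>p. f p \<circ> g p) \<kappa> p)) c)) (T (joint_input N g \<kappa>) c))"
    proof (rule routing_comp[OF IH st C])
      fix z assume "z \<in> PiE {..<N} K"
      then show "bij_betw (route N k0 q (\<lambda>p. s p (z p))) ?C ?C" using s by (intro route_bij k0) auto
    next
      fix \<kappa>' c assume "\<kappa>' \<in> PiE {..<N} K'" "c \<in> ?C"
      have "f q (\<kappa>' q) = joint_input N f \<kappa>' q" using q by (simp add: joint_input_def)
      then show "swap_coord k0 q (s q (f q (\<kappa>' q))) (route N k0 q (\<lambda>p. s p (joint_input N f \<kappa>' p)) c)
        = route N k0 (Suc q) (\<lambda>p. s p (joint_input N f \<kappa>' p)) c"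
        using swap_coord_route[OF q, of k0 "\<lambda>p. s p (joint_input N f \<kappa>' p)" c] by simp
    qed
    moreover have "q - 1 + 1 = Suc q - 1" using q by simp
    ultimately show ?case by metis
  qed
  from this[of N] show ?thesis using N by simp
qed

text \<open>The correction stands to the left of \<open>U\<close>, that is, it acts later: only such
  deviations can be removed locally.\<close>

definition implements :: "('d \<Rightarrow> 'd \<Rightarrow> complex) \<Rightarrow> ('d \<Rightarrow> 'd \<Rightarrow> complex) \<Rightarrow> bool"
  where "implements U W \<longleftrightarrow> (\<exists>S. L S \<and> (\<forall>r\<in>D. \<forall>b\<in>D. W r b = mat_mult D S U r b))"

text \<open>A pass, a unitary of Alice on each register, and a pass back. A label in
  \<open>C\<close> holds data of the users only; Alice adds her own, so that each label gives her a
  complete joint input, the true one for the register of the state. The error \<open>T2\<close> of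
  the second pass is an allowed correction, so failure requires a nontrivial error \<open>T1\<close>
  of the first pass on the register of the state. Unitarity on the other registers is recorded
  because Alice has to get rid of them later.\<close>

lemma registers_round:
  assumes K: "\<forall>p<N. finite (K p)" and k0: "k0 \<in> PiE {1..<N} K"
    and G: "\<forall>z\<in>PiE {..<N} K. unitary_on D (G z)"
    and C_def: "C = PiE {1..<N} K"
  obtains K' f a X where "central N (C \<rightarrow>\<^sub>E D) (C \<rightarrow>\<^sub>E D) K K' f (\<lambda>\<kappa> m' m. a \<kappa> * tens C (X \<kappa>) m' m)"
    and "\<And>\<kappa> c. \<kappa> \<in> PiE {..<N} K' \<Longrightarrow> c \<in> C \<Longrightarrow> unitary_on D (X \<kappa> c)"
    and "\<And>\<kappa>. \<kappa> \<in> PiE {..<N} K' \<Longrightarrow> \<exists>S T. L S \<and> L T \<and> X \<kappa> k0 = mat_mult D S (mat_mult D (G (joint_input N f \<kappa>)) T)"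
    and "\<And>z. z \<in> PiE {..<N} K \<Longrightarrow>
      (\<Sum>\<kappa> | \<kappa> \<in> PiE {..<N} K' \<and> joint_input N f \<kappa> = z \<and> \<not> implements (G z) (X \<kappa> k0). (cmod (a \<kappa>))\<^sup>2) \<le> 1 - \<eta> ^ (N - 1)"
proof -
  note K = K[rule_format] and G = G[rule_format]
  let ?M = "C \<rightarrow>\<^sub>E D"
  have C: "finite C" unfolding C_def using K by (intro finite_PiE) auto
  have M: "finite ?M" using C finite_D by (intro finite_PiE)
  have k0C: "k0 \<in> C" using k0 by (simp add: C_def)
  obtain K1 f1 a1 T1 where r1: "routing C (N - 1) K K1 f1 (\<lambda>z. route N k0 N z) a1 T1"
    using routing_pass[of K K "\<lambda>p i. i" k0] K k0 unfolding C_def by auto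
  note R1 = routingD[OF r1] note c1 = centralD[OF R1(1)]
  have f1: "f1 p i \<in> K p" if "p < N" "i \<in> K1 p" for p i using c1(3) that by auto
  \<comment> \<open>Steering by \<open>f1\<close> of the current inputs repeats the permutation of
    the first pass, which is its own inverse.\<close>
  obtain K2 f2 a2 T2 where r2: "routing C (N - 1) K1 K2 f2 (\<lambda>z. route N k0 N (\<lambda>p. f1 p (z p))) a2 T2"
    using routing_pass[of K1 K f1 k0] K k0 c1(2) f1 unfolding C_def by auto
  note R2 = routingD[OF r2] note c2 = centralD[OF R2(1)]
  \<comment> \<open>Alice cannot tell which register holds the state; she treats every register as
    if its label were the truth.\<close>
  define G' where "G' i c = G (\<lambda>q\<in>{..<N}. if q = 0 then f1 0 i else c q)" for i c
  have G': "unitary_on D (G' i c)" if "i \<in> K1 0" "c \<in> C" for i c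
  proof -
    have "(if q = 0 then f1 0 i else c q) \<in> K q" if "q < N" for q
      using PiE_mem[OF \<open>c \<in> C\<close>[unfolded C_def], of q] f1[OF N \<open>i \<in> K1 0\<close>] that by auto
    then show ?thesis unfolding G'_def by (intro G) auto
  qed
  have "central N ?M ?M K1 K1 (\<lambda>p. id) (\<lambda>\<kappa>. tens C (\<lambda>c. G' (\<kappa> 0) c))"
    by (intro central_alice_isometry[of N K1 ?M ?M "\<lambda>i. tens C (G' i)"] isometry_on_tens N c1(2) C finite_D
        unitary_onD G')
  note central_comp[OF central_comp[OF R1(1) this N M] R2(1) N M]
  moreover define f where "f p = f1 p \<circ> id \<circ> f2 p" for p
  ultimately have cc: "central N ?M ?M K K2 f (\<lambda>\<kappa>. mat_mult ?M
      (\<lambda>m' m. a2 \<kappa> * perm_tens C (route N k0 N (\<lambda>p. f1 p (joint_input N f2 \<kappa> p))) (T2 \<kappa>) m' m)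
      (mat_mult ?M (tens C (\<lambda>c. G' (joint_input N f2 \<kappa> 0) c))
        (\<lambda>m' m. a1 (joint_input N (\<lambda>p. id) (joint_input N f2 \<kappa>)) *
          perm_tens C (route N k0 N (joint_input N f1 (joint_input N (\<lambda>p. id) (joint_input N f2 \<kappa>))))
            (T1 (joint_input N (\<lambda>p. id) (joint_input N f2 \<kappa>))) m' m)))"
    unfolding f_def[abs_def] by simp
  have f2_in: "joint_input N f2 \<kappa> \<in> PiE {..<N} K1" if "\<kappa> \<in> PiE {..<N} K2" for \<kappa>
    using joint_input_in[OF c2(3) that] .
  have f1_in: "joint_input N f1 \<kappa> \<in> PiE {..<N} K" if "\<kappa> \<in> PiE {..<N} K1" for \<kappa>
    using joint_input_in[OF c1(3) that] .
  have f_eq: "joint_input N f \<kappa> = joint_input N f1 (joint_input N f2 \<kappa>)" for \<kappa>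
    by (simp add: joint_input_comp f_def[abs_def])
  define \<pi> where "\<pi> \<kappa> = route N k0 N (joint_input N f \<kappa>)" for \<kappa>
  define X where "X \<kappa> c = mat_mult D (T2 \<kappa> (\<pi> \<kappa> c)) (mat_mult D (G' (joint_input N f2 \<kappa> 0) (\<pi> \<kappa> c)) (T1 (joint_input N f2 \<kappa>) c))" for \<kappa> c
  define a where "a \<kappa> = a2 \<kappa> * a1 (joint_input N f2 \<kappa>)" for \<kappa>
  have \<pi>: "bij_betw (\<pi> \<kappa>) C C" if "\<kappa> \<in> PiE {..<N} K2" for \<kappa>
    unfolding \<pi>_def C_def f_eq using f1_in[OF f2_in[OF that]] by (intro route_bij k0) auto
  have \<pi>C: "\<pi> \<kappa> c \<in> C" if "\<kappa> \<in> PiE {..<N} K2" "c \<in> C" for \<kappa> c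
    using bij_betwE[OF \<pi>[OF that(1)]] that(2) by blast
  have cen: "central N ?M ?M K K2 f (\<lambda>\<kappa> m' m. a \<kappa> * tens C (X \<kappa>) m' m)"
  proof (rule central_cong[OF cc])
    fix \<kappa> m' m assume \<kappa>: "\<kappa> \<in> PiE {..<N} K2"
    let ?\<kappa> = "joint_input N f2 \<kappa>"
    have id: "joint_input N (\<lambda>p. id) ?\<kappa> = ?\<kappa>" by (rule joint_input_id[OF f2_in[OF \<kappa>]])
    have p2: "route N k0 N (\<lambda>p. f1 p (?\<kappa> p)) c = \<pi> \<kappa> c" for c
      unfolding \<pi>_def by (intro route_cong) (simp add: joint_input_def f_def)
    have "mat_mult ?M (\<lambda>m' m. a2 \<kappa> * perm_tens C (route N k0 N (\<lambda>p. f1 p (?\<kappa> p))) (T2 \<kappa>) m' m)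
      (mat_mult ?M (tens C (\<lambda>c. G' (?\<kappa> 0) c)) (\<lambda>m' m. a1 ?\<kappa> * perm_tens C (route N k0 N (joint_input N f1 ?\<kappa>)) (T1 ?\<kappa>) m' m)) m' m
      = a \<kappa> * mat_mult ?M (perm_tens C (\<pi> \<kappa>) (T2 \<kappa>)) (mat_mult ?M (tens C (\<lambda>c. G' (?\<kappa> 0) c)) (perm_tens C (\<pi> \<kappa>) (T1 ?\<kappa>))) m' m"
      unfolding mat_mult_def a_def sum_distrib_left f_eq[symmetric] \<pi>_def[symmetric] p2[abs_def]
      by (intro sum.cong refl) (simp add: sum_distrib_left mult_ac)
    also have "mat_mult ?M (perm_tens C (\<pi> \<kappa>) (T2 \<kappa>)) (mat_mult ?M (tens C (\<lambda>c. G' (?\<kappa> 0) c)) (perm_tens C (\<pi> \<kappa>) (T1 ?\<kappa>))) m' m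
      = mat_mult ?M (perm_tens C (\<pi> \<kappa>) (T2 \<kappa>)) (mat_mult ?M (perm_tens C id (\<lambda>c. G' (?\<kappa> 0) c)) (perm_tens C (\<pi> \<kappa>) (T1 ?\<kappa>))) m' m"
      by (intro mat_mult_cong) (simp_all add: perm_tens_id)
    also have "\<dots> = mat_mult ?M (perm_tens C (\<pi> \<kappa>) (T2 \<kappa>)) (perm_tens C (\<pi> \<kappa>) (\<lambda>c. mat_mult D (G' (?\<kappa> 0) (\<pi> \<kappa> c)) (T1 ?\<kappa> c))) m' m"
      using C finite_D \<pi>[OF \<kappa>] by (intro mat_mult_cong) (auto simp: mat_mult_perm_tens)
    also have "\<dots> = perm_tens C (\<pi> \<kappa> \<circ> \<pi> \<kappa>) (X \<kappa>) m' m"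
      using C finite_D \<pi>[OF \<kappa>] by (simp add: mat_mult_perm_tens X_def[abs_def])
    also have "\<dots> = tens C (X \<kappa>) m' m"
      by (intro perm_tens_id) (simp add: \<pi>_def C_def route_route)
    finally show "a \<kappa> * tens C (X \<kappa>) m' m = mat_mult ?M
      (\<lambda>m' m. a2 \<kappa> * perm_tens C (route N k0 N (\<lambda>p. f1 p (?\<kappa> p))) (T2 \<kappa>) m' m)
      (mat_mult ?M (tens C (\<lambda>c. G' (?\<kappa> 0) c))
        (\<lambda>m' m. a1 (joint_input N (\<lambda>p. id) ?\<kappa>) *
          perm_tens C (route N k0 N (joint_input N f1 (joint_input N (\<lambda>p. id) ?\<kappa>)))
            (T1 (joint_input N (\<lambda>p. id) ?\<kappa>)) m' m)) m' m"
      unfolding id ..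
  qed
  have uni: "unitary_on D (X \<kappa> c)" if "\<kappa> \<in> PiE {..<N} K2" "c \<in> C" for \<kappa> c
  proof -
    have "joint_input N f2 \<kappa> 0 \<in> K1 0" using f2_in[OF that(1)] N by auto
    then show ?thesis unfolding X_def
      by (intro unitary_on_mat_mult finite_D L_unitary[OF R2(2)] L_unitary[OF R1(2)] G' \<pi>C f2_in that)
  qed
  have Xk0: "X \<kappa> k0 = mat_mult D (T2 \<kappa> (\<pi> \<kappa> k0)) (mat_mult D (G (joint_input N f \<kappa>)) (T1 (joint_input N f2 \<kappa>) k0))" for \<kappa>
  proof -
    have "(\<lambda>q\<in>{..<N}. if q = 0 then f1 0 (joint_input N f2 \<kappa> 0) else \<pi> \<kappa> k0 q) = joint_input N f \<kappa>"
      by (auto simp: \<pi>_def route_start joint_input_def f_def fun_eq_iff)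
    then show ?thesis by (simp add: X_def G'_def)
  qed
  have LX: "\<exists>S T. L S \<and> L T \<and> X \<kappa> k0 = mat_mult D S (mat_mult D (G (joint_input N f \<kappa>)) T)" if "\<kappa> \<in> PiE {..<N} K2" for \<kappa>
    using Xk0 R2(2)[OF that \<pi>C[OF that k0C]] R1(2)[OF f2_in[OF that] k0C] by blast
  have good: "implements (G (joint_input N f \<kappa>)) (X \<kappa> k0)"
    if "\<kappa> \<in> PiE {..<N} K2" "is_id (T1 (joint_input N f2 \<kappa>) k0)" for \<kappa>
    unfolding implements_def Xk0
  proof (intro exI conjI ballI)
    show "L (T2 \<kappa> (\<pi> \<kappa> k0))" by (intro R2(2) \<pi>C that k0C)
    fix r b assume "r \<in> D" "b \<in> D"
    have "mat_mult D (G (joint_input N f \<kappa>)) (T1 (joint_input N f2 \<kappa>) k0) x b = mat_mult D (G (joint_input N f \<kappa>)) id_mat x b" for x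
      using that(2) \<open>b \<in> D\<close> by (intro mat_mult_cong) (auto simp: is_id_def)
    then show "mat_mult D (T2 \<kappa> (\<pi> \<kappa> k0)) (mat_mult D (G (joint_input N f \<kappa>)) (T1 (joint_input N f2 \<kappa>) k0)) r b
        = mat_mult D (T2 \<kappa> (\<pi> \<kappa> k0)) (G (joint_input N f \<kappa>)) r b"
      using \<open>b \<in> D\<close> finite_D by (intro mat_mult_cong) (auto simp: mat_mult_id_mat_right)
  qed
  have bad: "(\<Sum>\<kappa> | \<kappa> \<in> PiE {..<N} K2 \<and> joint_input N f \<kappa> = z \<and> \<not> implements (G z) (X \<kappa> k0). (cmod (a \<kappa>))\<^sup>2)
      \<le> 1 - \<eta> ^ (N - 1)" if z: "z \<in> PiE {..<N} K" for z
  proof -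
    have fin: "finite (PiE {..<N} K2)" "finite (PiE {..<N} K1)"
      using c1(2) c2(2) by (auto intro!: finite_PiE)
    have fg: "f = (\<lambda>p. f1 p \<circ> f2 p)" by (simp add: f_def[abs_def])
    have "(\<Sum>\<kappa> | \<kappa> \<in> PiE {..<N} K2 \<and> joint_input N f \<kappa> = z \<and> \<not> implements (G z) (X \<kappa> k0). (cmod (a \<kappa>))\<^sup>2)
      \<le> (\<Sum>\<kappa> | \<kappa> \<in> PiE {..<N} K2 \<and> joint_input N f \<kappa> = z \<and> \<not> is_id (T1 (joint_input N f2 \<kappa>) k0) \<and> True. (cmod (a \<kappa>))\<^sup>2)"
      using fin good by (intro sum_mono2) auto
    also have "\<dots> = (\<Sum>\<kappa>' | \<kappa>' \<in> PiE {..<N} K1 \<and> joint_input N f1 \<kappa>' = z \<and> \<not> is_id (T1 \<kappa>' k0).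
        \<Sum>\<kappa> | \<kappa> \<in> PiE {..<N} K2 \<and> joint_input N f2 \<kappa> = \<kappa>' \<and> True. (cmod (a \<kappa>))\<^sup>2)"
      unfolding fg using c2
      by (intro sum_joint_input_comp[where R="\<lambda>\<kappa>'. \<not> is_id (T1 \<kappa>' k0)" and S="\<lambda>_. True"]) auto
    also have "\<dots> = (\<Sum>\<kappa>' | \<kappa>' \<in> PiE {..<N} K1 \<and> joint_input N f1 \<kappa>' = z \<and> \<not> is_id (T1 \<kappa>' k0). (cmod (a1 \<kappa>'))\<^sup>2 *
        (\<Sum>\<kappa> | \<kappa> \<in> PiE {..<N} K2 \<and> joint_input N f2 \<kappa> = \<kappa>'. (cmod (a2 \<kappa>))\<^sup>2))"
      unfolding sum_distrib_left by (intro sum.cong) (auto simp: a_def norm_mult power_mult_distrib)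
    \<comment> \<open>For every outcome of the first pass, the outcomes of the second have total
      weight 1.\<close>
    also have "\<dots> = (\<Sum>\<kappa>' | \<kappa>' \<in> PiE {..<N} K1 \<and> joint_input N f1 \<kappa>' = z \<and> \<not> is_id (T1 \<kappa>' k0). (cmod (a1 \<kappa>'))\<^sup>2)"
      by (intro sum.cong refl) (simp add: R2(3))
    also have "\<dots> = (\<Sum>\<kappa>' \<in> {\<kappa>' \<in> PiE {..<N} K1. joint_input N f1 \<kappa>' = z} - {\<kappa>' \<in> PiE {..<N} K1. joint_input N f1 \<kappa>' = z \<and> is_id (T1 \<kappa>' k0)}. (cmod (a1 \<kappa>'))\<^sup>2)"
      by (intro sum.cong) auto
    also have "\<dots> = 1 - (\<Sum>\<kappa>' | \<kappa>' \<in> PiE {..<N} K1 \<and> joint_input N f1 \<kappa>' = z \<and> is_id (T1 \<kappa>' k0). (cmod (a1 \<kappa>'))\<^sup>2)"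
      using fin R1(3)[OF z] by (subst sum_diff) auto
    also have "\<dots> \<le> 1 - \<eta> ^ (N - 1)" using R1(4)[OF z k0C] by simp
    finally show ?thesis .
  qed
  show ?thesis by (rule that) (fact cen uni LX bad)+
qed

text \<open>For steps in which only Alice obtains something new, namely when she measures the spare
  registers and when she teleports the systems back at the end.\<close>

lemma sum_discard_fiber:
  assumes \<kappa>: "\<kappa> \<in> PiE {..<N} K"
  shows "(\<Sum>\<kappa>' | \<kappa>' \<in> PiE {..<N} (K(0 := prod_encode ` (K 0 \<times> A))) \<and>
      joint_input N ((\<lambda>p. id)(0 := fst \<circ> prod_decode)) \<kappa>' = \<kappa>. F \<kappa>') = (\<Sum>j\<in>A. F (\<kappa>(0 := prod_encode (\<kappa> 0, j))))"
proof (rule sum.reindex_bij_witness[where j="\<lambda>\<kappa>'. snd (prod_decode (\<kappa>' 0))" and i="\<lambda>j. \<kappa>(0 := prod_encode (\<kappa> 0, j))"])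
  let ?K = "K(0 := prod_encode ` (K 0 \<times> A))" and ?f = "(\<lambda>p. id)(0 := fst \<circ> prod_decode)"
  fix j assume j: "j \<in> A"
  then show "\<kappa>(0 := prod_encode (\<kappa> 0, j)) \<in> {\<kappa>'. \<kappa>' \<in> PiE {..<N} ?K \<and> joint_input N ?f \<kappa>' = \<kappa>}"
    using \<kappa> N by (auto simp: PiE_iff joint_input_def extensional_def fun_eq_iff)
  show "snd (prod_decode ((\<kappa>(0 := prod_encode (\<kappa> 0, j))) 0)) = j" by simp
next
  let ?K = "K(0 := prod_encode ` (K 0 \<times> A))" and ?f = "(\<lambda>p. id)(0 := fst \<circ> prod_decode)"
  fix \<kappa>' assume "\<kappa>' \<in> {\<kappa>'. \<kappa>' \<in> PiE {..<N} ?K \<and> joint_input N ?f \<kappa>' = \<kappa>}"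
  then have \<kappa>': "\<kappa>' \<in> PiE {..<N} ?K" "joint_input N ?f \<kappa>' = \<kappa>" by auto
  have "\<kappa>' 0 \<in> ?K 0" using PiE_mem[OF \<kappa>'(1)] N by blast
  then show "snd (prod_decode (\<kappa>' 0)) \<in> A" by auto
  have eq: "?f q (\<kappa>' q) = \<kappa> q" if "q < N" for q unfolding \<kappa>'(2)[symmetric] using that by (simp add: joint_input_def)
  have "prod_encode (\<kappa> 0, snd (prod_decode (\<kappa>' 0))) = \<kappa>' 0" unfolding eq[OF N, symmetric] by simp
  then have e: "(\<kappa>(0 := prod_encode (\<kappa> 0, snd (prod_decode (\<kappa>' 0))))) q = \<kappa>' q" if "q < N" for q
    using eq[OF that] by (cases "q = 0") auto
  show e': "\<kappa>(0 := prod_encode (\<kappa> 0, snd (prod_decode (\<kappa>' 0)))) = \<kappa>'"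
    using \<kappa> \<kappa>'(1) N e by (intro extensionalityI[of _ "{..<N}"]) (auto simp: PiE_iff extensional_def)
  show "F (\<kappa>(0 := prod_encode (\<kappa> 0, snd (prod_decode (\<kappa>' 0))))) = F \<kappa>'" unfolding e' ..
qed

text \<open>Alice prepares a fixed basis state \<open>d\<close> in all registers but one and finally
  measures them in the computational basis. The round acts as a tensor product, so these registers
  contribute a product of matrix entries. By unitarity the squared moduli of these products add up
  to 1 over the results, which leaves the failure probability unchanged.\<close>

lemma correction_round:
  assumes K: "\<forall>p<N. finite (K p)" and G: "\<forall>z\<in>PiE {..<N} K. unitary_on D (G z)"
  shows "\<exists>K' f a W. central N D D K K' f (\<lambda>\<kappa> r b. a \<kappa> * W \<kappa> r b) \<and>
    (\<forall>\<kappa>\<in>PiE {..<N} K'. \<exists>S T. L S \<and> L T \<and> W \<kappa> = mat_mult D S (mat_mult D (G (joint_input N f \<kappa>)) T)) \<and>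
    (\<forall>z\<in>PiE {..<N} K.
      (\<Sum>\<kappa> | \<kappa> \<in> PiE {..<N} K' \<and> joint_input N f \<kappa> = z \<and> \<not> implements (G z) (W \<kappa>). (cmod (a \<kappa>))\<^sup>2) \<le> 1 - \<eta> ^ (N - 1))"
proof (cases "PiE {1..<N} K = {}")
  \<comment> \<open>Without a label there is no default register. But then no joint input exists
    either, and the trivial protocol satisfies the claims about inputs and outcomes
    vacuously.\<close>
  case True
  then have e: "PiE {..<N} K = {}" by (auto simp: PiE_eq_empty_iff)
  have "central N D D K K (\<lambda>p. id) (\<lambda>\<kappa>. id_mat)"
    using K finite_D N by (intro central_alice_isometry isometry_on_id_mat) auto
  then have 1: "central N D D K K (\<lambda>p. id) (\<lambda>\<kappa> r b. 1 * id_mat r b)" by simp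
  show ?thesis
    unfolding e by (rule exI[of _ K], rule exI[of _ "\<lambda>p. id"], rule exI[of _ "\<lambda>\<kappa>. 1"], rule exI[of _ "\<lambda>\<kappa>. id_mat"])
      (use 1 e in simp)
next
  case False
  then obtain k0 where k0: "k0 \<in> PiE {1..<N} K" by blast
  define C where "C = PiE {1..<N} K"
  let ?M = "C \<rightarrow>\<^sub>E D" and ?g = "(\<lambda>p. id)(0 := fst \<circ> prod_decode)"
  have C: "finite C" unfolding C_def using K by (intro finite_PiE) auto
  have M: "finite ?M" using C finite_D by (intro finite_PiE)
  have k0C: "k0 \<in> C" using k0 by (simp add: C_def)
  obtain d where d: "d \<in> D" using D_ne by blast
  obtain K1 f a X where 1: "central N ?M ?M K K1 f (\<lambda>\<kappa> m' m. a \<kappa> * tens C (X \<kappa>) m' m)"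
    and X: "\<And>\<kappa> c. \<kappa> \<in> PiE {..<N} K1 \<Longrightarrow> c \<in> C \<Longrightarrow> unitary_on D (X \<kappa> c)"
    and LX: "\<And>\<kappa>. \<kappa> \<in> PiE {..<N} K1 \<Longrightarrow> \<exists>S T. L S \<and> L T \<and> X \<kappa> k0 = mat_mult D S (mat_mult D (G (joint_input N f \<kappa>)) T)"
    and bad: "\<And>z. z \<in> PiE {..<N} K \<Longrightarrow>
      (\<Sum>\<kappa> | \<kappa> \<in> PiE {..<N} K1 \<and> joint_input N f \<kappa> = z \<and> \<not> implements (G z) (X \<kappa> k0). (cmod (a \<kappa>))\<^sup>2) \<le> 1 - \<eta> ^ (N - 1)"
    by (rule registers_round[OF K k0 G C_def]) (rule that)
  note c1 = centralD[OF 1]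
  let ?J = "(C - {k0}) \<rightarrow>\<^sub>E D"
  have finJ: "finite ?J" using C finite_D by (intro finite_PiE) auto
  obtain h and A :: "nat set" where h: "bij_betw h A ?J"
    using ex_bij_betw_nat_finite[OF finJ] by blast
  have A: "finite A" using bij_betw_finite[OF h] finJ by blast
  have hJ: "h j c \<in> D" if "j \<in> A" "c \<in> C" "c \<noteq> k0" for j c
    using bij_betwE[OF h] that by (auto simp: PiE_iff)
  \<comment> \<open>\<open>v r\<close> is the initial configuration with the state in register
    \<open>k0\<close>, and \<open>w j r\<close> the final one when the other registers show the
    result \<open>h j\<close>.\<close>
  define v where "v r = (\<lambda>c\<in>C. if c = k0 then r else d)" for r
  define w where "w j r = (\<lambda>c\<in>C. if c = k0 then r else h j c)" for j r
  have v: "v r \<in> ?M" if "r \<in> D" for r using that d by (auto simp: v_def)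
  have w: "w j r \<in> ?M" if "r \<in> D" "j \<in> A" for j r using that hJ by (auto simp: w_def)
  have v_inj: "id_mat (v r) (v r') = id_mat r r'" for r r'
  proof -
    have "v r k0 = r" "v r' k0 = r'" using k0C by (simp_all add: v_def)
    then have "v r = v r' \<longleftrightarrow> r = r'" by metis
    then show ?thesis by (simp add: id_mat_def)
  qed
  have "isometry_on D ?M (\<lambda>m r. id_mat m (v r))"
    unfolding isometry_on_def
  proof (intro ballI)
    fix i j assume ij: "i \<in> D" "j \<in> D"
    have "(\<Sum>r\<in>?M. cnj (id_mat r (v i)) * id_mat r (v j)) = (\<Sum>r\<in>?M. if r = v i then id_mat (v i) (v j) else 0)"
      by (intro sum.cong refl) (auto simp: id_mat_def)
    also have "\<dots> = id_mat i j" using M v[OF ij(1)] by (simp add: v_inj)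
    finally show "(\<Sum>r\<in>?M. cnj (id_mat r (v i)) * id_mat r (v j)) = id_mat i j" .
  qed
  then have 0: "central N D ?M K K (\<lambda>p. id) (\<lambda>\<kappa> m r. id_mat m (v r))"
    by (intro central_alice_isometry[of N K D ?M "\<lambda>i m r. id_mat m (v r)"] N K[rule_format])
  have w_bij: "bij_betw (\<lambda>(j, r). w j r) (A \<times> D) ?M"
  proof (rule bij_betwI[where g="\<lambda>m. (inv_into A h (restrict m (C - {k0})), m k0)"])
    show "(\<lambda>(j, r). w j r) \<in> A \<times> D \<rightarrow> ?M" using w by auto
    have inv: "inv_into A h y \<in> A" "h (inv_into A h y) = y" if "y \<in> ?J" for y
      using that bij_betwE[OF bij_betw_inv_into[OF h]] bij_betw_inv_into_right[OF h] by auto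
    have res: "restrict m (C - {k0}) \<in> ?J" if "m \<in> ?M" for m using that by (auto simp: PiE_iff)
    show "(\<lambda>m. (inv_into A h (restrict m (C - {k0})), m k0)) \<in> ?M \<rightarrow> A \<times> D"
      using inv(1)[OF res] k0C by auto
    show "(case (inv_into A h (restrict m (C - {k0})), m k0) of (j, r) \<Rightarrow> w j r) = m" if "m \<in> ?M" for m
    proof (rule extensionalityI[of _ C])
      fix c assume "c \<in> C"
      then show "(case (inv_into A h (restrict m (C - {k0})), m k0) of (j, r) \<Rightarrow> w j r) c = m c"
        by (cases "c = k0") (simp_all add: w_def inv(2)[OF res[OF that]])
    qed (use that in \<open>auto simp: w_def PiE_iff\<close>)
    show "(inv_into A h (restrict (case x of (j, r) \<Rightarrow> w j r) (C - {k0})), (case x of (j, r) \<Rightarrow> w j r) k0) = x"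
      if "x \<in> A \<times> D" for x
    proof -
      obtain j r where x: "x = (j, r)" "j \<in> A" "r \<in> D" using \<open>x \<in> A \<times> D\<close> by (elim SigmaE) blast
      have "h j \<in> ?J" using bij_betwE[OF h] x by blast
      then have "restrict (w j r) (C - {k0}) = h j"
        by (intro extensionalityI[of _ "C - {k0}"]) (auto simp: w_def PiE_iff)
      then show ?thesis using x k0C bij_betw_inv_into_left[OF h] by (simp add: w_def)
    qed
  qed
  have 2: "central N ?M D K1 (K1(0 := prod_encode ` (K1 0 \<times> A))) ?g
      (\<lambda>\<kappa> r m. id_mat m (w (snd (prod_decode (\<kappa> 0))) r))"
  proof (rule central_alice[where L="\<lambda>k r m. id_mat m (w (snd (prod_decode k)) r)"])
    fix i m m' assume *: "i \<in> K1 0" "m \<in> ?M" "m' \<in> ?M"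
    have "(\<Sum>j\<in>A. \<Sum>r\<in>D. cnj (id_mat m (w j r)) * id_mat m' (w j r)) = (\<Sum>x\<in>?M. cnj (id_mat m x) * id_mat m' x)"
      using sum.reindex_bij_betw[OF w_bij, of "\<lambda>x. cnj (id_mat m x) * id_mat m' x"]
      by (simp add: sum.cartesian_product case_prod_beta)
    also have "\<dots> = (\<Sum>x\<in>?M. if x = m then id_mat m m' else 0)"
      by (intro sum.cong refl) (auto simp: id_mat_def)
    also have "\<dots> = id_mat m m'" using M * by simp
    finally show "(\<Sum>k | k \<in> prod_encode ` (K1 0 \<times> A) \<and> (fst \<circ> prod_decode) k = i.
        \<Sum>r\<in>D. cnj (id_mat m (w (snd (prod_decode k)) r)) * id_mat m' (w (snd (prod_decode k)) r)) = id_mat m m'"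
      using * by (simp add: sum_encode_fiber)
  qed (use N c1(2) A in auto)
  let ?K = "K1(0 := prod_encode ` (K1 0 \<times> A))"
  let ?f = "\<lambda>p. id \<circ> f p \<circ> ?g p"
  define a' where "a' \<kappa> = (let \<kappa>' = joint_input N ?g \<kappa> in
    a \<kappa>' * (\<Prod>c\<in>C - {k0}. X \<kappa>' c (h (snd (prod_decode (\<kappa> 0))) c) d))" for \<kappa>
  define W where "W \<kappa> = X (joint_input N ?g \<kappa>) k0" for \<kappa>
  note c2 = centralD[OF 2]
  have g_in: "joint_input N ?g \<kappa> \<in> PiE {..<N} K1" if "\<kappa> \<in> PiE {..<N} ?K" for \<kappa>
    by (rule joint_input_in[OF c2(3) that])
  have f_eq: "joint_input N ?f \<kappa> = joint_input N f (joint_input N ?g \<kappa>)" for \<kappa>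
    by (simp add: joint_input_comp)
  have "central N D D K ?K ?f (\<lambda>\<kappa>. mat_mult ?M (\<lambda>r m. id_mat m (w (snd (prod_decode (\<kappa> 0))) r))
      (mat_mult ?M (\<lambda>m' m. a (joint_input N ?g \<kappa>) * tens C (X (joint_input N ?g \<kappa>)) m' m) (\<lambda>m r. id_mat m (v r))))"
    using central_comp[OF central_comp[OF 0 1 N M] 2 N M] by simp
  then have cen: "central N D D K ?K ?f (\<lambda>\<kappa> r b. a' \<kappa> * W \<kappa> r b)"
  proof (rule central_cong)
    fix \<kappa> r b assume *: "\<kappa> \<in> PiE {..<N} ?K" "r \<in> D" "b \<in> D"
    let ?\<kappa> = "joint_input N ?g \<kappa>" and ?j = "snd (prod_decode (\<kappa> 0))"
    have "\<kappa> 0 \<in> ?K 0" using PiE_mem[OF *(1)] N by blast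
    then have j: "?j \<in> A" by auto
    have "mat_mult ?M (\<lambda>r m. id_mat m (w ?j r)) (mat_mult ?M (\<lambda>m' m. a ?\<kappa> * tens C (X ?\<kappa>) m' m) (\<lambda>m r. id_mat m (v r))) r b
      = mat_mult ?M (\<lambda>m' m. a ?\<kappa> * tens C (X ?\<kappa>) m' m) (\<lambda>m r. id_mat m (v r)) (w ?j r) b"
      unfolding mat_mult_def[of ?M "\<lambda>r m. id_mat m (w ?j r)"] by (rule sum_id_mat(1)[OF M w[OF *(2) j]])
    also have "\<dots> = a ?\<kappa> * tens C (X ?\<kappa>) (w ?j r) (v b)"
      unfolding mat_mult_def by (rule sum_id_mat(2)[OF M v[OF *(3)]])
    also have "tens C (X ?\<kappa>) (w ?j r) (v b) = X ?\<kappa> k0 r b * (\<Prod>c\<in>C - {k0}. X ?\<kappa> c (h ?j c) d)"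
      unfolding tens_def using C k0C by (subst prod.remove[of _ k0]) (auto simp: w_def v_def intro!: prod.cong)
    finally show "a' \<kappa> * W \<kappa> r b = mat_mult ?M (\<lambda>r m. id_mat m (w ?j r))
      (mat_mult ?M (\<lambda>m' m. a ?\<kappa> * tens C (X ?\<kappa>) m' m) (\<lambda>m r. id_mat m (v r))) r b"
      by (simp only: a'_def W_def Let_def mult_ac)
  qed
  have LW: "\<exists>S T. L S \<and> L T \<and> W \<kappa> = mat_mult D S (mat_mult D (G (joint_input N ?f \<kappa>)) T)" if "\<kappa> \<in> PiE {..<N} ?K" for \<kappa>
    using LX[OF g_in[OF that]] unfolding W_def f_eq .
  have bad': "(\<Sum>\<kappa> | \<kappa> \<in> PiE {..<N} ?K \<and> joint_input N ?f \<kappa> = z \<and> \<not> implements (G z) (W \<kappa>). (cmod (a' \<kappa>))\<^sup>2) \<le> 1 - \<eta> ^ (N - 1)"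
    if z: "z \<in> PiE {..<N} K" for z
  proof -
    have gg: "finite (K1 p) \<and> finite (?K p) \<and> ?g p \<in> ?K p \<rightarrow> K1 p" if "p < N" for p using c2[OF that] by blast
    have "(\<Sum>\<kappa> | \<kappa> \<in> PiE {..<N} ?K \<and> joint_input N ?f \<kappa> = z \<and> \<not> implements (G z) (X (joint_input N ?g \<kappa>) k0) \<and> True. (cmod (a' \<kappa>))\<^sup>2)
      = (\<Sum>\<kappa>' | \<kappa>' \<in> PiE {..<N} K1 \<and> joint_input N (\<lambda>p. id \<circ> f p) \<kappa>' = z \<and> \<not> implements (G z) (X \<kappa>' k0).
        \<Sum>\<kappa> | \<kappa> \<in> PiE {..<N} ?K \<and> joint_input N ?g \<kappa> = \<kappa>' \<and> True. (cmod (a' \<kappa>))\<^sup>2)"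
      by (rule sum_joint_input_comp[where R="\<lambda>\<kappa>'. \<not> implements (G z) (X \<kappa>' k0)" and S="\<lambda>_. True"]) (rule gg)
    also have "\<dots> = (\<Sum>\<kappa>' | \<kappa>' \<in> PiE {..<N} K1 \<and> joint_input N f \<kappa>' = z \<and> \<not> implements (G z) (X \<kappa>' k0). (cmod (a \<kappa>'))\<^sup>2)"
    proof (intro sum.cong)
      fix \<kappa>' assume "\<kappa>' \<in> {\<kappa>'. \<kappa>' \<in> PiE {..<N} K1 \<and> joint_input N f \<kappa>' = z \<and> \<not> implements (G z) (X \<kappa>' k0)}"
      then have \<kappa>': "\<kappa>' \<in> PiE {..<N} K1" by blast
      have "(\<Sum>\<kappa> | \<kappa> \<in> PiE {..<N} ?K \<and> joint_input N ?g \<kappa> = \<kappa>' \<and> True. (cmod (a' \<kappa>))\<^sup>2)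
        = (\<Sum>\<kappa> | \<kappa> \<in> PiE {..<N} ?K \<and> joint_input N ?g \<kappa> = \<kappa>'.
          (cmod (a \<kappa>' * (\<Prod>c\<in>C - {k0}. X \<kappa>' c (h (snd (prod_decode (\<kappa> 0))) c) d)))\<^sup>2)"
        by (intro sum.cong) (auto simp: a'_def Let_def)
      also have "\<dots> = (\<Sum>j\<in>A. (cmod (a \<kappa>' * (\<Prod>c\<in>C - {k0}. X \<kappa>' c (h j c) d)))\<^sup>2)"
        by (subst sum_discard_fiber[OF \<kappa>']) simp
      also have "\<dots> = (\<Sum>y\<in>?J. (cmod (a \<kappa>' * (\<Prod>c\<in>C - {k0}. X \<kappa>' c (y c) d)))\<^sup>2)"
        by (rule sum.reindex_bij_betw[OF h])
      also have "\<dots> = (cmod (a \<kappa>'))\<^sup>2 * (\<Sum>y\<in>?J. \<Prod>c\<in>C - {k0}. (cmod (X \<kappa>' c (y c) d))\<^sup>2)"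
        by (simp add: norm_mult power_mult_distrib sum_distrib_left prod_norm[symmetric] prod_power_distrib)
      also have "(\<Sum>y\<in>?J. \<Prod>c\<in>C - {k0}. (cmod (X \<kappa>' c (y c) d))\<^sup>2) = (\<Prod>c\<in>C - {k0}. \<Sum>y\<in>D. (cmod (X \<kappa>' c y d))\<^sup>2)"
        using C finite_D by (intro prod_sum_PiE[symmetric]) auto
      \<comment> \<open>Column \<open>d\<close> of each unitary \<open>X \<kappa>' c\<close> has
        norm 1.\<close>
      also have "\<dots> = 1"
      proof (rule prod.neutral, rule ballI)
        fix c assume "c \<in> C - {k0}"
        then have "(\<Sum>y\<in>D. cnj (X \<kappa>' c y d) * X \<kappa>' c y d) = 1"
          using isometry_onD[OF unitary_onD[OF X[OF \<kappa>']] d d] by (simp add: id_mat_def)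
        then have "complex_of_real (\<Sum>y\<in>D. (cmod (X \<kappa>' c y d))\<^sup>2) = 1"
          by (simp only: of_real_sum complex_norm_square mult.commute)
        then show "(\<Sum>y\<in>D. (cmod (X \<kappa>' c y d))\<^sup>2) = 1" by (simp only: of_real_eq_1_iff)
      qed
      finally show "(\<Sum>\<kappa> | \<kappa> \<in> PiE {..<N} ?K \<and> joint_input N ?g \<kappa> = \<kappa>' \<and> True. (cmod (a' \<kappa>))\<^sup>2) = (cmod (a \<kappa>'))\<^sup>2"
        by (simp only: mult_1_right)
    qed simp
    also have "\<dots> \<le> 1 - \<eta> ^ (N - 1)" by (rule bad[OF z])
    finally show ?thesis unfolding W_def by (simp only: simp_thms)
  qed
  show ?thesis
    by (intro exI[of _ ?K] exI[of _ ?f] exI[of _ a'] exI[of _ W] conjI ballI cen LW bad')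
qed

text \<open>The inputs of a round are the outcomes of all earlier ones, so they change with every
  round, whereas the bound \<open>1 - \<eta> ^ (N - 1)\<close> stays the same.
  \<open>W \<kappa>\<close> is the unitary accumulated so far. It is determined by the outcomes of
  all parties together, which is the knowledge that the labels of the next round give to
  Alice.\<close>

lemma iterated_rounds:
  assumes K: "\<forall>p<N. finite (K p)" and U: "\<forall>z\<in>PiE {..<N} K. unitary_on D (U z)"
  shows "\<exists>K' f a W. central N D D K K' f (\<lambda>\<kappa> r b. a \<kappa> * W \<kappa> r b) \<and>
    (\<forall>\<kappa>\<in>PiE {..<N} K'. unitary_on D (W \<kappa>)) \<and>
    (\<forall>z\<in>PiE {..<N} K.
      (\<Sum>\<kappa> | \<kappa> \<in> PiE {..<N} K' \<and> joint_input N f \<kappa> = z \<and> \<not> implements (U z) (W \<kappa>). (cmod (a \<kappa>))\<^sup>2) \<le> (1 - \<eta> ^ (N - 1)) ^ n)"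
proof (induction n)
  case 0
  have "central N D D K K (\<lambda>p. id) (\<lambda>\<kappa>. id_mat)"
    by (intro central_alice_isometry isometry_on_id_mat N K[rule_format] finite_D)
  then have 1: "central N D D K K (\<lambda>p. id) (\<lambda>\<kappa> r b. 1 * id_mat r b)" by simp
  have "(\<Sum>\<kappa> | \<kappa> \<in> PiE {..<N} K \<and> joint_input N (\<lambda>p. id) \<kappa> = z \<and> \<not> implements (U z) id_mat. (cmod 1)\<^sup>2) \<le> (1 - \<eta> ^ (N - 1)) ^ 0"
    for z
  proof -
    have "{\<kappa>. \<kappa> \<in> PiE {..<N} K \<and> joint_input N (\<lambda>p. id) \<kappa> = z \<and> \<not> implements (U z) id_mat} \<subseteq> {z}"
      using joint_input_id[of _ N K] by auto
    then have "card {\<kappa>. \<kappa> \<in> PiE {..<N} K \<and> joint_input N (\<lambda>p. id) \<kappa> = z \<and> \<not> implements (U z) id_mat} \<le> 1"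
      using card_mono[of "{z}"] by fastforce
    then show ?thesis by simp
  qed
  note 2 = this
  show ?case
    by (rule exI[of _ K], rule exI[of _ "\<lambda>p. id"], rule exI[of _ "\<lambda>\<kappa>. 1"], rule exI[of _ "\<lambda>\<kappa>. id_mat"])
      (intro conjI ballI 1 2 unitary_on_id_mat finite_D)
next
  case (Suc n)
  then obtain K1 f a W where 1: "central N D D K K1 f (\<lambda>\<kappa> r b. a \<kappa> * W \<kappa> r b)"
    and W: "\<And>\<kappa>. \<kappa> \<in> PiE {..<N} K1 \<Longrightarrow> unitary_on D (W \<kappa>)"
    and bad: "\<And>z. z \<in> PiE {..<N} K \<Longrightarrow> (\<Sum>\<kappa> | \<kappa> \<in> PiE {..<N} K1 \<and> joint_input N f \<kappa> = z \<and>
      \<not> implements (U z) (W \<kappa>). (cmod (a \<kappa>))\<^sup>2) \<le> (1 - \<eta> ^ (N - 1)) ^ n" by (elim exE conjE) (rule that; (assumption | erule (1) bspec))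
  note c1 = centralD[OF 1]
  have f_in: "joint_input N f \<kappa> \<in> PiE {..<N} K" if "\<kappa> \<in> PiE {..<N} K1" for \<kappa>
    by (rule joint_input_in[OF c1(3) that])
  \<comment> \<open>If the goal has been reached, the state must not be disturbed; otherwise the
    next round has to undo \<open>W \<kappa>\<close> and to apply the wanted unitary. The
    distinction depends on the joint outcome only, which the next round treats as its joint
    input.\<close>
  define G where "G \<kappa> = (if implements (U (joint_input N f \<kappa>)) (W \<kappa>) then id_mat
    else mat_mult D (U (joint_input N f \<kappa>)) (adj (W \<kappa>)))" for \<kappa>
  have G: "unitary_on D (G \<kappa>)" if "\<kappa> \<in> PiE {..<N} K1" for \<kappa>
    using W[OF that] bspec[OF U f_in[OF that]] finite_D
    by (auto simp: G_def intro!: unitary_on_id_mat unitary_on_mat_mult unitary_on_adj)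
  obtain K2 g b V where 2: "central N D D K1 K2 g (\<lambda>\<kappa> r c. b \<kappa> * V \<kappa> r c)"
    and V: "\<And>\<kappa>. \<kappa> \<in> PiE {..<N} K2 \<Longrightarrow> \<exists>S T. L S \<and> L T \<and> V \<kappa> = mat_mult D S (mat_mult D (G (joint_input N g \<kappa>)) T)"
    and bad2: "\<And>z. z \<in> PiE {..<N} K1 \<Longrightarrow> (\<Sum>\<kappa> | \<kappa> \<in> PiE {..<N} K2 \<and> joint_input N g \<kappa> = z \<and>
      \<not> implements (G z) (V \<kappa>). (cmod (b \<kappa>))\<^sup>2) \<le> 1 - \<eta> ^ (N - 1)"
  proof -
    have K1: "\<forall>p<N. finite (K1 p)" and G1: "\<forall>\<kappa>\<in>PiE {..<N} K1. unitary_on D (G \<kappa>)" using c1(2) G by blast+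
    show thesis using correction_round[OF K1 G1] by (elim exE conjE) (rule that; (assumption | erule (1) bspec))
  qed
  note c2 = centralD[OF 2]
  have g_in: "joint_input N g \<kappa> \<in> PiE {..<N} K1" if "\<kappa> \<in> PiE {..<N} K2" for \<kappa>
    by (rule joint_input_in[OF c2(3) that])
  let ?fg = "\<lambda>p. f p \<circ> g p"
  define W' where "W' \<kappa> = mat_mult D (V \<kappa>) (W (joint_input N g \<kappa>))" for \<kappa>
  define a' where "a' \<kappa> = b \<kappa> * a (joint_input N g \<kappa>)" for \<kappa>
  have cen: "central N D D K K2 ?fg (\<lambda>\<kappa> r b. a' \<kappa> * W' \<kappa> r b)"
  proof (rule central_cong[OF central_comp[OF 1 2 N finite_D]])
    fix \<kappa> r c
    show "a' \<kappa> * W' \<kappa> r c = mat_mult D (\<lambda>r c. b \<kappa> * V \<kappa> r c)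
        (\<lambda>r c. a (joint_input N g \<kappa>) * W (joint_input N g \<kappa>) r c) r c"
      unfolding mat_mult_def a'_def W'_def sum_distrib_left by (intro sum.cong refl) (simp add: mult_ac)
  qed
  have uni: "unitary_on D (W' \<kappa>)" if \<kappa>: "\<kappa> \<in> PiE {..<N} K2" for \<kappa>
  proof -
    obtain S T where "L S" "L T" "V \<kappa> = mat_mult D S (mat_mult D (G (joint_input N g \<kappa>)) T)" using V[OF \<kappa>] by blast
    then have "unitary_on D (V \<kappa>)" using G[OF g_in[OF \<kappa>]] finite_D L_unitary by (simp add: unitary_on_mat_mult)
    then show ?thesis unfolding W'_def by (intro unitary_on_mat_mult finite_D W g_in \<kappa>)
  qed
  \<comment> \<open>When the round has to apply the identity, its errors on both sides are allowed
    corrections and collect to the left of \<open>U z\<close>, whether the round succeeds or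
    not.\<close>
  have keep: "implements (U z) (W' \<kappa>)"
    if \<kappa>: "\<kappa> \<in> PiE {..<N} K2" and z: "joint_input N ?fg \<kappa> = z" and i: "implements (U z) (W (joint_input N g \<kappa>))" for \<kappa> z
  proof -
    have "G (joint_input N g \<kappa>) = id_mat" using z i by (simp add: G_def joint_input_comp)
    then obtain S T where ST: "L S" "L T" "V \<kappa> = mat_mult D S (mat_mult D id_mat T)" using V[OF \<kappa>] by auto
    obtain R where R: "L R" "\<And>r b. r \<in> D \<Longrightarrow> b \<in> D \<Longrightarrow> W (joint_input N g \<kappa>) r b = mat_mult D R (U z) r b"
      using i unfolding implements_def by blast
    show ?thesis
      unfolding implements_def
    proof (intro exI conjI ballI)
      show "L (mat_mult D (V \<kappa>) R)" unfolding ST(3) by (intro L_mat_mult ST L_id_mat R)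
      fix r b assume "r \<in> D" "b \<in> D"
      then show "W' \<kappa> r b = mat_mult D (mat_mult D (V \<kappa>) R) (U z) r b"
        unfolding W'_def mat_mult_assoc using R(2) by (intro mat_mult_cong) auto
    qed
  qed
  have succeed: "implements (U z) (W' \<kappa>)"
    if \<kappa>: "\<kappa> \<in> PiE {..<N} K2" and z: "joint_input N ?fg \<kappa> = z"
      and n: "\<not> implements (U z) (W (joint_input N g \<kappa>))" and i: "implements (G (joint_input N g \<kappa>)) (V \<kappa>)" for \<kappa> z
  proof -
    let ?W = "W (joint_input N g \<kappa>)"
    have "G (joint_input N g \<kappa>) = mat_mult D (U z) (adj ?W)" using z n by (auto simp: G_def joint_input_comp)
    then obtain S where S: "L S" "\<And>r b. r \<in> D \<Longrightarrow> b \<in> D \<Longrightarrow> V \<kappa> r b = mat_mult D S (mat_mult D (U z) (adj ?W)) r b"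
      using i unfolding implements_def by auto
    show ?thesis
      unfolding implements_def
    proof (intro exI conjI ballI)
      show "L S" by (rule S)
      fix r b assume rb: "r \<in> D" "b \<in> D"
      have "W' \<kappa> r b = mat_mult D (mat_mult D S (mat_mult D (U z) (adj ?W))) ?W r b"
        unfolding W'_def using S(2) rb by (intro mat_mult_cong) auto
      also have "\<dots> = mat_mult D (mat_mult D S (U z)) (mat_mult D (adj ?W) ?W) r b" by (simp only: mat_mult_assoc)
      also have "\<dots> = mat_mult D (mat_mult D S (U z)) id_mat r b"
        using rb W[OF g_in[OF \<kappa>]] by (intro mat_mult_cong) (auto simp: mat_mult_adj_left)
      finally show "W' \<kappa> r b = mat_mult D S (U z) r b" using rb finite_D by (simp add: mat_mult_id_mat_right)
    qed
  qed
  have "(\<Sum>\<kappa> | \<kappa> \<in> PiE {..<N} K2 \<and> joint_input N ?fg \<kappa> = z \<and> \<not> implements (U z) (W' \<kappa>). (cmod (a' \<kappa>))\<^sup>2) \<le> (1 - \<eta> ^ (N - 1)) ^ Suc n"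
    if z: "z \<in> PiE {..<N} K" for z
  proof -
    have fin: "finite (PiE {..<N} K2)" using c2(2) by (auto intro!: finite_PiE)
    have \<delta>: "0 \<le> 1 - \<eta> ^ (N - 1)" using \<eta> by (simp add: power_le_one)
    have g: "finite (K1 p) \<and> finite (K2 p) \<and> g p \<in> K2 p \<rightarrow> K1 p" if "p < N" for p using c2[OF that] by blast
    \<comment> \<open>By \<open>keep\<close> and \<open>succeed\<close>, failure now means failure
      before and failure of this round. The latter has conditional probability at most
      \<open>1 - \<eta> ^ (N - 1)\<close>, whatever the earlier outcomes were.\<close>
    have "(\<Sum>\<kappa> | \<kappa> \<in> PiE {..<N} K2 \<and> joint_input N ?fg \<kappa> = z \<and> \<not> implements (U z) (W' \<kappa>). (cmod (a' \<kappa>))\<^sup>2)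
      \<le> (\<Sum>\<kappa> | \<kappa> \<in> PiE {..<N} K2 \<and> joint_input N ?fg \<kappa> = z \<and> \<not> implements (U z) (W (joint_input N g \<kappa>)) \<and>
        \<not> implements (G (joint_input N g \<kappa>)) (V \<kappa>). (cmod (a' \<kappa>))\<^sup>2)"
      using fin keep succeed by (intro sum_mono2) auto
    also have "\<dots> = (\<Sum>\<kappa>' | \<kappa>' \<in> PiE {..<N} K1 \<and> joint_input N f \<kappa>' = z \<and> \<not> implements (U z) (W \<kappa>').
        \<Sum>\<kappa> | \<kappa> \<in> PiE {..<N} K2 \<and> joint_input N g \<kappa> = \<kappa>' \<and> \<not> implements (G (joint_input N g \<kappa>)) (V \<kappa>). (cmod (a' \<kappa>))\<^sup>2)"
      by (rule sum_joint_input_comp[where R="\<lambda>\<kappa>'. \<not> implements (U z) (W \<kappa>')"]) (rule g)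
    also have "\<dots> = (\<Sum>\<kappa>' | \<kappa>' \<in> PiE {..<N} K1 \<and> joint_input N f \<kappa>' = z \<and> \<not> implements (U z) (W \<kappa>'). (cmod (a \<kappa>'))\<^sup>2 *
        (\<Sum>\<kappa> | \<kappa> \<in> PiE {..<N} K2 \<and> joint_input N g \<kappa> = \<kappa>' \<and> \<not> implements (G \<kappa>') (V \<kappa>). (cmod (b \<kappa>))\<^sup>2))"
      unfolding sum_distrib_left by (intro sum.cong) (auto simp: a'_def norm_mult power_mult_distrib)
    also have "\<dots> \<le> (\<Sum>\<kappa>' | \<kappa>' \<in> PiE {..<N} K1 \<and> joint_input N f \<kappa>' = z \<and> \<not> implements (U z) (W \<kappa>'). (cmod (a \<kappa>'))\<^sup>2 * (1 - \<eta> ^ (N - 1)))"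
      by (intro sum_mono mult_left_mono bad2) auto
    also have "\<dots> \<le> (1 - \<eta> ^ (N - 1)) ^ n * (1 - \<eta> ^ (N - 1))"
      unfolding sum_distrib_right[symmetric] by (intro mult_right_mono bad z \<delta>)
    finally show ?thesis by (simp add: mult.commute)
  qed
  with cen uni show ?case by blast
qed

end

section \<open>Qubit-wise unitaries, Hilbert space vectors and EPR pairs\<close>

lemma tensor_eq_tens: "tensor N T = tens {..<N} T"
  by (simp add: tensor_def tens_def fun_eq_iff)

lemma finite_bits: "finite S \<Longrightarrow> finite (bits S)"
  by (simp add: bits_def finite_PiE)

lemma card_bits: "finite S \<Longrightarrow> card (bits S) = 2 ^ card S"
  by (simp add: bits_def card_PiE)

lemma qubitwise_unitaryE:
  assumes "qubitwise_unitary n V"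
  obtains c v where "cmod c = 1" "\<And>i. i < n \<Longrightarrow> unitary_on UNIV (v i :: bool \<Rightarrow> bool \<Rightarrow> complex)"
    "\<And>r b. r \<in> bits {..<n} \<Longrightarrow> b \<in> bits {..<n} \<Longrightarrow> V r b = c * tens {..<n} v r b"
  using assms unfolding qubitwise_unitary_def tens_def by blast

lemma qubitwise_unitaryI:
  assumes "cmod c = 1" "\<And>i. i < n \<Longrightarrow> unitary_on UNIV (v i :: bool \<Rightarrow> bool \<Rightarrow> complex)"
    "\<And>r b. r \<in> bits {..<n} \<Longrightarrow> b \<in> bits {..<n} \<Longrightarrow> V r b = c * tens {..<n} v r b"
  shows "qubitwise_unitary n V"
  using assms unfolding qubitwise_unitary_def tens_def by blast

lemma qubitwise_unitary_mat_mult: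
  assumes "qubitwise_unitary n V" "qubitwise_unitary n W"
  shows "qubitwise_unitary n (mat_mult (bits {..<n}) V W)"
proof -
  obtain c v where v: "cmod c = 1" "\<And>i. i < n \<Longrightarrow> unitary_on UNIV (v i :: bool \<Rightarrow> bool \<Rightarrow> complex)"
    "\<And>r b. r \<in> bits {..<n} \<Longrightarrow> b \<in> bits {..<n} \<Longrightarrow> V r b = c * tens {..<n} v r b"
    using assms(1) by (rule qubitwise_unitaryE) blast
  obtain d w where w: "cmod d = 1" "\<And>i. i < n \<Longrightarrow> unitary_on UNIV (w i :: bool \<Rightarrow> bool \<Rightarrow> complex)"
    "\<And>r b. r \<in> bits {..<n} \<Longrightarrow> b \<in> bits {..<n} \<Longrightarrow> W r b = d * tens {..<n} w r b"
    using assms(2) by (rule qubitwise_unitaryE) blast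
  show ?thesis
  proof (rule qubitwise_unitaryI[of "c * d"])
    show "cmod (c * d) = 1" using v w by (simp add: norm_mult)
    show "unitary_on UNIV (mat_mult UNIV (v i) (w i))" if "i < n" for i
      using v(2) w(2) that by (intro unitary_on_mat_mult) auto
    fix r b assume rb: "r \<in> bits {..<n}" "b \<in> bits {..<n}"
    have "mat_mult (bits {..<n}) V W r b = c * d * mat_mult (bits {..<n}) (tens {..<n} v) (tens {..<n} w) r b"
      unfolding mat_mult_def sum_distrib_left using rb v(3) w(3) by (intro sum.cong refl) (simp add: mult_ac)
    then show "mat_mult (bits {..<n}) V W r b = c * d * tens {..<n} (\<lambda>i. mat_mult UNIV (v i) (w i)) r b"
      unfolding bits_def by (subst (asm) mat_mult_tens) auto
  qed
qed

lemma qubitwise_unitary_adj: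
  assumes "qubitwise_unitary n V"
  shows "qubitwise_unitary n (adj V)"
proof -
  obtain c v where v: "cmod c = 1" "\<And>i. i < n \<Longrightarrow> unitary_on UNIV (v i :: bool \<Rightarrow> bool \<Rightarrow> complex)"
    "\<And>r b. r \<in> bits {..<n} \<Longrightarrow> b \<in> bits {..<n} \<Longrightarrow> V r b = c * tens {..<n} v r b"
    using assms by (rule qubitwise_unitaryE) blast
  show ?thesis
    by (rule qubitwise_unitaryI[of "cnj c" n "\<lambda>i. adj (v i)"])
      (use v in \<open>auto simp: unitary_on_adj adj_tens[symmetric]\<close>, auto simp: adj_def v)
qed

lemma qubitwise_unitary_scale:
  assumes "qubitwise_unitary n V" "cmod d = 1"
  shows "qubitwise_unitary n (\<lambda>r b. d * V r b)"
proof -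
  obtain c v where v: "cmod c = 1" "\<And>i. i < n \<Longrightarrow> unitary_on UNIV (v i :: bool \<Rightarrow> bool \<Rightarrow> complex)"
    "\<And>r b. r \<in> bits {..<n} \<Longrightarrow> b \<in> bits {..<n} \<Longrightarrow> V r b = c * tens {..<n} v r b"
    using assms(1) by (rule qubitwise_unitaryE) blast
  then show ?thesis
    using assms(2) by (intro qubitwise_unitaryI[of "d * c" n v]) (auto simp: norm_mult)
qed

lemma qubitwise_unitary_unitary:
  assumes "qubitwise_unitary n V"
  shows "unitary_on (bits {..<n}) V"
proof -
  obtain c v where v: "cmod c = 1" "\<And>i. i < n \<Longrightarrow> unitary_on UNIV (v i :: bool \<Rightarrow> bool \<Rightarrow> complex)"
    "\<And>r b. r \<in> bits {..<n} \<Longrightarrow> b \<in> bits {..<n} \<Longrightarrow> V r b = c * tens {..<n} v r b"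
    using assms by (rule qubitwise_unitaryE) blast
  have c: "cnj c * c = 1" using v(1) by (metis complex_norm_square mult.commute of_real_1 one_power2)
  have "unitary_on (bits {..<n}) (tens {..<n} v)"
    unfolding bits_def using v by (intro unitary_on_tens) auto
  moreover have "cnj (c * s) * (c * t) = cnj s * t" "(c * s) * cnj (c * t) = s * cnj t" for s t
    using c by (simp_all add: mult_ac)
  ultimately have "unitary_on (bits {..<n}) (\<lambda>r b. c * tens {..<n} v r b)"
    by (simp only: unitary_on_def)
  then show ?thesis by (subst unitary_on_cong[OF v(3)])
qed

lemma qubitwise_unitary_id_mat: "qubitwise_unitary n id_mat"
proof (rule qubitwise_unitaryI[of 1 n "\<lambda>i. id_mat"])
  show "unitary_on UNIV (id_mat :: bool \<Rightarrow> bool \<Rightarrow> complex)" by (rule unitary_on_id_mat) simp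
  fix r b assume "r \<in> bits {..<n}" "b \<in> bits {..<n}"
  then show "id_mat r b = 1 * tens {..<n} (\<lambda>i. id_mat) r b"
    unfolding bits_def by (subst tens_id_mat) auto
qed simp

definition qpauli :: "nat \<Rightarrow> (nat \<Rightarrow> bool \<times> bool) \<Rightarrow> sys \<Rightarrow> sys \<Rightarrow> complex"
  where "qpauli n k = tens {..<n} (\<lambda>i. pauli (k i))"

definition qpaulis :: "nat \<Rightarrow> (nat \<Rightarrow> bool \<times> bool) set"
  where "qpaulis n = {..<n} \<rightarrow>\<^sub>E UNIV"

lemma error_basis_qpauli: "error_basis (bits {..<n}) (qpaulis n) (qpauli n)"
  unfolding bits_def qpaulis_def qpauli_def using error_basis_pauli by (intro error_basis_tens) auto

lemma qubitwise_unitary_qpauli: "qubitwise_unitary n (qpauli n k)"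
  using error_basisD(5)[OF error_basis_pauli]
  by (intro qubitwise_unitaryI[of 1 n "\<lambda>i. pauli (k i)"]) (auto simp: qpauli_def)

text \<open>The class \<open>L\<close> of corrections to which the rounds are applied.\<close>

definition local_qubitwise :: "nat \<Rightarrow> (nat \<Rightarrow> nat) \<Rightarrow> (all_sys \<Rightarrow> all_sys \<Rightarrow> complex) \<Rightarrow> bool"
  where "local_qubitwise N n T \<longleftrightarrow> (\<exists>V. (\<forall>p<N. qubitwise_unitary (n p) (V p)) \<and>
    (\<forall>r\<in>sys_basis N n. \<forall>b\<in>sys_basis N n. T r b = tens {..<N} V r b))"

lemma local_qubitwiseI:
  assumes "\<And>p. p < N \<Longrightarrow> qubitwise_unitary (n p) (V p)"
    "\<And>r b. r \<in> sys_basis N n \<Longrightarrow> b \<in> sys_basis N n \<Longrightarrow> T r b = tens {..<N} V r b"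
  shows "local_qubitwise N n T"
  using assms unfolding local_qubitwise_def by blast

lemma local_qubitwiseE:
  assumes "local_qubitwise N n T"
  obtains V where "\<And>p. p < N \<Longrightarrow> qubitwise_unitary (n p) (V p)"
    "\<And>r b. r \<in> sys_basis N n \<Longrightarrow> b \<in> sys_basis N n \<Longrightarrow> T r b = tens {..<N} V r b"
  using assms unfolding local_qubitwise_def by blast

lemma finite_sys_basis: "finite (sys_basis N n)"
  unfolding sys_basis_def by (intro finite_PiE finite_bits) simp_all

lemma local_qubitwise_mat_mult:
  assumes "local_qubitwise N n S" "local_qubitwise N n T"
  shows "local_qubitwise N n (mat_mult (sys_basis N n) S T)"
proof -
  obtain V where V: "\<And>p. p < N \<Longrightarrow> qubitwise_unitary (n p) (V p)"
    "\<And>r b. r \<in> sys_basis N n \<Longrightarrow> b \<in> sys_basis N n \<Longrightarrow> S r b = tens {..<N} V r b"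
    using assms(1) by (rule local_qubitwiseE) blast
  obtain W where W: "\<And>p. p < N \<Longrightarrow> qubitwise_unitary (n p) (W p)"
    "\<And>r b. r \<in> sys_basis N n \<Longrightarrow> b \<in> sys_basis N n \<Longrightarrow> T r b = tens {..<N} W r b"
    using assms(2) by (rule local_qubitwiseE) blast
  show ?thesis
  proof (rule local_qubitwiseI)
    show "qubitwise_unitary (n p) (mat_mult (bits {..<n p}) (V p) (W p))" if "p < N" for p
      using V(1) W(1) that by (intro qubitwise_unitary_mat_mult)
    fix r b assume rb: "r \<in> sys_basis N n" "b \<in> sys_basis N n"
    have "mat_mult (sys_basis N n) S T r b = mat_mult (sys_basis N n) (tens {..<N} V) (tens {..<N} W) r b"
      using rb V W by (intro mat_mult_cong) auto
    then show "mat_mult (sys_basis N n) S T r b = tens {..<N} (\<lambda>p. mat_mult (bits {..<n p}) (V p) (W p)) r b"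
      unfolding sys_basis_def by (simp add: mat_mult_tens finite_bits)
  qed
qed

lemma local_qubitwise_adj:
  assumes "local_qubitwise N n T"
  shows "local_qubitwise N n (adj T)"
proof -
  obtain V where V: "\<And>p. p < N \<Longrightarrow> qubitwise_unitary (n p) (V p)"
    "\<And>r b. r \<in> sys_basis N n \<Longrightarrow> b \<in> sys_basis N n \<Longrightarrow> T r b = tens {..<N} V r b"
    using assms(1) by (rule local_qubitwiseE) blast
  then show ?thesis
    by (intro local_qubitwiseI[where V="\<lambda>p. adj (V p)"] qubitwise_unitary_adj) (simp_all add: adj_tens[symmetric], simp add: adj_def)
qed

text \<open>The phase is put into the factor of Alice. Should she hold no qubit, it is the explicit
  phase in \<open>qubitwise_unitary\<close> that takes it up.\<close>

lemma local_qubitwise_scale: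
  assumes "local_qubitwise N n T" "cmod c = 1" "N > 0"
  shows "local_qubitwise N n (\<lambda>r b. c * T r b)"
proof -
  obtain V where V: "\<And>p. p < N \<Longrightarrow> qubitwise_unitary (n p) (V p)"
    "\<And>r b. r \<in> sys_basis N n \<Longrightarrow> b \<in> sys_basis N n \<Longrightarrow> T r b = tens {..<N} V r b"
    using assms(1) by (rule local_qubitwiseE) blast
  show ?thesis
  proof (rule local_qubitwiseI[where V="V(0 := \<lambda>r b. c * V 0 r b)"])
    show "qubitwise_unitary (n p) ((V(0 := \<lambda>r b. c * V 0 r b)) p)" if "p < N" for p
      using V(1)[OF that] assms by (auto intro: qubitwise_unitary_scale)
    fix r b assume "r \<in> sys_basis N n" "b \<in> sys_basis N n"
    then have "T r b = tens {..<N} V r b" by (rule V)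
    also have "c * \<dots> = tens {..<N} (V(0 := \<lambda>r b. c * V 0 r b)) r b"
    proof -
      have "tens {..<N} T' r b = T' 0 (r 0) (b 0) * (\<Prod>p\<in>{..<N} - {0}. T' p (r p) (b p))" for T'
        unfolding tens_def by (rule prod.remove) (use assms in auto)
      then show ?thesis by simp
    qed
    finally show "c * T r b = tens {..<N} (V(0 := \<lambda>r b. c * V 0 r b)) r b" .
  qed
qed

lemma local_qubitwise_unitary:
  assumes "local_qubitwise N n T"
  shows "unitary_on (sys_basis N n) T"
proof -
  obtain V where V: "\<And>p. p < N \<Longrightarrow> qubitwise_unitary (n p) (V p)"
    "\<And>r b. r \<in> sys_basis N n \<Longrightarrow> b \<in> sys_basis N n \<Longrightarrow> T r b = tens {..<N} V r b"
    using assms(1) by (rule local_qubitwiseE) blast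
  have "unitary_on (sys_basis N n) (tens {..<N} V)"
    unfolding sys_basis_def by (intro unitary_on_tens qubitwise_unitary_unitary V(1) finite_bits) simp_all
  then show ?thesis by (subst unitary_on_cong[OF V(2)])
qed

lemma card_sys_basis: "card (sys_basis N n) = 2 ^ (\<Sum>p<N. n p)"
  by (simp add: sys_basis_def card_PiE card_bits power_sum)

lemma local_corrections_qpauli:
  assumes "N > 0"
  shows "local_corrections N (sys_basis N n) (PiE {..<N} (\<lambda>p. qpaulis (n p)))
    (\<lambda>k. tens {..<N} (\<lambda>p. qpauli (n p) (k p))) (local_qubitwise N n)"
proof
  show "error_basis (sys_basis N n) (PiE {..<N} (\<lambda>p. qpaulis (n p))) (\<lambda>k. tens {..<N} (\<lambda>p. qpauli (n p) (k p)))"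
    unfolding sys_basis_def by (intro error_basis_tens error_basis_qpauli) simp
  show "local_qubitwise N n (tens {..<N} (\<lambda>p. qpauli (n p) (k p)))" for k
    by (rule local_qubitwiseI[OF qubitwise_unitary_qpauli]) simp
  show "local_qubitwise N n T" if "local_qubitwise N n S"
    "\<And>r b. r \<in> sys_basis N n \<Longrightarrow> b \<in> sys_basis N n \<Longrightarrow> T r b = S r b" for S T
    using that unfolding local_qubitwise_def by simp
qed (use assms card_sys_basis in \<open>auto intro: local_qubitwise_mat_mult local_qubitwise_unitary\<close>)

section \<open>Vectors with values in a Hilbert space\<close>

lemma scaleC_zero_left: "0 *\<^sub>C (x :: 'e :: complex_hilbert) = 0"
  using scaleC_of_real[of 0 x] by simp

lemma scaleC_zero_right: "a *\<^sub>C (0 :: 'e :: complex_hilbert) = 0"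
  using scaleC_scaleC[of a 0 "0 :: 'e"] by (simp add: scaleC_zero_left)

lemma scaleC_sum_right: "a *\<^sub>C (\<Sum>x\<in>A. f x) = (\<Sum>x\<in>A. a *\<^sub>C (f x :: 'e :: complex_hilbert))"
  by (induction A rule: infinite_finite_induct) (simp_all add: scaleC_zero_right scaleC_add_right)

lemma scaleC_sum_left: "(\<Sum>x\<in>A. f x) *\<^sub>C y = (\<Sum>x\<in>A. f x *\<^sub>C (y :: 'e :: complex_hilbert))"
  by (induction A rule: infinite_finite_induct) (simp_all add: scaleC_zero_left scaleC_add_left)

lemma cinner_zero_right: "cinner (x :: 'e :: complex_hilbert) 0 = 0"
  using cinner_scaleC_right[of x 0 0] by (simp add: scaleC_zero_left)

lemma cinner_sum_right: "cinner (x :: 'e :: complex_hilbert) (\<Sum>a\<in>A. f a) = (\<Sum>a\<in>A. cinner x (f a))"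
  by (induction A rule: infinite_finite_induct) (simp_all add: cinner_zero_right cinner_add_right)

lemma cinner_sum_left: "cinner (\<Sum>a\<in>A. f a) (x :: 'e :: complex_hilbert) = (\<Sum>a\<in>A. cinner (f a) x)"
  by (subst (1 2) cinner_commute) (simp add: cinner_sum_right)

lemma cinner_scaleC_left: "cinner (a *\<^sub>C x) (y :: 'e :: complex_hilbert) = cnj a * cinner x y"
  by (subst (1 2) cinner_commute) (simp add: cinner_scaleC_right)

lemma apply_op_mat_mult:
  "apply_op B S (apply_op A T \<psi>) r = apply_op A (mat_mult B S T) (\<psi> :: 'b \<Rightarrow> 'e :: complex_hilbert) r"
  unfolding apply_op_def mat_mult_def scaleC_sum_right scaleC_sum_left
  by (subst sum.swap) (simp add: scaleC_scaleC)

lemma apply_op_cong: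
  "(\<And>b. b \<in> A \<Longrightarrow> S r b = T r b) \<Longrightarrow> (\<And>b. b \<in> A \<Longrightarrow> \<psi> b = \<phi> b) \<Longrightarrow> apply_op A S \<psi> r = apply_op A T \<phi> r"
  unfolding apply_op_def by (intro sum.cong refl) simp

lemma apply_op_scale: "apply_op A (\<lambda>r b. c * T r b) \<psi> r = c *\<^sub>C apply_op A T \<psi> r"
  by (simp add: apply_op_def scaleC_sum_right scaleC_scaleC)

text \<open>This is why the probability of an outcome whose Kraus operator is a scalar times a
  unitary does not depend on the state.\<close>

lemma sq_norm_isometry:
  assumes "finite A" "isometry_on A B T"
  shows "sq_norm B (apply_op A T \<psi>) = sq_norm A (\<psi> :: 'b \<Rightarrow> 'e :: complex_hilbert)"
proof -
  have "complex_of_real (sq_norm B (apply_op A T \<psi>)) = (\<Sum>r\<in>B. cinner (apply_op A T \<psi> r) (apply_op A T \<psi> r))"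
    by (simp add: sq_norm_def cinner_self)
  also have "\<dots> = (\<Sum>r\<in>B. \<Sum>i\<in>A. \<Sum>j\<in>A. cnj (T r i) * T r j * cinner (\<psi> i) (\<psi> j))"
    unfolding apply_op_def cinner_sum_left
    by (intro sum.cong refl)
      (simp only: cinner_sum_right cinner_scaleC_left cinner_scaleC_right mult_ac sum_distrib_left)
  also have "\<dots> = (\<Sum>i\<in>A. \<Sum>j\<in>A. (\<Sum>r\<in>B. cnj (T r i) * T r j) * cinner (\<psi> i) (\<psi> j))"
    by (subst sum.swap, intro sum.cong refl, subst sum.swap) (simp add: sum_distrib_right)
  also have "\<dots> = (\<Sum>i\<in>A. \<Sum>j\<in>A. if j = i then cinner (\<psi> i) (\<psi> i) else 0)"
    using assms(2) by (intro sum.cong refl) (auto simp: isometry_onD id_mat_def)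
  also have "\<dots> = complex_of_real (sq_norm A \<psi>)"
    using assms(1) by (simp add: sq_norm_def cinner_self)
  finally show ?thesis by (simp only: of_real_eq_iff)
qed

lemma sq_norm_scale:
  "sq_norm A (\<lambda>b. c *\<^sub>C \<psi> b) = (cmod c)\<^sup>2 * sq_norm A (\<psi> :: 'b \<Rightarrow> 'e :: complex_hilbert)"
proof -
  have "(norm (c *\<^sub>C x))\<^sup>2 = (cmod c)\<^sup>2 * (norm x)\<^sup>2" for x :: 'e
  proof -
    have "complex_of_real ((norm (c *\<^sub>C x))\<^sup>2) = cnj c * c * complex_of_real ((norm x)\<^sup>2)"
      by (simp only: cinner_self[symmetric] cinner_scaleC_left cinner_scaleC_right mult_ac)
    also have "\<dots> = complex_of_real ((cmod c)\<^sup>2 * (norm x)\<^sup>2)"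
      by (simp only: of_real_mult complex_norm_square mult_ac)
    finally show ?thesis by (simp only: of_real_eq_iff)
  qed
  then show ?thesis by (simp add: sq_norm_def sum_distrib_left)
qed

text \<open>All entanglement is shared with Alice, as the users never interact directly in the
  protocol.\<close>

definition star_links :: "(nat \<Rightarrow> nat) \<Rightarrow> nat \<Rightarrow> nat \<Rightarrow> nat"
  where "star_links l p q = (if p = 0 then l q else 0)"

lemma halves_star_alice: "halves N (star_links l) 0 = {(q, i). q \<in> {1..<N} \<and> i < l q}"
  by (auto simp: halves_def star_links_def)

lemma halves_star_user: "p \<in> {1..<N} \<Longrightarrow> halves N (star_links l) p = {0} \<times> {..<l p}"
  by (auto simp: halves_def star_links_def min_def max_def split: if_splits)

lemma epr_pairs_star:
  assumes "N > 0"
  shows "epr_pairs N (star_links l) h = (\<Prod>q=1..<N. \<Prod>i<l q. epr (h 0 (q, i)) (h q (0, i)))"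
proof -
  have "epr_pairs N (star_links l) h
      = (\<Prod>p<N. if p = 0 then \<Prod>q=1..<N. \<Prod>i<l q. epr (h 0 (q, i)) (h q (0, i)) else 1)"
    unfolding epr_pairs_def
    by (intro prod.cong refl) (auto simp: star_links_def atLeastSucLessThan_greaterThanLessThan[symmetric])
  then show ?thesis using assms by simp
qed

text \<open>
  The EPR pairs between Alice and a user act as a maximally entangled state on any label set of
  the right cardinality; \<open>va\<close> and \<open>vu\<close> read off the labels from the halves.
\<close>

lemma epr_labels:
  fixes B :: "nat \<Rightarrow> 'l set"
  assumes N: "N > 0" and B: "\<forall>q\<in>{1..<N}. card (B q) = 2 ^ l q"
  obtains va vu where
    "\<And>h. h \<in> bits (halves N (star_links l) 0) \<Longrightarrow> va h \<in> PiE {1..<N} B"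
    "inj_on va (bits (halves N (star_links l) 0))"
    "\<And>q h. q \<in> {1..<N} \<Longrightarrow> h \<in> bits (halves N (star_links l) q) \<Longrightarrow> vu q h \<in> B q"
    "\<And>q. q \<in> {1..<N} \<Longrightarrow> inj_on (vu q) (bits (halves N (star_links l) q))"
    "\<And>F G. (\<Sum>h\<in>ebit_basis N (star_links l). F (va (h 0)) * (\<Prod>q=1..<N. G q (vu q (h q))) * epr_pairs N (star_links l) h)
      = (\<Sum>s\<in>PiE {1..<N} B. F s * (\<Prod>q=1..<N. G q (s q) / complex_of_real (sqrt (card (B q)))))"
proof -
  let ?I = "{1..<N}"
  have "\<exists>g. \<forall>q\<in>?I. bij_betw (g q) (bits {..<l q}) (B q)"
  proof (rule bchoice, rule ballI)
    fix q assume "q \<in> ?I"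
    then have c: "card (B q) = 2 ^ l q" using B by blast
    then have "finite (B q)" by (metis card.infinite power_eq_0_iff zero_neq_numeral)
    then show "\<exists>g. bij_betw g (bits {..<l q}) (B q)"
      using c by (intro finite_same_card_bij) (simp_all add: finite_bits card_bits)
  qed
  then obtain g where g: "\<And>q. q \<in> ?I \<Longrightarrow> bij_betw (g q) (bits {..<l q}) (B q)" by blast
  let ?ha = "halves N (star_links l)"
  define va where "va h = (\<lambda>q\<in>?I. g q (\<lambda>i\<in>{..<l q}. h (q, i)))" for h
  define vu where "vu q h = g q (\<lambda>i\<in>{..<l q}. h (0 :: nat, i))" for q h
  \<comment> \<open>The configuration of all halves in which both ends of each EPR pair carry the
    bit given by \<open>t\<close>.\<close>
  define H where "H t = (\<lambda>p\<in>{..<N}. if p = 0 then (\<lambda>x\<in>?ha 0. t (fst x) (snd x)) else (\<lambda>x\<in>?ha p. t p (snd x)))"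
    for t :: "nat \<Rightarrow> nat \<Rightarrow> bool"
  let ?T = "PiE ?I (\<lambda>q. bits {..<l q})"
  have inbits: "(\<lambda>i\<in>{..<l q}. t i) \<in> bits {..<l q}" for q t by (simp add: bits_def)
  have g_inj: "x = y" if "q \<in> ?I" "g q x = g q y" "x \<in> bits {..<l q}" "y \<in> bits {..<l q}" for q x y
    using bij_betw_imp_inj_on[OF g[OF that(1)]] that(2-) by (rule inj_onD)
  show ?thesis
  proof (rule that[of va vu])
    show "va h \<in> PiE ?I B" for h
      unfolding va_def using bij_betwE[OF g] inbits by auto
    show "vu q h \<in> B q" if "q \<in> ?I" for q h
      unfolding vu_def using bij_betwE[OF g[OF that]] inbits by auto
    show "inj_on va (bits (?ha 0))"
    proof (rule inj_onI)
      fix h h' assume h: "h \<in> bits (?ha 0)" "h' \<in> bits (?ha 0)" "va h = va h'"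
      have "h (q, i) = h' (q, i)" if q: "q \<in> ?I" "i < l q" for q i
      proof -
        have "g q (\<lambda>i\<in>{..<l q}. h (q, i)) = g q (\<lambda>i\<in>{..<l q}. h' (q, i))"
          using fun_cong[OF h(3), of q] q(1) by (simp add: va_def)
        then have "(\<lambda>i\<in>{..<l q}. h (q, i)) = (\<lambda>i\<in>{..<l q}. h' (q, i))" using q(1) inbits by (intro g_inj)
        from fun_cong[OF this, of i] show ?thesis using q by simp
      qed
      then show "h = h'"
        using h(1,2) unfolding bits_def halves_star_alice by (intro PiE_ext[of h _ _ h']) auto
    qed
    show "inj_on (vu q) (bits (?ha q))" if q: "q \<in> ?I" for q
    proof (rule inj_onI)
      fix h h' assume h: "h \<in> bits (?ha q)" "h' \<in> bits (?ha q)" "vu q h = vu q h'"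
      have "(\<lambda>i\<in>{..<l q}. h (0, i)) = (\<lambda>i\<in>{..<l q}. h' (0, i))"
        using h(3) q inbits unfolding vu_def by (intro g_inj)
      then have "h (0, i) = h' (0, i)" if "i < l q" for i
        using that by (metis lessThan_iff restrict_apply')
      then show "h = h'"
        using h(1,2) unfolding bits_def halves_star_user[OF q] by (intro PiE_ext[of h _ _ h']) auto
    qed
    fix F :: "(nat \<Rightarrow> 'l) \<Rightarrow> complex" and G :: "nat \<Rightarrow> 'l \<Rightarrow> complex"
    let ?F = "\<lambda>h. F (va (h 0)) * (\<Prod>q\<in>?I. G q (vu q (h q))) * epr_pairs N (star_links l) h"
    have HT: "H t \<in> ebit_basis N (star_links l)" for t
      unfolding H_def ebit_basis_def bits_def by auto
    have vaH: "va (H t 0) = (\<lambda>q\<in>?I. g q (t q))" if "t \<in> ?T" for t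
    proof -
      have "(\<lambda>i\<in>{..<l q}. H t 0 (q, i)) = t q" if q: "q \<in> ?I" for q
      proof -
        have "t q \<in> extensional {..<l q}" using PiE_mem[OF \<open>t \<in> ?T\<close> q] by (simp add: bits_def PiE_iff)
        then show ?thesis using q N
          by (intro extensionalityI[of _ "{..<l q}"]) (auto simp: H_def halves_star_alice)
      qed
      then show ?thesis unfolding va_def by (intro restrict_ext) simp
    qed
    have vuH: "vu q (H t q) = g q (t q)" if "t \<in> ?T" "q \<in> ?I" for t q
    proof -
      have "t q \<in> extensional {..<l q}" using PiE_mem[OF that] by (simp add: bits_def PiE_iff)
      then have "(\<lambda>i\<in>{..<l q}. H t q (0, i)) = t q"
        using that(2) by (intro extensionalityI[of _ "{..<l q}"]) (auto simp: H_def halves_star_user)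
      then show ?thesis by (simp add: vu_def)
    qed
    have eprH: "epr_pairs N (star_links l) (H t) = (\<Prod>q\<in>?I. 1 / complex_of_real (sqrt (card (B q))))" for t
      unfolding epr_pairs_star[OF N]
    proof (intro prod.cong refl)
      fix q assume q: "q \<in> ?I"
      have "(\<Prod>i<l q. epr (H t 0 (q, i)) (H t q (0, i))) = (\<Prod>i<l q. 1 / complex_of_real (sqrt 2))"
        using q N by (intro prod.cong refl) (auto simp: H_def halves_star_alice halves_star_user epr_def)
      then show "(\<Prod>i<l q. epr (H t 0 (q, i)) (H t q (0, i))) = 1 / complex_of_real (sqrt (card (B q)))"
        using B q by (simp add: power_divide real_sqrt_power)
    qed
    have inj: "inj_on H ?T"
    proof (rule inj_onI)
      fix t t' assume t: "t \<in> ?T" "t' \<in> ?T" "H t = H t'"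
      then have "(\<lambda>q\<in>?I. g q (t q)) = (\<lambda>q\<in>?I. g q (t' q))" using vaH by metis
      then have "g q (t q) = g q (t' q)" if "q \<in> ?I" for q using that by (metis restrict_apply')
      then show "t = t'" using PiE_mem[OF t(1)] PiE_mem[OF t(2)] by (intro PiE_ext[OF t(1,2)]) (rule g_inj)
    qed
    \<comment> \<open>\<open>epr\<close> vanishes on unequal bits, so exactly the configurations of
      the form \<open>H t\<close> survive.\<close>
    have "(\<Sum>h\<in>ebit_basis N (star_links l). ?F h) = (\<Sum>h\<in>H ` ?T. ?F h)"
    proof (rule sum.mono_neutral_right)
      have "finite (?ha p)" if "p < N" for p
        using finite_subset[of "?ha p" "Sigma {..<N} (\<lambda>q. {..<star_links l (min p q) (max p q)})"]
        by (auto simp: halves_def)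
      then show "finite (ebit_basis N (star_links l))"
        unfolding ebit_basis_def by (intro finite_PiE finite_bits) auto
      show "H ` ?T \<subseteq> ebit_basis N (star_links l)" using HT by auto
      show "\<forall>h\<in>ebit_basis N (star_links l) - H ` ?T. ?F h = 0"
      proof
        fix h assume h: "h \<in> ebit_basis N (star_links l) - H ` ?T"
        define t where "t = (\<lambda>q\<in>?I. \<lambda>i\<in>{..<l q}. h 0 (q, i))"
        have t: "t \<in> ?T" unfolding t_def using inbits by auto
        have hb: "h p \<in> bits (?ha p)" if "p < N" for p using h that by (auto simp: ebit_basis_def)
        have "\<exists>q\<in>?I. \<exists>i<l q. h 0 (q, i) \<noteq> h q (0, i)"
        proof (rule ccontr)
          assume n: "\<not> ?thesis"
          have "h = H t"
          proof (rule PiE_ext)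
            show "h \<in> PiE {..<N} (\<lambda>p. bits (?ha p))" using h by (simp add: ebit_basis_def)
            show "H t \<in> PiE {..<N} (\<lambda>p. bits (?ha p))" using HT by (simp add: ebit_basis_def)
            fix p assume p: "p \<in> {..<N}"
            show "h p = H t p"
            proof (cases "p = 0")
              case True
              have "h 0 = (\<lambda>x\<in>?ha 0. t (fst x) (snd x))"
                using hb[OF N] by (intro extensionalityI[of _ "?ha 0"]) (auto simp: bits_def PiE_iff t_def halves_star_alice)
              then show ?thesis using True N by (simp add: H_def)
            next
              case False
              then have pI: "p \<in> ?I" using p by auto
              have "h p = (\<lambda>x\<in>?ha p. t p (snd x))"
                using hb[of p] p n pI
                by (intro extensionalityI[of _ "?ha p"]) (auto simp: bits_def PiE_iff t_def halves_star_user[OF pI])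
              then show ?thesis using False p by (simp add: H_def)
            qed
          qed
          then show False using h t by blast
        qed
        then obtain q i where qi: "q \<in> ?I" "i < l q" "h 0 (q, i) \<noteq> h q (0, i)" by blast
        have "(\<Prod>i<l q. epr (h 0 (q, i)) (h q (0, i))) = 0"
          using qi by (intro prod_zero bexI[of _ i]) (auto simp: epr_def)
        then have "epr_pairs N (star_links l) h = 0"
          unfolding epr_pairs_star[OF N] using qi(1) by (intro prod_zero) auto
        then show "?F h = 0" by simp
      qed
    qed
    also have "\<dots> = (\<Sum>t\<in>?T. ?F (H t))" by (subst sum.reindex[OF inj]) (simp only: o_def)
    also have "\<dots> = (\<Sum>t\<in>?T. F (\<lambda>q\<in>?I. g q (t q)) * (\<Prod>q\<in>?I. G q (g q (t q)) / complex_of_real (sqrt (card (B q)))))"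
    proof (intro sum.cong refl)
      fix t assume t: "t \<in> ?T"
      show "?F (H t) = F (\<lambda>q\<in>?I. g q (t q)) * (\<Prod>q\<in>?I. G q (g q (t q)) / complex_of_real (sqrt (card (B q))))"
        unfolding eprH vaH[OF t] mult.assoc prod.distrib[symmetric]
        using vuH[OF t] by (intro arg_cong2[where f="(*)"] prod.cong refl) simp
    qed
    also have "\<dots> = (\<Sum>s\<in>PiE ?I B. F s * (\<Prod>q\<in>?I. G q (s q) / complex_of_real (sqrt (card (B q)))))"
    proof (rule sum.reindex_bij_witness[where j="\<lambda>t. \<lambda>q\<in>?I. g q (t q)" and i="\<lambda>s. \<lambda>q\<in>?I. inv_into (bits {..<l q}) (g q) (s q)"])
      fix t assume t: "t \<in> ?T"
      show "(\<lambda>q\<in>?I. g q (t q)) \<in> PiE ?I B" using PiE_mem[OF t] bij_betwE[OF g] by (intro restrict_PiE_iff[THEN iffD2]) blast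
      show "(\<lambda>q\<in>?I. inv_into (bits {..<l q}) (g q) ((\<lambda>q\<in>?I. g q (t q)) q)) = t"
        using t bij_betw_inv_into_left[OF g PiE_mem[OF t]]
        by (intro PiE_ext[of _ ?I "\<lambda>q. bits {..<l q}"]) (simp_all add: PiE_iff)
    next
      fix s assume s: "s \<in> PiE ?I B"
      show "(\<lambda>q\<in>?I. inv_into (bits {..<l q}) (g q) (s q)) \<in> ?T"
        using PiE_mem[OF s] bij_betwE[OF bij_betw_inv_into[OF g]] by (intro restrict_PiE_iff[THEN iffD2]) blast
      show "(\<lambda>q\<in>?I. g q ((\<lambda>q\<in>?I. inv_into (bits {..<l q}) (g q) (s q)) q)) = s"
        using s bij_betw_inv_into_right[OF g PiE_mem[OF s]]
        by (intro PiE_ext[of _ ?I B]) (simp_all add: PiE_iff)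
    qed (auto intro!: prod.cong)
    finally show "(\<Sum>h\<in>ebit_basis N (star_links l). ?F h)
      = (\<Sum>s\<in>PiE ?I B. F s * (\<Prod>q\<in>?I. G q (s q) / complex_of_real (sqrt (card (B q)))))" .
  qed
qed

section \<open>Distributing the systems\<close>

lemma lessThan_insert: "N > 0 \<Longrightarrow> {..<N} = insert 0 {1..<N::nat}"
  by auto

lemma prod_lessThan_split: "(N :: nat) > 0 \<Longrightarrow> (\<Prod>p<N. F p) = F 0 * (\<Prod>q=1..<N. F q)"
  by (subst lessThan_insert) simp_all

lemma sum_PiE_Times:
  "(\<Sum>s\<in>PiE I (\<lambda>q. A q \<times> B q). G s) = (\<Sum>x\<in>PiE I A. \<Sum>y\<in>PiE I B. G (\<lambda>q\<in>I. (x q, y q)))"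
  unfolding sum.cartesian_product
proof (rule sum.reindex_bij_witness[where
        j="\<lambda>s. (\<lambda>q\<in>I. fst (s q), \<lambda>q\<in>I. snd (s q))" and i="\<lambda>(x, y). \<lambda>q\<in>I. (x q, y q)"])
  fix s assume s: "s \<in> PiE I (\<lambda>q. A q \<times> B q)"
  then have eq: "(\<lambda>q\<in>I. ((\<lambda>q\<in>I. fst (s q)) q, (\<lambda>q\<in>I. snd (s q)) q)) = s"
    by (auto simp: PiE_iff extensional_def fun_eq_iff)
  show "(case (\<lambda>q\<in>I. fst (s q), \<lambda>q\<in>I. snd (s q)) of (x, y) \<Rightarrow> \<lambda>q\<in>I. (x q, y q)) = s"
    unfolding prod.case by (rule eq)
  show "(case (\<lambda>q\<in>I. fst (s q), \<lambda>q\<in>I. snd (s q)) of (x, y) \<Rightarrow> G (\<lambda>q\<in>I. (x q, y q))) = G s"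
    unfolding prod.case by (rule arg_cong[OF eq])
  show "(\<lambda>q\<in>I. fst (s q), \<lambda>q\<in>I. snd (s q)) \<in> PiE I A \<times> PiE I B"
    using s by (force simp: PiE_iff)
qed (auto simp: PiE_iff extensional_def fun_eq_iff)

definition join_alice :: "nat \<Rightarrow> 'a \<Rightarrow> (nat \<Rightarrow> 'a) \<Rightarrow> nat \<Rightarrow> 'a"
  where "join_alice N b i = (\<lambda>p\<in>{..<N}. if p = 0 then b else i p)"

lemma sum_PiE_join_alice:
  assumes "N > 0"
  shows "(\<Sum>c\<in>PiE {..<N} A. G c) = (\<Sum>b\<in>A 0. \<Sum>i\<in>PiE {1..<N} A. G (join_alice N b i))"
  unfolding sum.cartesian_product
proof (rule sum.reindex_bij_witness[where
        j="\<lambda>c. (c 0, \<lambda>q\<in>{1..<N}. c q)" and i="\<lambda>(b, i). join_alice N b i"])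
  fix c assume c: "c \<in> PiE {..<N} A"
  then have eq: "join_alice N (c 0) (\<lambda>q\<in>{1..<N}. c q) = c"
    by (auto simp: join_alice_def PiE_iff extensional_def fun_eq_iff)
  show "(case (c 0, \<lambda>q\<in>{1..<N}. c q) of (b, i) \<Rightarrow> join_alice N b i) = c"
    unfolding prod.case by (rule eq)
  show "(case (c 0, \<lambda>q\<in>{1..<N}. c q) of (b, i) \<Rightarrow> G (join_alice N b i)) = G c"
    unfolding prod.case by (rule arg_cong[OF eq])
  show "(c 0, \<lambda>q\<in>{1..<N}. c q) \<in> A 0 \<times> PiE {1..<N} A"
    using c assms by (auto simp: PiE_iff)
next
  fix x assume "x \<in> A 0 \<times> PiE {1..<N} A"
  then obtain b i where x: "x = (b, i)" "b \<in> A 0" "i \<in> PiE {1..<N} A" by (elim SigmaE) blast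
  show "((case x of (b, i) \<Rightarrow> join_alice N b i) 0, \<lambda>q\<in>{1..<N}. (case x of (b, i) \<Rightarrow> join_alice N b i) q) = x"
    using x assms by (auto simp: join_alice_def PiE_iff extensional_def fun_eq_iff)
  show "(case x of (b, i) \<Rightarrow> join_alice N b i) \<in> PiE {..<N} A"
    using x by (auto simp: join_alice_def PiE_iff)
qed

text \<open>Such Kronecker deltas arise because a user hands over an untouched half of its EPR pairs
  as its output register.\<close>

lemma sum_PiE_id_mat:
  assumes "finite I" "\<And>q. q \<in> I \<Longrightarrow> finite (A q)" "\<And>q. q \<in> I \<Longrightarrow> r q \<in> A q"
  shows "(\<Sum>y\<in>PiE I A. H y * (\<Prod>q\<in>I. id_mat (r q) (y q))) = H (restrict r I)"
proof -
  have r: "restrict r I \<in> PiE I A" using assms by auto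
  have "(\<Sum>y\<in>PiE I A. H y * (\<Prod>q\<in>I. id_mat (r q) (y q))) = (\<Sum>y\<in>PiE I A. if y = restrict r I then H y else 0)"
  proof (intro sum.cong refl)
    fix y assume y: "y \<in> PiE I A"
    have "(\<Prod>q\<in>I. id_mat (r q) (y q)) = tens I (\<lambda>q. id_mat) (restrict r I) y"
      unfolding tens_def by (intro prod.cong) auto
    also have "\<dots> = id_mat (restrict r I) y" using assms(1) r y by (rule tens_id_mat)
    finally show "H y * (\<Prod>q\<in>I. id_mat (r q) (y q)) = (if y = restrict r I then H y else 0)"
      by (auto simp: id_mat_def)
  qed
  then show ?thesis using r assms by (simp add: finite_PiE)
qed

text \<open>The system of Alice stays with her and is never teleported as such, hence the identity
  for party 0.\<close>

definition user_paulis :: "nat \<Rightarrow> (nat \<Rightarrow> nat) \<Rightarrow> (nat \<Rightarrow> nat \<Rightarrow> bool \<times> bool) \<Rightarrow> all_sys \<Rightarrow> all_sys \<Rightarrow> complex"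
  where "user_paulis N n w = tens {..<N} (\<lambda>p. if p = 0 then id_mat else qpauli (n p) (w p))"

lemma user_paulis_split:
  "N > 0 \<Longrightarrow> user_paulis N n w r t = id_mat (r 0) (t 0) * (\<Prod>q=1..<N. qpauli (n q) (w q) (r q) (t q))"
  by (simp add: user_paulis_def tens_def prod_lessThan_split)

lemma local_qubitwise_user_paulis: "local_qubitwise N n (user_paulis N n w)"
  unfolding user_paulis_def
  by (rule local_qubitwiseI[where V="\<lambda>p. if p = 0 then id_mat else qpauli (n p) (w p)"])
    (auto intro: qubitwise_unitary_id_mat qubitwise_unitary_qpauli)

text \<open>
  The users first teleport their systems to Alice, then a protocol with Alice holding everything
  is executed, and finally Alice teleports the systems back.
\<close>

lemma distribute:
  assumes N: "N > 0" and cen: "central N (sys_basis N n) (sys_basis N n) K K' f J"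
    and K: "\<forall>q\<in>{1..<N}. K q = prod_encode ` (Yc q \<times> A q) \<and> bij_betw (h q) (A q) (qpaulis (n q))"
  obtains l Q hw NA NB where
    "bij_betw hw Q (PiE {1..<N} (\<lambda>q. qpaulis (n q)))"
    "\<And>i. i \<in> K 0 \<Longrightarrow> local_operation N n (star_links l) 0 (prod_encode ` (K' 0 \<times> Q))
      (\<lambda>k r x. if f 0 (fst (prod_decode k)) = i then NA k r x else 0)"
    "\<And>q y. q \<in> {1..<N} \<Longrightarrow> y \<in> Yc q \<Longrightarrow> local_operation N n (star_links l) q (K' q)
      (\<lambda>k r x. if fst (prod_decode (f q k)) = y then NB q k r x else 0)"
    "\<And>\<kappa> r b. \<kappa> \<in> PiE {..<N} (K'(0 := prod_encode ` (K' 0 \<times> Q))) \<Longrightarrow> r \<in> sys_basis N n \<Longrightarrow> b \<in> sys_basis N n \<Longrightarrow>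
      (\<Sum>x\<in>ebit_basis N (star_links l). NA (\<kappa> 0) (r 0) (b 0, x 0) * (\<Prod>q=1..<N. NB q (\<kappa> q) (r q) (b q, x q)) *
        epr_pairs N (star_links l) x)
      = (\<Prod>q=1..<N. 1 / (of_nat (card (bits {..<n q})))\<^sup>2) *
        mat_mult (sys_basis N n) (user_paulis N n (hw (snd (prod_decode (\<kappa> 0)))))
          (mat_mult (sys_basis N n) (J (joint_input N ((\<lambda>p. id)(0 := fst \<circ> prod_decode)) \<kappa>))
            (user_paulis N n (\<lambda>q. h q (snd (prod_decode (f q (\<kappa> q))))))) r b"
proof -
  let ?I = "{1..<N}" and ?D = "sys_basis N n"
  note Dfin = finite_sys_basis[of N n]
  let ?b = "\<lambda>q. bits {..<n q}"
  have bfin: "finite (?b q)" for q by (rule finite_bits) simp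
  obtain E \<alpha> \<beta> where
    f: "\<And>p. p < N \<Longrightarrow> finite (K p) \<and> finite (K' p) \<and> f p \<in> K' p \<rightarrow> K p" and
    E: "\<And>q. q \<in> ?I \<Longrightarrow> \<exists>l. card (E q :: nat set) = 2 ^ l" and
    \<alpha>: "\<And>i b b' s s'. i \<in> K 0 \<Longrightarrow> b \<in> ?D \<Longrightarrow> b' \<in> ?D \<Longrightarrow> s \<in> PiE ?I E \<Longrightarrow> s' \<in> PiE ?I E \<Longrightarrow>
      (\<Sum>k | k \<in> K' 0 \<and> f 0 k = i. \<Sum>r\<in>?D. cnj (\<alpha> k r b s) * \<alpha> k r b' s') = id_mat b b' * id_mat s s'" and
    \<beta>: "\<And>q i e e'. q \<in> ?I \<Longrightarrow> i \<in> K q \<Longrightarrow> e \<in> E q \<Longrightarrow> e' \<in> E q \<Longrightarrow>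
      (\<Sum>k | k \<in> K' q \<and> f q k = i. cnj (\<beta> q k e) * \<beta> q k e') = id_mat e e'" and
    J: "\<And>\<kappa> r b. \<kappa> \<in> PiE {..<N} K' \<Longrightarrow> r \<in> ?D \<Longrightarrow> b \<in> ?D \<Longrightarrow> J \<kappa> r b =
      (\<Sum>s\<in>PiE ?I E. \<alpha> (\<kappa> 0) r b s * (\<Prod>q\<in>?I. \<beta> q (\<kappa> q) (s q) / complex_of_real (sqrt (card (E q)))))"
    using cen by (elim centralE) blast
  have "\<exists>le. \<forall>q\<in>?I. card (E q) = 2 ^ le q" using E by (intro bchoice) blast
  then obtain le where le: "\<And>q. q \<in> ?I \<Longrightarrow> card (E q) = 2 ^ le q" by blast
  define d where "d q = card (?b q)" for q
  have d: "d q = 2 ^ n q" for q by (simp add: d_def card_bits)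
  have d0: "d q > 0" for q by (simp add: d)
  define c where "c q = complex_of_real (sqrt (d q))" for q
  have c: "cnj (c q) = c q" "c q * c q = of_nat (d q)" "c q \<noteq> 0" for q
    using d0[of q] by (simp_all add: c_def of_real_mult[symmetric] del: of_real_mult)
  \<comment> \<open>The pairs shared with user \<open>q\<close> have three purposes:
    \<open>n q\<close> of them send its system to Alice, \<open>n q\<close> send it back, and
    \<open>le q\<close> belong to the central protocol. The components of \<open>Lab q\<close>
    follow this order.\<close>
  define l where "l q = n q + (n q + le q)" for q
  define Lab where "Lab q = ?b q \<times> (?b q \<times> E q)" for q
  have cLab: "card (Lab q) = d q * (d q * card (E q))" for q
    by (simp add: Lab_def d_def card_cartesian_product)
  have "\<forall>q\<in>?I. card (Lab q) = 2 ^ l q"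
    using le by (simp add: cLab l_def power_add d)
  then obtain va vu where
    va: "\<And>x. x \<in> bits (halves N (star_links l) 0) \<Longrightarrow> va x \<in> PiE ?I Lab" and
    va_inj: "inj_on va (bits (halves N (star_links l) 0))" and
    vu: "\<And>q x. q \<in> ?I \<Longrightarrow> x \<in> bits (halves N (star_links l) q) \<Longrightarrow> vu q x \<in> Lab q" and
    vu_inj: "\<And>q. q \<in> ?I \<Longrightarrow> inj_on (vu q) (bits (halves N (star_links l) q))" and
    eprs: "\<And>F G. (\<Sum>x\<in>ebit_basis N (star_links l). F (va (x 0)) * (\<Prod>q\<in>?I. G q (vu q (x q))) * epr_pairs N (star_links l) x)
      = (\<Sum>s\<in>PiE ?I Lab. F s * (\<Prod>q\<in>?I. G q (s q) / complex_of_real (sqrt (card (Lab q)))))"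
    by (rule epr_labels[OF N]) blast
  let ?P = "\<lambda>q. qpauli (n q)"
  note eb = error_basisD[OF error_basis_qpauli]
  let ?W = "PiE ?I (\<lambda>q. qpaulis (n q))"
  have finW: "finite ?W" using eb(3) by (intro finite_PiE) auto
  obtain hw and Q :: "nat set" where hw: "bij_betw hw Q ?W"
    using ex_bij_betw_nat_finite[OF finW] by blast
  \<comment> \<open>The last measurement of Alice, with result \<open>w\<close>: the system
    \<open>t q\<close> of each user against the half \<open>y q\<close>, while her own part of
    \<open>t\<close> is her output.\<close>
  define F where "F w y r t = id_mat r (t 0) * (\<Prod>q\<in>?I. ?P q (w q) (y q) (t q) / c q)"
    for w :: "nat \<Rightarrow> nat \<Rightarrow> bool \<times> bool" and y t :: all_sys and r :: sys
  define NAs where "NAs k r b s = (\<Sum>t\<in>?D. F (hw (snd (prod_decode k))) (\<lambda>q. fst (snd (s q))) r t *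
      \<alpha> (fst (prod_decode k)) t (join_alice N b (\<lambda>q. fst (s q))) (\<lambda>q\<in>?I. snd (snd (s q))))"
    for k r b and s :: "nat \<Rightarrow> sys \<times> sys \<times> nat"
  \<comment> \<open>The user measures its system with the first half, outputs the second half as it
    is, and contributes its scalar of the central protocol.\<close>
  define NBs where "NBs q k r b s = ?P q (h q (snd (prod_decode (f q k)))) (fst s) b / c q *
      id_mat r (fst (snd s)) * \<beta> q k (snd (snd s))" for q k r b and s :: "sys \<times> sys \<times> nat"
  have sysI: "t q \<in> ?b q" if "t \<in> ?D" "q < N" for t q
    using that by (auto simp: sys_basis_def)
  have F: "(\<Sum>j\<in>Q. \<Sum>r\<in>?b 0. cnj (F (hw j) y r t) * F (hw j) y' r t') = id_mat t t' * (\<Prod>q\<in>?I. id_mat (y q) (y' q))"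
    if t: "t \<in> ?D" "t' \<in> ?D" and y: "\<And>q. q \<in> ?I \<Longrightarrow> y q \<in> ?b q" "\<And>q. q \<in> ?I \<Longrightarrow> y' q \<in> ?b q" for t t' y y'
  proof -
    have "(\<Sum>j\<in>Q. \<Sum>r\<in>?b 0. cnj (F (hw j) y r t) * F (hw j) y' r t') = (\<Sum>w\<in>?W. \<Sum>r\<in>?b 0. cnj (F w y r t) * F w y' r t')"
      by (rule sum.reindex_bij_betw[OF hw])
    also have "\<dots> = (\<Sum>w\<in>?W. id_mat (t 0) (t' 0) * (\<Prod>q\<in>?I. cnj (?P q (w q) (y q) (t q)) * ?P q (w q) (y' q) (t' q) / of_nat (d q)))"
    proof (intro sum.cong refl)
      fix w
      have "(\<Sum>r\<in>?b 0. cnj (F w y r t) * F w y' r t')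
        = (\<Sum>r\<in>?b 0. id_mat r (t 0) * (id_mat r (t' 0) * (\<Prod>q\<in>?I. cnj (?P q (w q) (y q) (t q)) * ?P q (w q) (y' q) (t' q) / of_nat (d q))))"
      proof (intro sum.cong refl)
        fix r
        have "(\<Prod>q\<in>?I. cnj (?P q (w q) (y q) (t q)) * ?P q (w q) (y' q) (t' q) / of_nat (d q))
          = cnj (\<Prod>q\<in>?I. ?P q (w q) (y q) (t q) / c q) * (\<Prod>q\<in>?I. ?P q (w q) (y' q) (t' q) / c q)"
          unfolding cnj_prod prod.distrib[symmetric] by (intro prod.cong refl) (simp add: c)
        moreover have "cnj (id_mat r (t 0)) = id_mat r (t 0)" by (simp add: id_mat_def)
        ultimately show "cnj (F w y r t) * F w y' r t'
          = id_mat r (t 0) * (id_mat r (t' 0) * (\<Prod>q\<in>?I. cnj (?P q (w q) (y q) (t q)) * ?P q (w q) (y' q) (t' q) / of_nat (d q)))"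
          by (simp add: F_def mult_ac)
      qed
      also have "\<dots> = id_mat (t 0) (t' 0) * (\<Prod>q\<in>?I. cnj (?P q (w q) (y q) (t q)) * ?P q (w q) (y' q) (t' q) / of_nat (d q))"
        using sum_id_mat(1)[OF bfin sysI[OF t(1) N]] by simp
      finally show "(\<Sum>r\<in>?b 0. cnj (F w y r t) * F w y' r t')
        = id_mat (t 0) (t' 0) * (\<Prod>q\<in>?I. cnj (?P q (w q) (y q) (t q)) * ?P q (w q) (y' q) (t' q) / of_nat (d q))" .
    qed
    also have "\<dots> = id_mat (t 0) (t' 0) * (\<Prod>q\<in>?I. \<Sum>k\<in>qpaulis (n q). cnj (?P q k (y q) (t q)) * ?P q k (y' q) (t' q) / of_nat (d q))"
      using eb(3) by (simp add: sum_distrib_left[symmetric] prod_sum_PiE)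
    also have "\<dots> = id_mat (t 0) (t' 0) * (\<Prod>q\<in>?I. id_mat (t q) (t' q) * id_mat (y q) (y' q))"
    proof (intro arg_cong2[where f="(*)"] prod.cong refl)
      fix q assume q: "q \<in> ?I"
      then show "(\<Sum>k\<in>qpaulis (n q). cnj (?P q k (y q) (t q)) * ?P q k (y' q) (t' q) / of_nat (d q))
        = id_mat (t q) (t' q) * id_mat (y q) (y' q)"
        unfolding sum_divide_distrib[symmetric]
        using eb(6)[of "y q" "n q" "t q" "y' q" "t' q"] y sysI[OF t(1)] sysI[OF t(2)] d0[of q]
        by (simp add: d_def)
    qed
    also have "\<dots> = tens {..<N} (\<lambda>p. id_mat) t t' * (\<Prod>q\<in>?I. id_mat (y q) (y' q))"
      using N by (simp add: tens_def prod_lessThan_split prod.distrib)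
    also have "tens {..<N} (\<lambda>p. id_mat) t t' = id_mat t t'"
      using t unfolding sys_basis_def by (intro tens_id_mat) auto
    finally show ?thesis .
  qed
  \<comment> \<open>Kraus operators whose outcome records another input are set to 0, so that one
    set of outcomes serves all inputs.\<close>
  have c1: "local_operation N n (star_links l) 0 (prod_encode ` (K' 0 \<times> Q))
      (\<lambda>k r x. if f 0 (fst (prod_decode k)) = i then NAs k r (fst x) (va (snd x)) else 0)" if i: "i \<in> K 0" for i
    unfolding local_operation_def Let_def
  proof (intro conjI ballI)
    have finQ: "finite Q" using bij_betw_finite[OF hw] finW by blast
    then show "finite (prod_encode ` (K' 0 \<times> Q))" using f[OF N] by auto
    fix x x' assume x: "x \<in> ?b 0 \<times> bits (halves N (star_links l) 0)" "x' \<in> ?b 0 \<times> bits (halves N (star_links l) 0)"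
    define b where "b = fst x" define b' where "b' = fst x'"
    define s where "s = va (snd x)" define s' where "s' = va (snd x')"
    have b: "b \<in> ?b 0" "b' \<in> ?b 0" using x by (auto simp: b_def b'_def)
    have s: "s \<in> PiE ?I Lab" "s' \<in> PiE ?I Lab" using x by (simp_all only: s_def s'_def va mem_Times_iff)
    have sq: "fst (s q) \<in> ?b q" "fst (snd (s q)) \<in> ?b q" "snd (snd (s q)) \<in> E q"
      "fst (s' q) \<in> ?b q" "fst (snd (s' q)) \<in> ?b q" "snd (snd (s' q)) \<in> E q" if "q \<in> ?I" for q
      using PiE_mem[OF s(1) that] PiE_mem[OF s(2) that] by (auto simp: Lab_def)
    let ?c = "join_alice N b (\<lambda>q. fst (s q))" and ?c' = "join_alice N b' (\<lambda>q. fst (s' q))"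
    let ?e = "\<lambda>q\<in>?I. snd (snd (s q))" and ?e' = "\<lambda>q\<in>?I. snd (snd (s' q))"
    let ?y = "\<lambda>q. fst (snd (s q))" and ?y' = "\<lambda>q. fst (snd (s' q))"
    have ce: "?c \<in> ?D" "?c' \<in> ?D" "?e \<in> PiE ?I E" "?e' \<in> PiE ?I E"
      using b sq by (auto simp: join_alice_def sys_basis_def)
    have "(\<Sum>k\<in>prod_encode ` (K' 0 \<times> Q). \<Sum>r\<in>?b 0.
        cnj (if f 0 (fst (prod_decode k)) = i then NAs k r b s else 0) *
        (if f 0 (fst (prod_decode k)) = i then NAs k r b' s' else 0))
      = (\<Sum>k'\<in>K' 0. \<Sum>j\<in>Q. if f 0 k' = i then \<Sum>r\<in>?b 0. cnj (NAs (prod_encode (k', j)) r b s) * NAs (prod_encode (k', j)) r b' s' else 0)"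
    proof -
      have "(\<Sum>k\<in>prod_encode ` (K' 0 \<times> Q). G k) = (\<Sum>k'\<in>K' 0. \<Sum>j\<in>Q. G (prod_encode (k', j)))" for G :: "nat \<Rightarrow> complex"
        unfolding sum.cartesian_product by (subst sum.reindex) (simp_all add: inj_on_def case_prod_beta)
      then show ?thesis
        by (simp only: prod_encode_inverse fst_conv) (intro sum.cong refl, auto)
    qed
    also have "\<dots> = (\<Sum>k'\<in>K' 0. if f 0 k' = i then \<Sum>j\<in>Q. \<Sum>r\<in>?b 0. cnj (NAs (prod_encode (k', j)) r b s) * NAs (prod_encode (k', j)) r b' s' else 0)"
      by (intro sum.cong refl) auto
    also have "\<dots> = (\<Sum>k' | k' \<in> K' 0 \<and> f 0 k' = i. \<Sum>j\<in>Q. \<Sum>r\<in>?b 0. cnj (NAs (prod_encode (k', j)) r b s) * NAs (prod_encode (k', j)) r b' s')"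
      using f[OF N] by (simp add: sum.inter_filter)
    also have "\<dots> = (\<Sum>k' | k' \<in> K' 0 \<and> f 0 k' = i. (\<Sum>t\<in>?D. cnj (\<alpha> k' t ?c ?e) * \<alpha> k' t ?c' ?e') * (\<Prod>q\<in>?I. id_mat (?y q) (?y' q)))"
    proof (rule sum.cong[OF refl])
      fix k'
      have "(\<Sum>j\<in>Q. \<Sum>r\<in>?b 0. cnj (NAs (prod_encode (k', j)) r b s) * NAs (prod_encode (k', j)) r b' s')
        = (\<Sum>j\<in>Q. \<Sum>r\<in>?b 0. \<Sum>t\<in>?D. \<Sum>t'\<in>?D. cnj (\<alpha> k' t ?c ?e) * \<alpha> k' t' ?c' ?e' * (cnj (F (hw j) ?y r t) * F (hw j) ?y' r t'))"
        unfolding NAs_def cnj_sum sum_product by (intro sum.cong refl) (simp add: mult_ac)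
      also have "\<dots> = (\<Sum>t\<in>?D. \<Sum>t'\<in>?D. \<Sum>j\<in>Q. \<Sum>r\<in>?b 0. cnj (\<alpha> k' t ?c ?e) * \<alpha> k' t' ?c' ?e' * (cnj (F (hw j) ?y r t) * F (hw j) ?y' r t'))"
        by (subst (2) sum.swap, subst sum.swap, rule sum.cong[OF refl], subst (2) sum.swap, subst sum.swap, rule refl)
      also have "\<dots> = (\<Sum>t\<in>?D. \<Sum>t'\<in>?D. cnj (\<alpha> k' t ?c ?e) * \<alpha> k' t' ?c' ?e' * (id_mat t t' * (\<Prod>q\<in>?I. id_mat (?y q) (?y' q))))"
        unfolding sum_distrib_left[symmetric] by (intro sum.cong refl arg_cong2[where f="(*)"] F sq)
      also have "\<dots> = (\<Sum>t\<in>?D. \<Sum>t'\<in>?D. id_mat t' t * (cnj (\<alpha> k' t ?c ?e) * \<alpha> k' t' ?c' ?e' * (\<Prod>q\<in>?I. id_mat (?y q) (?y' q))))"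
        by (intro sum.cong refl) (simp add: id_mat_def)
      also have "\<dots> = (\<Sum>t\<in>?D. cnj (\<alpha> k' t ?c ?e) * \<alpha> k' t ?c' ?e' * (\<Prod>q\<in>?I. id_mat (?y q) (?y' q)))"
        by (rule sum.cong[OF refl], rule sum_id_mat(1)[OF Dfin])
      finally show "(\<Sum>j\<in>Q. \<Sum>r\<in>?b 0. cnj (NAs (prod_encode (k', j)) r b s) * NAs (prod_encode (k', j)) r b' s')
        = (\<Sum>t\<in>?D. cnj (\<alpha> k' t ?c ?e) * \<alpha> k' t ?c' ?e') * (\<Prod>q\<in>?I. id_mat (?y q) (?y' q))"
        by (simp only: sum_distrib_right)
    qed
    also have "\<dots> = id_mat ?c ?c' * id_mat ?e ?e' * (\<Prod>q\<in>?I. id_mat (?y q) (?y' q))"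
      unfolding sum_distrib_right[symmetric] by (simp only: \<alpha>[OF i ce])
    also have "\<dots> = (if x = x' then 1 else 0)"
    proof (cases "x = x'")
      case True
      then show ?thesis by (simp add: id_mat_def b_def b'_def s_def s'_def)
    next
      case False
      have "\<not> (?c = ?c' \<and> ?e = ?e' \<and> (\<forall>q\<in>?I. ?y q = ?y' q))"
      proof
        assume *: "?c = ?c' \<and> ?e = ?e' \<and> (\<forall>q\<in>?I. ?y q = ?y' q)"
        have bb: "b = b'" using fun_cong[OF conjunct1[OF *], of 0] N by (simp add: join_alice_def)
        have "s q = s' q" if q: "q \<in> ?I" for q
        proof -
          have "fst (s q) = fst (s' q)" using fun_cong[OF conjunct1[OF *], of q] q by (simp add: join_alice_def)
          moreover have "snd (snd (s q)) = snd (snd (s' q))"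
            using fun_cong[OF conjunct1[OF conjunct2[OF *]], of q] q by simp
          moreover have "?y q = ?y' q" using * q by blast
          ultimately show ?thesis by (simp add: prod_eq_iff)
        qed
        then have "s = s'" using s by (intro PiE_ext[OF s])
        then have "snd x = snd x'" using va_inj x unfolding s_def s'_def by (intro inj_onD[OF va_inj]) auto
        then show False using False bb by (simp add: b_def b'_def prod_eq_iff)
      qed
      then consider "?c \<noteq> ?c'" | "?e \<noteq> ?e'" | q where "q \<in> ?I" "?y q \<noteq> ?y' q" by blast
      then have "id_mat ?c ?c' * id_mat ?e ?e' * (\<Prod>q\<in>?I. id_mat (?y q) (?y' q)) = 0"
      proof cases
        case 3
        then have "(\<Prod>q\<in>?I. id_mat (?y q) (?y' q)) = 0"
          by (intro prod_zero) (auto simp: id_mat_def)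
        then show ?thesis by (simp only: mult_zero_right)
      qed (simp_all add: id_mat_def)
      then show ?thesis using False by (simp only: if_False)
    qed
    finally show "(\<Sum>k\<in>prod_encode ` (K' 0 \<times> Q). \<Sum>r\<in>?b 0.
        cnj (if f 0 (fst (prod_decode k)) = i then NAs k r (fst x) (va (snd x)) else 0) *
        (if f 0 (fst (prod_decode k)) = i then NAs k r (fst x') (va (snd x')) else 0)) = (if x = x' then 1 else 0)"
      by (simp only: b_def b'_def s_def s'_def)
  qed
  \<comment> \<open>The input of user \<open>q\<close> to the central protocol is a pair
    \<open>(y, j)\<close>, where \<open>y\<close> is given and \<open>j\<close> is the result of its
    first measurement. Completeness therefore combines that of \<open>\<beta>\<close> for each
    \<open>j\<close> with that of the Pauli basis over all \<open>j\<close>.\<close>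
  have c2: "local_operation N n (star_links l) q (K' q)
      (\<lambda>k r x. if fst (prod_decode (f q k)) = y then NBs q k r (fst x) (vu q (snd x)) else 0)"
    if q: "q \<in> ?I" and y: "y \<in> Yc q" for q y
    unfolding local_operation_def Let_def
  proof (intro conjI ballI)
    have fq: "finite (K q)" "finite (K' q)" "f q ` K' q \<subseteq> K q" using f[of q] q by auto
    then show "finite (K' q)" by blast
    have Kq: "K q = prod_encode ` (Yc q \<times> A q)" and hq: "bij_betw (h q) (A q) (qpaulis (n q))" using K q by auto
    fix x x' assume x: "x \<in> ?b q \<times> bits (halves N (star_links l) q)" "x' \<in> ?b q \<times> bits (halves N (star_links l) q)"
    define b where "b = fst x" define b' where "b' = fst x'"
    define s where "s = vu q (snd x)" define s' where "s' = vu q (snd x')"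
    have b: "b \<in> ?b q" "b' \<in> ?b q" using x by (auto simp: b_def b'_def)
    have s: "s \<in> Lab q" "s' \<in> Lab q" using x vu[OF q] by (auto simp: s_def s'_def)
    obtain i z e i' z' e' where se: "s = (i, z, e)" "s' = (i', z', e')" using prod_cases3 by metis
    have ize: "i \<in> ?b q" "z \<in> ?b q" "e \<in> E q" "i' \<in> ?b q" "z' \<in> ?b q" "e' \<in> E q"
      using s by (auto simp: se Lab_def)
    have "(\<Sum>k\<in>K' q. \<Sum>r\<in>?b q. cnj (if fst (prod_decode (f q k)) = y then NBs q k r b s else 0) *
        (if fst (prod_decode (f q k)) = y then NBs q k r b' s' else 0))
      = (\<Sum>k\<in>K' q. if fst (prod_decode (f q k)) = y then \<Sum>r\<in>?b q. cnj (NBs q k r b s) * NBs q k r b' s' else 0)"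
      by (intro sum.cong refl) auto
    also have "\<dots> = (\<Sum>k | k \<in> K' q \<and> fst (prod_decode (f q k)) = y. \<Sum>r\<in>?b q. cnj (NBs q k r b s) * NBs q k r b' s')"
      using fq by (simp add: sum.inter_filter)
    also have "\<dots> = (\<Sum>i | i \<in> K q \<and> fst (prod_decode i) = y. \<Sum>k | k \<in> K' q \<and> f q k = i. \<Sum>r\<in>?b q. cnj (NBs q k r b s) * NBs q k r b' s')"
      using fq by (intro sum_fibers[where R="\<lambda>i. fst (prod_decode i) = y"]) auto
    also have "\<dots> = (\<Sum>j\<in>A q. \<Sum>k | k \<in> K' q \<and> f q k = prod_encode (y, j). \<Sum>r\<in>?b q. cnj (NBs q k r b s) * NBs q k r b' s')"
      unfolding Kq by (rule sum_encode_fiber[OF y])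
    also have "\<dots> = (\<Sum>j\<in>A q. cnj (?P q (h q j) i b) * ?P q (h q j) i' b' / of_nat (d q) * id_mat z z' * id_mat e e')"
    proof (rule sum.cong[OF refl])
      fix j assume j: "j \<in> A q"
      have "(\<Sum>k | k \<in> K' q \<and> f q k = prod_encode (y, j). \<Sum>r\<in>?b q. cnj (NBs q k r b s) * NBs q k r b' s')
        = (\<Sum>k | k \<in> K' q \<and> f q k = prod_encode (y, j).
          cnj (?P q (h q j) i b) * ?P q (h q j) i' b' / of_nat (d q) * id_mat z z' * (cnj (\<beta> q k e) * \<beta> q k e'))"
      proof (rule sum.cong[OF refl])
        fix k assume k: "k \<in> {k. k \<in> K' q \<and> f q k = prod_encode (y, j)}"
        have ci: "cnj (id_mat r z) = id_mat r z" for r by (simp add: id_mat_def)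
        have "(\<Sum>r\<in>?b q. cnj (NBs q k r b s) * NBs q k r b' s')
          = (\<Sum>r\<in>?b q. id_mat r z * (id_mat r z' * (cnj (?P q (h q j) i b) * ?P q (h q j) i' b' / of_nat (d q) * (cnj (\<beta> q k e) * \<beta> q k e'))))"
          using k by (intro sum.cong refl) (simp add: NBs_def se c(1) ci c(2)[symmetric])
        also have "\<dots> = id_mat z z' * (cnj (?P q (h q j) i b) * ?P q (h q j) i' b' / of_nat (d q) * (cnj (\<beta> q k e) * \<beta> q k e'))"
          by (rule sum_id_mat(1)[OF bfin ize(2)])
        finally show "(\<Sum>r\<in>?b q. cnj (NBs q k r b s) * NBs q k r b' s')
          = cnj (?P q (h q j) i b) * ?P q (h q j) i' b' / of_nat (d q) * id_mat z z' * (cnj (\<beta> q k e) * \<beta> q k e')"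
          by (simp only: mult_ac)
      qed
      also have "\<dots> = cnj (?P q (h q j) i b) * ?P q (h q j) i' b' / of_nat (d q) * id_mat z z' * id_mat e e'"
        unfolding sum_distrib_left[symmetric] using \<beta>[OF q _ ize(3,6), of "prod_encode (y, j)"] y j by (simp add: Kq)
      finally show "(\<Sum>k | k \<in> K' q \<and> f q k = prod_encode (y, j). \<Sum>r\<in>?b q. cnj (NBs q k r b s) * NBs q k r b' s')
        = cnj (?P q (h q j) i b) * ?P q (h q j) i' b' / of_nat (d q) * id_mat z z' * id_mat e e'" .
    qed
    also have "\<dots> = (\<Sum>k\<in>qpaulis (n q). cnj (?P q k i b) * ?P q k i' b' / of_nat (d q) * id_mat z z' * id_mat e e')"
      by (rule sum.reindex_bij_betw[OF hq])
    also have "\<dots> = id_mat i i' * id_mat b b' * id_mat z z' * id_mat e e'"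
      unfolding sum_distrib_right[symmetric] sum_divide_distrib[symmetric]
      using eb(6)[OF ize(1) b(1) ize(4) b(2)] d0[of q] by (simp add: d_def)
    also have "\<dots> = (if x = x' then 1 else 0)"
    proof (cases "x = x'")
      case True
      then have "b = b'" "s = s'" by (simp_all add: b_def b'_def s_def s'_def)
      then show ?thesis using True se by (simp add: id_mat_def)
    next
      case False
      have "\<not> (b = b' \<and> s = s')"
      proof
        assume *: "b = b' \<and> s = s'"
        then have "snd x = snd x'" using x unfolding s_def s'_def by (intro inj_onD[OF vu_inj[OF q]]) auto
        then show False using False * by (simp add: b_def b'_def prod_eq_iff)
      qed
      then show ?thesis using False by (auto simp: id_mat_def se)
    qed
    finally show "(\<Sum>k\<in>K' q. \<Sum>r\<in>?b q.
        cnj (if fst (prod_decode (f q k)) = y then NBs q k r (fst x) (vu q (snd x)) else 0) *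
        (if fst (prod_decode (f q k)) = y then NBs q k r (fst x') (vu q (snd x')) else 0)) = (if x = x' then 1 else 0)"
      by (simp only: b_def b'_def s_def s'_def)
  qed
  have c3: "(\<Sum>x\<in>ebit_basis N (star_links l). NAs (\<kappa> 0) (r 0) (b 0) (va (x 0)) *
        (\<Prod>q\<in>?I. NBs q (\<kappa> q) (r q) (b q) (vu q (x q))) * epr_pairs N (star_links l) x)
      = (\<Prod>q\<in>?I. 1 / (of_nat (card (?b q)))\<^sup>2) *
        mat_mult ?D (user_paulis N n (hw (snd (prod_decode (\<kappa> 0)))))
          (mat_mult ?D (J (joint_input N ((\<lambda>p. id)(0 := fst \<circ> prod_decode)) \<kappa>))
            (user_paulis N n (\<lambda>q. h q (snd (prod_decode (f q (\<kappa> q))))))) r b"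
    if \<kappa>: "\<kappa> \<in> PiE {..<N} (K'(0 := prod_encode ` (K' 0 \<times> Q)))" and rb: "r \<in> ?D" "b \<in> ?D" for \<kappa> r b
  proof -
    define \<kappa>' where "\<kappa>' = joint_input N ((\<lambda>p. id)(0 := fst \<circ> prod_decode)) \<kappa>"
    define w where "w = hw (snd (prod_decode (\<kappa> 0)))"
    define u where "u q = h q (snd (prod_decode (f q (\<kappa> q))))" for q
    have \<kappa>0: "\<kappa>' 0 = fst (prod_decode (\<kappa> 0))" and \<kappa>q: "\<And>q. q \<in> ?I \<Longrightarrow> \<kappa>' q = \<kappa> q"
      using N by (simp_all add: \<kappa>'_def joint_input_def)
    have \<kappa>': "\<kappa>' \<in> PiE {..<N} K'"
      unfolding \<kappa>'_def by (rule joint_input_in[OF _ \<kappa>]) auto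
    let ?X = "PiE ?I ?b"
    let ?sE = "\<lambda>q. complex_of_real (sqrt (card (E q)))"
    let ?PI = "\<lambda>i. \<Prod>q\<in>?I. ?P q (u q) (i q) (b q)"
    \<comment> \<open>\<open>?C\<close> comes from the last measurement of Alice, \<open>?C'\<close>
      from the first measurements of the users and from the normalisation of the EPR pairs that
      carry the systems to and fro. As \<open>c q * c q = d q\<close>, each user accounts for
      \<open>1 / (d q)^2\<close>.\<close>
    let ?C = "\<Prod>q\<in>?I. 1 / c q"
    let ?C' = "\<Prod>q\<in>?I. 1 / (c q * of_nat (d q))"
    have PIc: "join_alice N (b 0) i \<in> ?D" if "i \<in> ?X" for i
      using that sysI[OF rb(2)] N by (auto simp: join_alice_def sys_basis_def PiE_iff)
    have "(\<Sum>x\<in>ebit_basis N (star_links l). NAs (\<kappa> 0) (r 0) (b 0) (va (x 0)) *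
        (\<Prod>q\<in>?I. NBs q (\<kappa> q) (r q) (b q) (vu q (x q))) * epr_pairs N (star_links l) x)
      = (\<Sum>s\<in>PiE ?I Lab. NAs (\<kappa> 0) (r 0) (b 0) s * (\<Prod>q\<in>?I. NBs q (\<kappa> q) (r q) (b q) (s q) / complex_of_real (sqrt (card (Lab q)))))"
      by (rule eprs[of "NAs (\<kappa> 0) (r 0) (b 0)" "\<lambda>q. NBs q (\<kappa> q) (r q) (b q)"])
    also have "\<dots> = (\<Sum>i\<in>?X. \<Sum>y\<in>?X. \<Sum>e\<in>PiE ?I E.
        (\<Sum>t\<in>?D. F w y (r 0) t * \<alpha> (\<kappa>' 0) t (join_alice N (b 0) i) e) * (\<Prod>q\<in>?I. \<beta> q (\<kappa>' q) (e q) / ?sE q) * ?PI i * ?C' *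
          (\<Prod>q\<in>?I. id_mat (r q) (y q)))"
      unfolding Lab_def sum_PiE_Times
    proof (intro sum.cong refl)
      fix i y e assume iye: "i \<in> ?X" "y \<in> ?X" "e \<in> PiE ?I E"
      let ?s = "\<lambda>q\<in>?I. (i q, (\<lambda>q\<in>?I. (y q, e q)) q)"
      have "NAs (\<kappa> 0) (r 0) (b 0) ?s = (\<Sum>t\<in>?D. F w y (r 0) t * \<alpha> (\<kappa>' 0) t (join_alice N (b 0) i) e)"
      proof -
        have "F w (\<lambda>q. fst (snd (?s q))) (r 0) t = F w y (r 0) t" for t
          unfolding F_def by (intro arg_cong2[where f="(*)"] prod.cong refl) simp
        moreover have "join_alice N (b 0) (\<lambda>q. fst (?s q)) = join_alice N (b 0) i"
          unfolding join_alice_def by (intro restrict_ext) auto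
        moreover have "(\<lambda>q\<in>?I. snd (snd (?s q))) = e"
          using iye(3) by (intro extensionalityI[of _ ?I]) (auto simp: PiE_iff)
        ultimately show ?thesis by (simp only: NAs_def w_def[symmetric] \<kappa>0[symmetric])
      qed
      moreover have "(\<Prod>q\<in>?I. NBs q (\<kappa> q) (r q) (b q) (?s q) / complex_of_real (sqrt (card (?b q \<times> ?b q \<times> E q))))
        = (\<Prod>q\<in>?I. \<beta> q (\<kappa>' q) (e q) / ?sE q) * ?PI i * ?C' * (\<Prod>q\<in>?I. id_mat (r q) (y q))"
        unfolding prod.distrib[symmetric]
      proof (intro prod.cong refl)
        fix q assume q: "q \<in> ?I"
        have "complex_of_real (sqrt (card (?b q \<times> ?b q \<times> E q))) = of_nat (d q) * ?sE q"
        proof -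
          have "real (card (?b q \<times> ?b q \<times> E q)) = (real (d q))\<^sup>2 * real (card (E q))"
            using cLab[of q] by (simp add: Lab_def power2_eq_square)
          then show ?thesis by (simp only: real_sqrt_mult real_sqrt_abs) simp
        qed
        then show "NBs q (\<kappa> q) (r q) (b q) (?s q) / complex_of_real (sqrt (card (?b q \<times> ?b q \<times> E q)))
          = \<beta> q (\<kappa>' q) (e q) / ?sE q * ?P q (u q) (i q) (b q) * (1 / (c q * of_nat (d q))) * id_mat (r q) (y q)"
          using q \<kappa>q[OF q] by (simp add: NBs_def u_def mult_ac)
      qed
      ultimately show "NAs (\<kappa> 0) (r 0) (b 0) ?s * (\<Prod>q\<in>?I. NBs q (\<kappa> q) (r q) (b q) (?s q) / complex_of_real (sqrt (card (?b q \<times> ?b q \<times> E q))))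
        = (\<Sum>t\<in>?D. F w y (r 0) t * \<alpha> (\<kappa>' 0) t (join_alice N (b 0) i) e) * (\<Prod>q\<in>?I. \<beta> q (\<kappa>' q) (e q) / ?sE q) * ?PI i * ?C' *
          (\<Prod>q\<in>?I. id_mat (r q) (y q))"
        by (simp only: mult.assoc)
    qed
    also have "\<dots> = (\<Sum>i\<in>?X. \<Sum>e\<in>PiE ?I E.
        (\<Sum>t\<in>?D. F w r (r 0) t * \<alpha> (\<kappa>' 0) t (join_alice N (b 0) i) e) * (\<Prod>q\<in>?I. \<beta> q (\<kappa>' q) (e q) / ?sE q) * ?PI i * ?C')"
    proof (rule sum.cong[OF refl])
      fix i
      define H where "H y = (\<Sum>e\<in>PiE ?I E. (\<Sum>t\<in>?D. F w y (r 0) t * \<alpha> (\<kappa>' 0) t (join_alice N (b 0) i) e) *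
        (\<Prod>q\<in>?I. \<beta> q (\<kappa>' q) (e q) / ?sE q) * ?PI i * ?C')" for y
      have "(\<Sum>y\<in>?X. H y * (\<Prod>q\<in>?I. id_mat (r q) (y q))) = H (restrict r ?I)"
        using sysI[OF rb(1)] bfin by (intro sum_PiE_id_mat) auto
      moreover have "F w (restrict r ?I) (r 0) t = F w r (r 0) t" for t
        unfolding F_def by (intro arg_cong2[where f="(*)"] prod.cong refl) simp
      ultimately show "(\<Sum>y\<in>?X. \<Sum>e\<in>PiE ?I E.
        (\<Sum>t\<in>?D. F w y (r 0) t * \<alpha> (\<kappa>' 0) t (join_alice N (b 0) i) e) * (\<Prod>q\<in>?I. \<beta> q (\<kappa>' q) (e q) / ?sE q) * ?PI i * ?C' *
          (\<Prod>q\<in>?I. id_mat (r q) (y q)))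
        = (\<Sum>e\<in>PiE ?I E. (\<Sum>t\<in>?D. F w r (r 0) t * \<alpha> (\<kappa>' 0) t (join_alice N (b 0) i) e) *
        (\<Prod>q\<in>?I. \<beta> q (\<kappa>' q) (e q) / ?sE q) * ?PI i * ?C')"
        by (simp only: H_def sum_distrib_right)
    qed
    also have "\<dots> = (\<Sum>i\<in>?X. \<Sum>t\<in>?D. F w r (r 0) t * J \<kappa>' t (join_alice N (b 0) i) * ?PI i * ?C')"
    proof (rule sum.cong[OF refl])
      fix i assume i: "i \<in> ?X"
      have "(\<Sum>t\<in>?D. F w r (r 0) t * J \<kappa>' t (join_alice N (b 0) i) * ?PI i * ?C')
        = (\<Sum>t\<in>?D. \<Sum>e\<in>PiE ?I E. F w r (r 0) t * (\<alpha> (\<kappa>' 0) t (join_alice N (b 0) i) e * (\<Prod>q\<in>?I. \<beta> q (\<kappa>' q) (e q) / ?sE q)) * ?PI i * ?C')"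
        by (rule sum.cong[OF refl]) (simp only: J[OF \<kappa>' _ PIc[OF i]] sum_distrib_left sum_distrib_right)
      also have "\<dots> = (\<Sum>e\<in>PiE ?I E. \<Sum>t\<in>?D. F w r (r 0) t * (\<alpha> (\<kappa>' 0) t (join_alice N (b 0) i) e * (\<Prod>q\<in>?I. \<beta> q (\<kappa>' q) (e q) / ?sE q)) * ?PI i * ?C')"
        by (rule sum.swap)
      finally show "(\<Sum>e\<in>PiE ?I E. (\<Sum>t\<in>?D. F w r (r 0) t * \<alpha> (\<kappa>' 0) t (join_alice N (b 0) i) e) *
        (\<Prod>q\<in>?I. \<beta> q (\<kappa>' q) (e q) / ?sE q) * ?PI i * ?C') = (\<Sum>t\<in>?D. F w r (r 0) t * J \<kappa>' t (join_alice N (b 0) i) * ?PI i * ?C')"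
        by (simp only: sum_distrib_right mult.assoc)
    qed
    also have "\<dots> = (\<Sum>i\<in>?X. \<Sum>t\<in>?D. ?C * ?C' * (user_paulis N n w r t * (J \<kappa>' t (join_alice N (b 0) i) * ?PI i)))"
    proof (intro sum.cong refl)
      fix i t
      have "F w r (r 0) t = user_paulis N n w r t * ?C"
        unfolding F_def user_paulis_split[OF N] mult.assoc prod.distrib[symmetric] by simp
      then show "F w r (r 0) t * J \<kappa>' t (join_alice N (b 0) i) * ?PI i * ?C' = ?C * ?C' * (user_paulis N n w r t * (J \<kappa>' t (join_alice N (b 0) i) * ?PI i))"
        by (simp only: mult_ac)
    qed
    also have "\<dots> = ?C * ?C' * (\<Sum>t\<in>?D. user_paulis N n w r t * (\<Sum>i\<in>?X. J \<kappa>' t (join_alice N (b 0) i) * ?PI i))"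
      unfolding sum_distrib_left by (rule sum.swap)
    also have "(\<Sum>t\<in>?D. user_paulis N n w r t * (\<Sum>i\<in>?X. J \<kappa>' t (join_alice N (b 0) i) * ?PI i))
      = mat_mult ?D (user_paulis N n w) (mat_mult ?D (J \<kappa>') (user_paulis N n u)) r b"
      unfolding mat_mult_def
    proof (rule sum.cong[OF refl], rule arg_cong2[where f="(*)", OF refl])
      fix t
      have "(\<Sum>x\<in>?D. J \<kappa>' t x * user_paulis N n u x b)
        = (\<Sum>y\<in>?b 0. \<Sum>i\<in>?X. J \<kappa>' t (join_alice N y i) * user_paulis N n u (join_alice N y i) b)"
        unfolding sys_basis_def by (rule sum_PiE_join_alice[OF N])
      also have "\<dots> = (\<Sum>y\<in>?b 0. id_mat y (b 0) * (\<Sum>i\<in>?X. J \<kappa>' t (join_alice N y i) * ?PI i))"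
        unfolding sum_distrib_left
      proof (intro sum.cong refl)
        fix y :: sys and i :: all_sys
        have cb: "join_alice N y i 0 = y" "\<And>q. q \<in> ?I \<Longrightarrow> join_alice N y i q = i q" using N by (simp_all add: join_alice_def)
        have "user_paulis N n u (join_alice N y i) b = id_mat y (b 0) * ?PI i"
          unfolding user_paulis_split[OF N] by (intro arg_cong2[where f="(*)"] prod.cong refl) (simp_all only: cb)
        then show "J \<kappa>' t (join_alice N y i) * user_paulis N n u (join_alice N y i) b = id_mat y (b 0) * (J \<kappa>' t (join_alice N y i) * ?PI i)"
          by (simp only: mult_ac)
      qed
      also have "\<dots> = (\<Sum>i\<in>?X. J \<kappa>' t (join_alice N (b 0) i) * ?PI i)"
        by (rule sum_id_mat(1)[OF bfin sysI[OF rb(2) N]])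
      finally show "(\<Sum>i\<in>?X. J \<kappa>' t (join_alice N (b 0) i) * ?PI i) = (\<Sum>x\<in>?D. J \<kappa>' t x * user_paulis N n u x b)" ..
    qed
    also have "?C * ?C' = (\<Prod>q\<in>?I. 1 / (of_nat (card (?b q)))\<^sup>2)"
      unfolding prod.distrib[symmetric]
      by (intro prod.cong refl) (simp add: power2_eq_square d_def[symmetric] c(2)[symmetric])
    finally show ?thesis unfolding \<kappa>'_def w_def u_def .
  qed
  show ?thesis
    by (rule that[where NA="\<lambda>k r x. NAs k r (fst x) (va (snd x))" and NB="\<lambda>q k r x. NBs q k r (fst x) (vu q (snd x))"])
      (use hw c1 c2 c3 in simp_all)
qed

section \<open>From joint Kraus operators to normalised states and the theorem\<close>

lemma user_paulis_cong:
  assumes "\<And>q. q \<in> {1..<N} \<Longrightarrow> w q = w' q"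
  shows "user_paulis N n w = user_paulis N n w'"
  unfolding user_paulis_def tens_def using assms by (intro ext prod.cong refl) auto

lemma joint_execution_eq:
  assumes "\<And>b. b \<in> sys_basis N n \<Longrightarrow>
    (\<Sum>h\<in>ebit_basis N m. tensor N (\<lambda>p. M p (\<kappa> p)) r (\<lambda>p. (b p, h p)) * epr_pairs N m h) = T r b"
  shows "joint_execution N n m M \<psi> \<kappa> r = apply_op (sys_basis N n) T (\<psi> :: all_sys \<Rightarrow> 'e :: complex_hilbert) r"
proof -
  have "joint_execution N n m M \<psi> \<kappa> r = (\<Sum>b\<in>sys_basis N n. \<Sum>h\<in>ebit_basis N m.
      tensor N (\<lambda>p. M p (\<kappa> p)) r (\<lambda>p. (b p, h p)) *\<^sub>C epr_pairs N m h *\<^sub>C \<psi> b)"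
    unfolding joint_execution_def apply_op_def sum.cartesian_product by (intro sum.cong refl) auto
  also have "\<dots> = (\<Sum>b\<in>sys_basis N n. (\<Sum>h\<in>ebit_basis N m.
      tensor N (\<lambda>p. M p (\<kappa> p)) r (\<lambda>p. (b p, h p)) * epr_pairs N m h) *\<^sub>C \<psi> b)"
    unfolding scaleC_sum_left by (simp only: scaleC_scaleC)
  finally show ?thesis unfolding apply_op_def by (simp add: assms)
qed

text \<open>\<open>V\<close> is the adjoint of \<open>R\<close> times the conjugate of the phase of
  \<open>a\<close>, which the normalised state still carries. It is obtained before unitary,
  operations and state are fixed, so a single correction serves them all.\<close>

lemma correctable:
  assumes "N > 0" "local_qubitwise N n R" "a \<noteq> 0"
  obtains V where "\<And>p. p < N \<Longrightarrow> qubitwise_unitary (n p) (V p)"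
    "\<And>U M m \<kappa> and \<psi> :: all_sys \<Rightarrow> 'e :: complex_hilbert.
      sq_norm (sys_basis N n) \<psi> = 1 \<Longrightarrow> unitary_on (sys_basis N n) U \<Longrightarrow>
      (\<And>r. r \<in> sys_basis N n \<Longrightarrow> joint_execution N n m M \<psi> \<kappa> r =
        a *\<^sub>C apply_op (sys_basis N n) (mat_mult (sys_basis N n) R U) \<psi> r) \<Longrightarrow>
      coincides_up_to N n V (apply_op (sys_basis N n) U \<psi>) (outcome_state N n m M \<psi> \<kappa>)"
proof -
  let ?D = "sys_basis N n"
  note fin = finite_sys_basis[of N n]
  define c where "c = cnj a / complex_of_real (cmod a)"
  have c: "cmod c = 1" using assms(3) by (simp add: c_def norm_divide)
  have "local_qubitwise N n (\<lambda>r b. c * adj R r b)" using assms c by (intro local_qubitwise_scale local_qubitwise_adj)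
  then obtain V where V: "\<And>p. p < N \<Longrightarrow> qubitwise_unitary (n p) (V p)"
    "\<And>r b. r \<in> ?D \<Longrightarrow> b \<in> ?D \<Longrightarrow> c * adj R r b = tens {..<N} V r b"
    by (rule local_qubitwiseE) blast
  have R: "unitary_on ?D R" using assms(2) by (rule local_qubitwise_unitary)
  show ?thesis
  proof (rule that[OF V(1)])
    fix U M m \<kappa> and \<psi> :: "all_sys \<Rightarrow> 'e"
    assume \<psi>: "sq_norm ?D \<psi> = 1" and U: "unitary_on ?D U"
      and je: "\<And>r. r \<in> ?D \<Longrightarrow> joint_execution N n m M \<psi> \<kappa> r = a *\<^sub>C apply_op ?D (mat_mult ?D R U) \<psi> r"
    have "outcome_prob N n m M \<psi> \<kappa> = sq_norm ?D (\<lambda>r. a *\<^sub>C apply_op ?D (mat_mult ?D R U) \<psi> r)"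
      unfolding outcome_prob_def sq_norm_def by (intro sum.cong refl) (simp add: je)
    also have "\<dots> = (cmod a)\<^sup>2 * sq_norm ?D (apply_op ?D (mat_mult ?D R U) \<psi>)" by (rule sq_norm_scale)
    also have "sq_norm ?D (apply_op ?D (mat_mult ?D R U) \<psi>) = 1"
      by (rule trans[OF sq_norm_isometry[OF fin unitary_onD[OF unitary_on_mat_mult[OF fin R U]]] \<psi>])
    finally have p: "sqrt (outcome_prob N n m M \<psi> \<kappa>) = cmod a" by simp
    have os: "outcome_state N n m M \<psi> \<kappa> x = (a / complex_of_real (cmod a)) *\<^sub>C apply_op ?D (mat_mult ?D R U) \<psi> x"
      if "x \<in> ?D" for x
      unfolding outcome_state_def p je[OF that] scaleC_of_real[symmetric] scaleC_scaleC by simp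
    show "coincides_up_to N n V (apply_op ?D U \<psi>) (outcome_state N n m M \<psi> \<kappa>)"
      unfolding coincides_up_to_def
    proof
      fix r assume r: "r \<in> ?D"
      have cc: "c * (a / complex_of_real (cmod a)) = 1"
      proof -
        have "cnj a * a = complex_of_real (cmod a) * complex_of_real (cmod a)"
          using complex_norm_square[of a] by (simp add: power2_eq_square mult.commute)
        then show ?thesis using assms(3) by (simp add: c_def)
      qed
      have "apply_op ?D (tensor N V) (outcome_state N n m M \<psi> \<kappa>) r
        = apply_op ?D (\<lambda>r b. c * adj R r b) (\<lambda>x. (a / complex_of_real (cmod a)) *\<^sub>C apply_op ?D (mat_mult ?D R U) \<psi> x) r"
        unfolding tensor_eq_tens by (intro apply_op_cong) (simp_all add: V(2)[OF r] os)
      also have "\<dots> = apply_op ?D (adj R) (apply_op ?D (mat_mult ?D R U) \<psi>) r"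
      proof -
        have "(c * t) *\<^sub>C (a / complex_of_real (cmod a)) *\<^sub>C v = t *\<^sub>C (v :: 'e)" for t v
        proof -
          have "(c * t) * (a / complex_of_real (cmod a)) = c * (a / complex_of_real (cmod a)) * t" by (simp only: mult_ac)
          then show ?thesis unfolding scaleC_scaleC cc by simp
        qed
        then show ?thesis unfolding apply_op_def by (simp only:)
      qed
      also have "\<dots> = apply_op ?D (mat_mult ?D (mat_mult ?D (adj R) R) U) \<psi> r" by (simp only: apply_op_mat_mult mat_mult_assoc)
      also have "\<dots> = apply_op ?D (mat_mult ?D id_mat U) \<psi> r"
        using R r by (intro apply_op_cong mat_mult_cong refl) (simp add: mat_mult_adj_left)
      also have "\<dots> = apply_op ?D U \<psi> r"
        using r fin by (intro apply_op_cong refl) (simp add: mat_mult_id_mat_left)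
      finally show "apply_op ?D U \<psi> r = apply_op ?D (tensor N V) (outcome_state N n m M \<psi> \<kappa>) r" ..
    qed
  qed
qed

theorem theoremB1:
  fixes N :: nat
    and n :: "nat \<Rightarrow> nat"
    and X :: "'x set"
    and Y :: "nat \<Rightarrow> 'y set"
    and U :: "'x \<Rightarrow> (nat \<Rightarrow> 'y) \<Rightarrow> all_sys \<Rightarrow> all_sys \<Rightarrow> complex"
    and \<epsilon> :: real
  assumes "N \<ge> 2"
    and "finite X"
    and "\<And>p. p \<in> {1..<N} \<Longrightarrow> finite (Y p)"
    and "\<And>x y. x \<in> X \<Longrightarrow> y \<in> PiE {1..<N} Y \<Longrightarrow> unitary_on (sys_basis N n) (U x y)"
    and "\<epsilon> > 0"
  shows "\<exists>(m :: nat \<Rightarrow> nat \<Rightarrow> nat) (K :: nat \<Rightarrow> nat set)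
      (A :: 'x \<Rightarrow> nat \<Rightarrow> kraus) (B :: nat \<Rightarrow> 'y \<Rightarrow> nat \<Rightarrow> kraus)
      (V :: (nat \<Rightarrow> nat) \<Rightarrow> nat \<Rightarrow> sys \<Rightarrow> sys \<Rightarrow> complex).
    (\<forall>x\<in>X. local_operation N n m 0 (K 0) (A x)) \<and>
    (\<forall>p\<in>{1..<N}. \<forall>y\<in>Y p. local_operation N n m p (K p) (B p y)) \<and>
    (\<forall>\<kappa>\<in>PiE {..<N} K. \<forall>p<N. qubitwise_unitary (n p) (V \<kappa> p)) \<and>
    (\<forall>\<psi> :: all_sys \<Rightarrow> 'e::complex_hilbert. sq_norm (sys_basis N n) \<psi> = 1 \<longrightarrow>
      (\<forall>x\<in>X. \<forall>y\<in>PiE {1..<N} Y.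
        let M = parties (A x) (\<lambda>p. B p (y p)) in
        (\<Sum>\<kappa> | \<kappa> \<in> PiE {..<N} K \<and>
              \<not> coincides_up_to N n (V \<kappa>)
                  (apply_op (sys_basis N n) (U x y) \<psi>) (outcome_state N n m M \<psi> \<kappa>).
            outcome_prob N n m M \<psi> \<kappa>) \<le> \<epsilon>))"
proof -
  let ?I = "{1..<N}" and ?D = "sys_basis N n"
  note fin = finite_sys_basis[of N n]
  have N: "N > 0" using assms(1) by simp
  interpret local_corrections N ?D "PiE {..<N} (\<lambda>p. qpaulis (n p))"
    "\<lambda>k. tens {..<N} (\<lambda>p. qpauli (n p) (k p))" "local_qubitwise N n"
    by (rule local_corrections_qpauli[OF N])
  note eb = error_basisD[OF error_basis_qpauli]
  have "\<exists>h. bij_betw h {..<card (qpaulis (n q))} (qpaulis (n q))" for q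
    using ex_bij_betw_nat_finite[OF eb(3)] by (simp add: lessThan_atLeast0)
  then obtain h where h: "\<And>q. bij_betw (h q) {..<card (qpaulis (n q))} (qpaulis (n q))" by metis
  define A where "A q = {..<card (qpaulis (n q))}" for q
  define Yc where "Yc q = to_nat_on (Y q) ` Y q" for q
  \<comment> \<open>Classical inputs are coded by natural numbers. To the central protocol a user
    brings its classical input and its result in teleporting its system to Alice.\<close>
  define K where "K q = (if q = 0 then to_nat_on X ` X else prod_encode ` (Yc q \<times> A q))" for q
  define xd where "xd z = from_nat_into X (z (0::nat))" for z
  define yd where "yd z = (\<lambda>q\<in>?I. from_nat_into (Y q) (fst (prod_decode (z q))))" for z
  define ud where "ud z q = h q (snd (prod_decode (z q)))" for z q
  \<comment> \<open>When the systems arrive at Alice they carry the users' Pauli errors; the unitary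
    to be implemented undoes these before it applies \<open>U\<close>.\<close>
  define T where "T z = mat_mult ?D (U (xd z) (yd z)) (adj (user_paulis N n (ud z)))" for z
  have cX: "countable X" and cY: "\<And>q. q \<in> ?I \<Longrightarrow> countable (Y q)"
    using assms(2,3) by (auto intro: countable_finite)
  have Kfin: "\<forall>p<N. finite (K p)"
    using assms(2,3) by (auto simp: K_def Yc_def A_def)
  have Kq: "K q = prod_encode ` (Yc q \<times> A q)" if "q \<in> ?I" for q using that by (simp add: K_def)
  have xd: "xd z \<in> X" if "z \<in> PiE {..<N} K" for z
  proof -
    have "z 0 \<in> K 0" using that N by auto
    then show ?thesis using cX by (auto simp: xd_def K_def)
  qed
  have yd: "yd z \<in> PiE ?I Y" if z: "z \<in> PiE {..<N} K" for z
    unfolding yd_def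
  proof (rule restrict_PiE_iff[THEN iffD2], rule ballI)
    fix q assume q: "q \<in> ?I"
    then have "z q \<in> K q" using z by auto
    then show "from_nat_into (Y q) (fst (prod_decode (z q))) \<in> Y q"
      using cY[OF q] by (auto simp: Kq[OF q] Yc_def)
  qed
  have T: "\<forall>z\<in>PiE {..<N} K. unitary_on ?D (T z)"
    unfolding T_def by (intro ballI unitary_on_mat_mult fin assms(4) xd yd unitary_on_adj local_qubitwise_unitary local_qubitwise_user_paulis)
  obtain k where k: "(1 - \<eta> ^ (N - 1)) ^ k < \<epsilon>"
    using real_arch_pow_inv[OF assms(5), of "1 - \<eta> ^ (N - 1)"] \<eta> by auto
  obtain K' f a W where cen: "central N ?D ?D K K' f (\<lambda>\<kappa> r b. a \<kappa> * W \<kappa> r b)"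
    and W: "\<And>\<kappa>. \<kappa> \<in> PiE {..<N} K' \<Longrightarrow> unitary_on ?D (W \<kappa>)"
    and bad: "\<And>z. z \<in> PiE {..<N} K \<Longrightarrow> (\<Sum>\<kappa> | \<kappa> \<in> PiE {..<N} K' \<and> joint_input N f \<kappa> = z \<and>
      \<not> implements (T z) (W \<kappa>). (cmod (a \<kappa>))\<^sup>2) \<le> (1 - \<eta> ^ (N - 1)) ^ k"
    using iterated_rounds[OF Kfin T, of k] by (elim exE conjE) (rule that; (assumption | erule (1) bspec))
  have "\<forall>q\<in>?I. K q = prod_encode ` (Yc q \<times> A q) \<and> bij_betw (h q) (A q) (qpaulis (n q))"
    using Kq h by (simp add: A_def)
  then obtain l Q hw NA NB where
    hw: "bij_betw hw Q (PiE ?I (\<lambda>q. qpaulis (n q)))" and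
    NA: "\<And>i. i \<in> K 0 \<Longrightarrow> local_operation N n (star_links l) 0 (prod_encode ` (K' 0 \<times> Q))
      (\<lambda>k r x. if f 0 (fst (prod_decode k)) = i then NA k r x else 0)" and
    NB: "\<And>q y. q \<in> ?I \<Longrightarrow> y \<in> Yc q \<Longrightarrow> local_operation N n (star_links l) q (K' q)
      (\<lambda>k r x. if fst (prod_decode (f q k)) = y then NB q k r x else 0)" and
    NAB: "\<And>\<kappa> r b. \<kappa> \<in> PiE {..<N} (K'(0 := prod_encode ` (K' 0 \<times> Q))) \<Longrightarrow> r \<in> ?D \<Longrightarrow> b \<in> ?D \<Longrightarrow>
      (\<Sum>x\<in>ebit_basis N (star_links l). NA (\<kappa> 0) (r 0) (b 0, x 0) * (\<Prod>q\<in>?I. NB q (\<kappa> q) (r q) (b q, x q)) *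
        epr_pairs N (star_links l) x)
      = (\<Prod>q\<in>?I. 1 / (of_nat (card (bits {..<n q})))\<^sup>2) *
        mat_mult ?D (user_paulis N n (hw (snd (prod_decode (\<kappa> 0)))))
          (mat_mult ?D (\<lambda>r b. a (joint_input N ((\<lambda>p. id)(0 := fst \<circ> prod_decode)) \<kappa>) *
              W (joint_input N ((\<lambda>p. id)(0 := fst \<circ> prod_decode)) \<kappa>) r b)
            (user_paulis N n (\<lambda>q. h q (snd (prod_decode (f q (\<kappa> q))))))) r b"
    by (rule distribute[OF N cen]) blast
  let ?m = "star_links l" and ?g = "(\<lambda>p. id)(0 := fst \<circ> prod_decode) :: nat \<Rightarrow> nat \<Rightarrow> nat"
  define KF where "KF = K'(0 := prod_encode ` (K' 0 \<times> Q))"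
  define A' where "A' x k r w = (if f 0 (fst (prod_decode k)) = to_nat_on X x then NA k r w else 0)"
    for x k and r :: sys and w :: "sys \<times> ebits"
  define B' where "B' q y k r w = (if fst (prod_decode (f q k)) = to_nat_on (Y q) y then NB q k r w else 0)"
    for q y k and r :: sys and w :: "sys \<times> ebits"
  define C where "C = (\<Prod>q\<in>?I. 1 / (of_nat (card (bits {..<n q})) :: complex)\<^sup>2)"
  define \<kappa>' where "\<kappa>' \<kappa> = joint_input N ?g \<kappa>" for \<kappa>
  define z where "z \<kappa> = joint_input N f (\<kappa>' \<kappa>)" for \<kappa>
  define R where "R \<kappa> = mat_mult ?D (user_paulis N n (hw (snd (prod_decode (\<kappa> 0)))))
    (mat_mult ?D (W (\<kappa>' \<kappa>)) (user_paulis N n (ud (z \<kappa>))))" for \<kappa>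
  \<comment> \<open>Outcomes record the inputs of all parties. If the recorded inputs differ from
    \<open>x\<close> and \<open>y\<close>, some Kraus operator is 0 and the outcome has probability
    0.\<close>
  define match where "match x y zz \<longleftrightarrow> zz 0 = to_nat_on X x \<and> (\<forall>q\<in>?I. fst (prod_decode (zz q)) = to_nat_on (Y q) (y q))"
    for x y and zz :: "nat \<Rightarrow> nat"
  define good where "good \<kappa> \<longleftrightarrow> implements (T (z \<kappa>)) (W (\<kappa>' \<kappa>))" for \<kappa>
  define amp where "amp \<kappa> = C * a (\<kappa>' \<kappa>)" for \<kappa>
  note cd = centralD[OF cen]
  have finQ: "finite Q"
    using bij_betw_finite[OF hw] eb(3) by (simp add: finite_PiE)
  have gin: "?g p \<in> KF p \<rightarrow> K' p" if "p < N" for p by (auto simp: KF_def)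
  have KFfin: "finite (KF p)" if "p < N" for p using cd(2)[OF that] finQ by (auto simp: KF_def)
  have \<kappa>'_in: "\<kappa>' \<kappa> \<in> PiE {..<N} K'" if "\<kappa> \<in> PiE {..<N} KF" for \<kappa>
    unfolding \<kappa>'_def by (rule joint_input_in[OF gin that])
  have z_in: "z \<kappa> \<in> PiE {..<N} K" if "\<kappa> \<in> PiE {..<N} KF" for \<kappa>
    unfolding z_def by (rule joint_input_in[OF cd(3) \<kappa>'_in[OF that]])
  have z0: "z \<kappa> 0 = f 0 (fst (prod_decode (\<kappa> 0)))" and zq: "\<And>q. q \<in> ?I \<Longrightarrow> z \<kappa> q = f q (\<kappa> q)" for \<kappa>
    using N by (simp_all add: z_def \<kappa>'_def joint_input_def)
  have je: "joint_execution N n ?m (parties (A' x) (\<lambda>p. B' p (y p))) \<psi> \<kappa> r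
      = (if match x y (z \<kappa>) then amp \<kappa> else 0) *\<^sub>C apply_op ?D (R \<kappa>) \<psi> r"
    if \<kappa>: "\<kappa> \<in> PiE {..<N} KF" and r: "r \<in> ?D" for x y \<kappa> r and \<psi> :: "all_sys \<Rightarrow> 'e"
  proof -
    let ?M = "parties (A' x) (\<lambda>p. B' p (y p))"
    have t: "tensor N (\<lambda>p. ?M p (\<kappa> p)) r (\<lambda>p. (b p, w p)) = (if match x y (z \<kappa>)
        then NA (\<kappa> 0) (r 0) (b 0, w 0) * (\<Prod>q\<in>?I. NB q (\<kappa> q) (r q) (b q, w q)) else 0)" for b w
    proof -
      have "tensor N (\<lambda>p. ?M p (\<kappa> p)) r (\<lambda>p. (b p, w p))
        = A' x (\<kappa> 0) (r 0) (b 0, w 0) * (\<Prod>q\<in>?I. B' q (y q) (\<kappa> q) (r q) (b q, w q))"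
        unfolding tensor_def prod_lessThan_split[OF N] parties_def by (intro arg_cong2[where f="(*)"] prod.cong) auto
      also have "\<dots> = (if match x y (z \<kappa>) then NA (\<kappa> 0) (r 0) (b 0, w 0) * (\<Prod>q\<in>?I. NB q (\<kappa> q) (r q) (b q, w q)) else 0)"
      proof (cases "match x y (z \<kappa>)")
        case True
        then have AB: "A' x (\<kappa> 0) (r 0) (b 0, w 0) = NA (\<kappa> 0) (r 0) (b 0, w 0)"
          "\<And>q. q \<in> ?I \<Longrightarrow> B' q (y q) (\<kappa> q) (r q) (b q, w q) = NB q (\<kappa> q) (r q) (b q, w q)"
          unfolding match_def A'_def B'_def z0[symmetric] by (simp_all add: zq[symmetric])
        have "(\<Prod>q\<in>?I. B' q (y q) (\<kappa> q) (r q) (b q, w q)) = (\<Prod>q\<in>?I. NB q (\<kappa> q) (r q) (b q, w q))"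
          by (rule prod.cong[OF refl AB(2)])
        then show ?thesis using True AB(1) by (simp only: if_True)
      next
        case False
        then consider "z \<kappa> 0 \<noteq> to_nat_on X x" | q where "q \<in> ?I" "fst (prod_decode (z \<kappa> q)) \<noteq> to_nat_on (Y q) (y q)"
          unfolding match_def by blast
        then show ?thesis
        proof cases
          case 1
          then show ?thesis using False by (simp add: A'_def z0)
        next
          case 2
          then have "B' q (y q) (\<kappa> q) (r q) (b q, w q) = 0" by (simp add: B'_def zq)
          then have "(\<Prod>q\<in>?I. B' q (y q) (\<kappa> q) (r q) (b q, w q)) = 0" using 2 by (intro prod_zero) auto
          then show ?thesis using False by (simp only: mult_zero_right if_False)
        qed
      qed
      finally show ?thesis .
    qed
    have "joint_execution N n ?m ?M \<psi> \<kappa> r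
      = apply_op ?D (\<lambda>r b. (if match x y (z \<kappa>) then amp \<kappa> else 0) * R \<kappa> r b) \<psi> r"
    proof (rule joint_execution_eq)
      fix b assume b: "b \<in> ?D"
      have up: "user_paulis N n (\<lambda>q. h q (snd (prod_decode (f q (\<kappa> q))))) = user_paulis N n (ud (z \<kappa>))"
        by (rule user_paulis_cong) (simp add: ud_def zq)
      have "mat_mult ?D S (mat_mult ?D (\<lambda>r b. c * V r b) S') r b = c * mat_mult ?D S (mat_mult ?D V S') r b" for S V S' c
        unfolding mat_mult_def sum_distrib_left by (intro sum.cong refl) (simp add: mult_ac)
      then have "(\<Sum>w\<in>ebit_basis N ?m. NA (\<kappa> 0) (r 0) (b 0, w 0) * (\<Prod>q\<in>?I. NB q (\<kappa> q) (r q) (b q, w q)) *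
        epr_pairs N ?m w) = amp \<kappa> * R \<kappa> r b"
        unfolding NAB[OF \<kappa>[unfolded KF_def] r b] up R_def amp_def C_def[symmetric] \<kappa>'_def[symmetric]
        by (simp only: mult.assoc)
      then show "(\<Sum>w\<in>ebit_basis N ?m. tensor N (\<lambda>p. ?M p (\<kappa> p)) r (\<lambda>p. (b p, w p)) * epr_pairs N ?m w)
        = (if match x y (z \<kappa>) then amp \<kappa> else 0) * R \<kappa> r b"
        unfolding t by (cases "match x y (z \<kappa>)") (simp_all only: if_True if_False mult_zero_left sum.neutral_const)
    qed
    then show ?thesis by (simp only: apply_op_scale)
  qed
  have R: "unitary_on ?D (R \<kappa>)" if "\<kappa> \<in> PiE {..<N} KF" for \<kappa>
    unfolding R_def by (intro unitary_on_mat_mult fin W \<kappa>'_in that local_qubitwise_unitary local_qubitwise_user_paulis)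
  have prob: "outcome_prob N n ?m (parties (A' x) (\<lambda>p. B' p (y p))) \<psi> \<kappa> = (if match x y (z \<kappa>) then (cmod (amp \<kappa>))\<^sup>2 else 0)"
    if \<kappa>: "\<kappa> \<in> PiE {..<N} KF" and \<psi>: "sq_norm ?D \<psi> = 1" for x y \<kappa> and \<psi> :: "all_sys \<Rightarrow> 'e"
  proof -
    have "outcome_prob N n ?m (parties (A' x) (\<lambda>p. B' p (y p))) \<psi> \<kappa>
      = sq_norm ?D (\<lambda>r. (if match x y (z \<kappa>) then amp \<kappa> else 0) *\<^sub>C apply_op ?D (R \<kappa>) \<psi> r)"
      unfolding outcome_prob_def sq_norm_def by (intro sum.cong refl) (simp add: je[OF \<kappa>])
    also have "\<dots> = (cmod (if match x y (z \<kappa>) then amp \<kappa> else 0))\<^sup>2"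
      by (simp only: sq_norm_scale sq_norm_isometry[OF fin unitary_onD[OF R[OF \<kappa>]]] \<psi> mult_1_right)
    finally show ?thesis by simp
  qed
  have decode: "xd zz = x" "yd zz = y" if "match x y zz" "x \<in> X" "y \<in> PiE ?I Y" for x y zz
  proof -
    show "xd zz = x" using that(1,2) cX by (simp add: match_def xd_def)
    show "yd zz = y"
    proof (rule PiE_ext[OF _ that(3)])
      show yy: "yd zz q = y q" if "q \<in> ?I" for q
        using that \<open>match x y zz\<close> cY[OF that] PiE_mem[OF \<open>y \<in> PiE ?I Y\<close> that] by (simp add: match_def yd_def)
      show "yd zz \<in> PiE ?I Y"
        using yy PiE_mem[OF that(3)] unfolding yd_def by (intro restrict_PiE_iff[THEN iffD2]) auto
    qed
  qed
  \<comment> \<open>The state and the inputs are quantified inside, so that the \<open>V\<close>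
    chosen afterwards depends on the outcomes only.\<close>
  define corrects where "corrects \<kappa> V \<longleftrightarrow> (\<forall>p<N. qubitwise_unitary (n p) (V p)) \<and>
    (good \<kappa> \<longrightarrow> amp \<kappa> \<noteq> 0 \<longrightarrow> (\<forall>\<psi> :: all_sys \<Rightarrow> 'e. sq_norm ?D \<psi> = 1 \<longrightarrow>
      (\<forall>x\<in>X. \<forall>y\<in>PiE ?I Y. match x y (z \<kappa>) \<longrightarrow>
        coincides_up_to N n V (apply_op ?D (U x y) \<psi>) (outcome_state N n ?m (parties (A' x) (\<lambda>p. B' p (y p))) \<psi> \<kappa>))))"
    for \<kappa> V
  have "\<forall>\<kappa>\<in>PiE {..<N} KF. \<exists>V. corrects \<kappa> V"
  proof
    fix \<kappa> assume \<kappa>: "\<kappa> \<in> PiE {..<N} KF"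
    show "\<exists>V. corrects \<kappa> V"
    proof (cases "good \<kappa> \<and> amp \<kappa> \<noteq> 0")
      case False
      then have "good \<kappa> \<Longrightarrow> amp \<kappa> \<noteq> 0 \<Longrightarrow> R" for R by blast
      then show ?thesis
        unfolding corrects_def by (intro exI[of _ "\<lambda>p. id_mat"] conjI allI impI qubitwise_unitary_id_mat)
    next
      case True
      then obtain S where S: "local_qubitwise N n S" "\<And>r b. r \<in> ?D \<Longrightarrow> b \<in> ?D \<Longrightarrow> W (\<kappa>' \<kappa>) r b = mat_mult ?D S (T (z \<kappa>)) r b"
        unfolding good_def implements_def by blast
      let ?w = "user_paulis N n (hw (snd (prod_decode (\<kappa> 0))))" and ?u = "user_paulis N n (ud (z \<kappa>))"
      have "local_qubitwise N n (mat_mult ?D ?w S)" by (intro local_qubitwise_mat_mult local_qubitwise_user_paulis S)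
      then obtain V where V: "\<And>p. p < N \<Longrightarrow> qubitwise_unitary (n p) (V p)"
        "\<And>U M m \<kappa>' and \<psi> :: all_sys \<Rightarrow> 'e. sq_norm ?D \<psi> = 1 \<Longrightarrow> unitary_on ?D U \<Longrightarrow>
          (\<And>r. r \<in> ?D \<Longrightarrow> joint_execution N n m M \<psi> \<kappa>' r = amp \<kappa> *\<^sub>C apply_op ?D (mat_mult ?D (mat_mult ?D ?w S) U) \<psi> r) \<Longrightarrow>
          coincides_up_to N n V (apply_op ?D U \<psi>) (outcome_state N n m M \<psi> \<kappa>')"
        by (rule correctable[OF N _ conjunct2[OF True]]) blast
      have cc: "coincides_up_to N n V (apply_op ?D (U x y) \<psi>) (outcome_state N n ?m (parties (A' x) (\<lambda>p. B' p (y p))) \<psi> \<kappa>)"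
        if \<psi>: "sq_norm ?D \<psi> = 1" and x: "x \<in> X" and y: "y \<in> PiE ?I Y" and m: "match x y (z \<kappa>)" for \<psi> :: "all_sys \<Rightarrow> 'e" and x y
      proof (rule V(2)[OF \<psi> assms(4)[OF x y]])
        fix r assume r: "r \<in> ?D"
        have u: "unitary_on ?D ?u" by (intro local_qubitwise_unitary local_qubitwise_user_paulis)
        have Tz: "T (z \<kappa>) = mat_mult ?D (U x y) (adj ?u)" by (simp only: T_def decode[OF m x y])
        \<comment> \<open>The adjoint in \<open>T\<close> cancels the users' Pauli errors, which
          leaves \<open>U\<close> followed by allowed corrections.\<close>
        have Rb: "R \<kappa> r b = mat_mult ?D (mat_mult ?D ?w S) (U x y) r b" if b: "b \<in> ?D" for b
        proof -
          have eq: "mat_mult ?D (W (\<kappa>' \<kappa>)) ?u t b = mat_mult ?D (mat_mult ?D S (mat_mult ?D (U x y) (adj ?u))) ?u t b" if "t \<in> ?D" for t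
            unfolding Tz[symmetric] by (rule mat_mult_cong, rule S(2)[OF that], assumption, rule refl)
          have "R \<kappa> r b = mat_mult ?D ?w (mat_mult ?D (mat_mult ?D S (mat_mult ?D (U x y) (adj ?u))) ?u) r b"
            unfolding R_def by (rule mat_mult_cong, rule refl, rule eq)
          also have "\<dots> = mat_mult ?D (mat_mult ?D (mat_mult ?D ?w S) (U x y)) (mat_mult ?D (adj ?u) ?u) r b" by (simp only: mat_mult_assoc)
          also have "\<dots> = mat_mult ?D (mat_mult ?D (mat_mult ?D ?w S) (U x y)) id_mat r b"
            by (rule mat_mult_cong, rule refl, rule mat_mult_adj_left[OF u], assumption, rule b)
          finally show ?thesis by (simp only: mat_mult_id_mat_right[OF fin b])
        qed
        have "apply_op ?D (R \<kappa>) \<psi> r = apply_op ?D (mat_mult ?D (mat_mult ?D ?w S) (U x y)) \<psi> r"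
          by (rule apply_op_cong, rule Rb, assumption, rule refl)
        then show "joint_execution N n ?m (parties (A' x) (\<lambda>p. B' p (y p))) \<psi> \<kappa> r
          = amp \<kappa> *\<^sub>C apply_op ?D (mat_mult ?D (mat_mult ?D ?w S) (U x y)) \<psi> r"
          by (simp only: je[OF \<kappa> r] m if_True)
      qed
      show ?thesis
        unfolding corrects_def by (rule exI[of _ V]) (intro conjI allI impI ballI V(1) cc)
    qed
  qed
  from bchoice[OF this] obtain V where corr: "\<forall>\<kappa>\<in>PiE {..<N} KF. corrects \<kappa> (V \<kappa>)" by blast
  have V: "qubitwise_unitary (n p) (V \<kappa> p)" if "\<kappa> \<in> PiE {..<N} KF" "p < N" for \<kappa> p
    using bspec[OF corr that(1)] that(2) unfolding corrects_def by blast
  have coin: "coincides_up_to N n (V \<kappa>) (apply_op ?D (U x y) \<psi>) (outcome_state N n ?m (parties (A' x) (\<lambda>p. B' p (y p))) \<psi> \<kappa>)"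
    if "\<kappa> \<in> PiE {..<N} KF" "good \<kappa>" "amp \<kappa> \<noteq> 0" "sq_norm ?D \<psi> = 1" "x \<in> X" "y \<in> PiE ?I Y" "match x y (z \<kappa>)"
    for \<kappa> x y and \<psi> :: "all_sys \<Rightarrow> 'e"
    using bspec[OF corr that(1)] that(2-) unfolding corrects_def by blast
  \<comment> \<open>For given \<open>x\<close> and \<open>y\<close>, at most \<open>?dd\<close>
    joint inputs of the central protocol match, one for each result of the users' first
    measurements, and Alice has \<open>?dd\<close> results in the last one. Since
    \<open>cmod C = 1 / ?dd\<close>, these numbers cancel: the bound for a single joint input is
    averaged over the inputs and is not multiplied by their number.\<close>
  have total: "(\<Sum>\<kappa> | \<kappa> \<in> PiE {..<N} KF \<and> match x y (z \<kappa>) \<and> \<not> good \<kappa>. (cmod (amp \<kappa>))\<^sup>2) \<le> \<epsilon>" for x y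
  proof -
    let ?S = "{\<kappa> \<in> PiE {..<N} KF. \<not> good \<kappa>}" and ?Z = "{zz. zz \<in> PiE {..<N} K \<and> match x y zz}"
    let ?dd = "\<Prod>q\<in>?I. (real (card (bits {..<n q})))\<^sup>2"
    have dd: "?dd > 0" using eb(4) by (intro prod_pos) auto
    have finPK: "finite (PiE {..<N} K)" "finite (PiE {..<N} KF)" using Kfin KFfin by (auto intro!: finite_PiE)
    have cardA: "card (A q) = (card (bits {..<n q}))\<^sup>2" for q
      using error_basis_card[OF error_basis_qpauli] by (simp add: A_def)
    have cardQ: "real (card Q) = ?dd"
      using bij_betw_same_card[OF hw] error_basis_card[OF error_basis_qpauli] by (simp add: card_PiE)
    have "(\<Sum>\<kappa> | \<kappa> \<in> PiE {..<N} KF \<and> match x y (z \<kappa>) \<and> \<not> good \<kappa>. (cmod (amp \<kappa>))\<^sup>2)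
      = (\<Sum>\<kappa> | \<kappa> \<in> ?S \<and> match x y (z \<kappa>). (cmod (amp \<kappa>))\<^sup>2)"
      by (intro sum.cong) auto
    also have "\<dots> = (\<Sum>zz\<in>?Z. \<Sum>\<kappa> | \<kappa> \<in> ?S \<and> z \<kappa> = zz. (cmod (amp \<kappa>))\<^sup>2)"
      using finPK z_in by (intro sum_fibers) auto
    also have "\<dots> \<le> (\<Sum>zz\<in>?Z. real (card Q) * (cmod C)\<^sup>2 * \<epsilon>)"
    proof (rule sum_mono)
      fix zz assume zz: "zz \<in> ?Z"
      have "(\<Sum>\<kappa> | \<kappa> \<in> ?S \<and> z \<kappa> = zz. (cmod (amp \<kappa>))\<^sup>2)
        = (\<Sum>\<kappa> | \<kappa> \<in> PiE {..<N} KF \<and> joint_input N (\<lambda>p. f p \<circ> ?g p) \<kappa> = zz \<and> \<not> implements (T zz) (W (joint_input N ?g \<kappa>)) \<and> True.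
          (cmod (amp \<kappa>))\<^sup>2)"
        by (intro sum.cong) (auto simp: good_def z_def \<kappa>'_def joint_input_comp)
      also have "\<dots> = (\<Sum>\<kappa>1 | \<kappa>1 \<in> PiE {..<N} K' \<and> joint_input N f \<kappa>1 = zz \<and> \<not> implements (T zz) (W \<kappa>1).
          \<Sum>\<kappa> | \<kappa> \<in> PiE {..<N} KF \<and> joint_input N ?g \<kappa> = \<kappa>1 \<and> True. (cmod (amp \<kappa>))\<^sup>2)"
        using cd(2) KFfin gin
        by (intro sum_joint_input_comp[where R="\<lambda>\<kappa>1. \<not> implements (T zz) (W \<kappa>1)" and S="\<lambda>_. True"]) blast
      also have "\<dots> = (\<Sum>\<kappa>1 | \<kappa>1 \<in> PiE {..<N} K' \<and> joint_input N f \<kappa>1 = zz \<and> \<not> implements (T zz) (W \<kappa>1).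
          real (card Q) * (cmod C)\<^sup>2 * (cmod (a \<kappa>1))\<^sup>2)"
      proof (rule sum.cong[OF refl])
        fix \<kappa>1 assume "\<kappa>1 \<in> {\<kappa>1. \<kappa>1 \<in> PiE {..<N} K' \<and> joint_input N f \<kappa>1 = zz \<and> \<not> implements (T zz) (W \<kappa>1)}"
        then have \<kappa>1: "\<kappa>1 \<in> PiE {..<N} K'" by blast
        have "(\<Sum>\<kappa> | \<kappa> \<in> PiE {..<N} KF \<and> joint_input N ?g \<kappa> = \<kappa>1 \<and> True. (cmod (amp \<kappa>))\<^sup>2)
          = (\<Sum>\<kappa> | \<kappa> \<in> PiE {..<N} KF \<and> joint_input N ?g \<kappa> = \<kappa>1. (cmod C)\<^sup>2 * (cmod (a \<kappa>1))\<^sup>2)"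
          by (intro sum.cong) (auto simp: amp_def \<kappa>'_def norm_mult power_mult_distrib)
        also have "\<dots> = (\<Sum>j\<in>Q. (cmod C)\<^sup>2 * (cmod (a \<kappa>1))\<^sup>2)"
          unfolding KF_def by (rule sum_discard_fiber[OF \<kappa>1])
        finally show "(\<Sum>\<kappa> | \<kappa> \<in> PiE {..<N} KF \<and> joint_input N ?g \<kappa> = \<kappa>1 \<and> True. (cmod (amp \<kappa>))\<^sup>2)
          = real (card Q) * (cmod C)\<^sup>2 * (cmod (a \<kappa>1))\<^sup>2"
          by (simp only: sum_constant of_nat_id mult.assoc)
      qed
      also have "\<dots> \<le> real (card Q) * (cmod C)\<^sup>2 * \<epsilon>"
        unfolding sum_distrib_left[symmetric] using bad[of zz] zz k by (intro mult_left_mono) auto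
      finally show "(\<Sum>\<kappa> | \<kappa> \<in> ?S \<and> z \<kappa> = zz. (cmod (amp \<kappa>))\<^sup>2) \<le> real (card Q) * (cmod C)\<^sup>2 * \<epsilon>" .
    qed
    also have "\<dots> = real (card ?Z) * (real (card Q) * (cmod C)\<^sup>2 * \<epsilon>)" by simp
    also have "\<dots> \<le> ?dd * (real (card Q) * (cmod C)\<^sup>2 * \<epsilon>)"
    proof (rule mult_right_mono)
      have "card ?Z \<le> card (PiE ?I A)"
      proof (rule card_inj_on_le[of "\<lambda>zz. \<lambda>q\<in>?I. snd (prod_decode (zz q))"])
        show "inj_on (\<lambda>zz. \<lambda>q\<in>?I. snd (prod_decode (zz q))) ?Z"
        proof (rule inj_onI)
          fix v v' assume v: "v \<in> ?Z" "v' \<in> ?Z" "(\<lambda>q\<in>?I. snd (prod_decode (v q))) = (\<lambda>q\<in>?I. snd (prod_decode (v' q)))"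
          have "v q = v' q" if "q < N" for q
          proof (cases "q = 0")
            case True
            then show ?thesis using v(1,2) by (simp add: match_def)
          next
            case False
            then have q: "q \<in> ?I" using that by simp
            have "fst (prod_decode (v q)) = fst (prod_decode (v' q))" using v(1,2) q by (simp add: match_def)
            moreover have "snd (prod_decode (v q)) = snd (prod_decode (v' q))" using fun_cong[OF v(3), of q] q by simp
            ultimately show ?thesis by (metis prod.collapse prod_decode_inverse)
          qed
          then show "v = v'" using v(1,2) by (intro PiE_ext[of v "{..<N}" K v']) auto
        qed
        show "(\<lambda>zz. \<lambda>q\<in>?I. snd (prod_decode (zz q))) ` ?Z \<subseteq> PiE ?I A"
        proof (rule image_subsetI, rule restrict_PiE_iff[THEN iffD2], rule ballI)
          fix zz q assume "zz \<in> ?Z" "q \<in> ?I"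
          then have "zz q \<in> K q" by auto
          then show "snd (prod_decode (zz q)) \<in> A q" using Kq[OF \<open>q \<in> ?I\<close>] by auto
        qed
        show "finite (PiE ?I A)" by (intro finite_PiE) (auto simp: A_def)
      qed
      also have "real (card (PiE ?I A)) = ?dd" by (simp add: card_PiE cardA)
      finally show "real (card ?Z) \<le> ?dd" by simp
    qed (use assms(5) in simp)
    also have "\<dots> = \<epsilon>"
    proof -
      have "cmod C = 1 / ?dd"
        by (simp add: C_def prod_norm[symmetric] norm_divide norm_power prod_dividef)
      moreover have "v * (v * (1 / v)\<^sup>2 * \<epsilon>) = \<epsilon>" if "v > 0" for v
        using that by (simp add: power2_eq_square)
      ultimately show ?thesis using dd by (simp only: cardQ)
    qed
    finally show ?thesis .
  qed
  have main: "(\<Sum>\<kappa> | \<kappa> \<in> PiE {..<N} KF \<and> \<not> coincides_up_to N n (V \<kappa>) (apply_op ?D (U x y) \<psi>)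
        (outcome_state N n ?m (parties (A' x) (\<lambda>p. B' p (y p))) \<psi> \<kappa>).
      outcome_prob N n ?m (parties (A' x) (\<lambda>p. B' p (y p))) \<psi> \<kappa>) \<le> \<epsilon>"
    if \<psi>: "sq_norm ?D \<psi> = 1" and x: "x \<in> X" and y: "y \<in> PiE ?I Y" for \<psi> :: "all_sys \<Rightarrow> 'e" and x y
  proof -
    have finKF: "finite (PiE {..<N} KF)" using KFfin by (auto intro!: finite_PiE)
    let ?S = "{\<kappa>. \<kappa> \<in> PiE {..<N} KF \<and> \<not> coincides_up_to N n (V \<kappa>) (apply_op ?D (U x y) \<psi>)
        (outcome_state N n ?m (parties (A' x) (\<lambda>p. B' p (y p))) \<psi> \<kappa>)}"
    have "(\<Sum>\<kappa>\<in>?S. outcome_prob N n ?m (parties (A' x) (\<lambda>p. B' p (y p))) \<psi> \<kappa>)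
      \<le> (\<Sum>\<kappa>\<in>?S. if match x y (z \<kappa>) \<and> \<not> good \<kappa> then (cmod (amp \<kappa>))\<^sup>2 else 0)"
    proof (rule sum_mono)
      fix \<kappa> assume \<kappa>: "\<kappa> \<in> ?S"
      \<comment> \<open>In the last two of these cases the outcome has probability 0, so only
        matching outcomes that are not \<open>good\<close> count.\<close>
      then have "\<not> good \<kappa> \<or> amp \<kappa> = 0 \<or> \<not> match x y (z \<kappa>)" using coin[of \<kappa> \<psi> x y] \<psi> x y by blast
      then show "outcome_prob N n ?m (parties (A' x) (\<lambda>p. B' p (y p))) \<psi> \<kappa>
        \<le> (if match x y (z \<kappa>) \<and> \<not> good \<kappa> then (cmod (amp \<kappa>))\<^sup>2 else 0)"
        using prob[of \<kappa> \<psi> x y] \<kappa> \<psi> by auto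
    qed
    also have "\<dots> \<le> (\<Sum>\<kappa>\<in>PiE {..<N} KF. if match x y (z \<kappa>) \<and> \<not> good \<kappa> then (cmod (amp \<kappa>))\<^sup>2 else 0)"
      using finKF by (intro sum_mono2) auto
    also have "\<dots> = (\<Sum>\<kappa> | \<kappa> \<in> PiE {..<N} KF \<and> match x y (z \<kappa>) \<and> \<not> good \<kappa>. (cmod (amp \<kappa>))\<^sup>2)"
      using finKF by (simp add: sum.inter_filter)
    also have "\<dots> \<le> \<epsilon>" by (rule total)
    finally show ?thesis .
  qed
  have LA: "local_operation N n ?m 0 (KF 0) (A' x)" if "x \<in> X" for x
    using NA[of "to_nat_on X x"] that by (simp add: KF_def K_def A'_def[abs_def])
  have LB: "local_operation N n ?m q (KF q) (B' q y)" if "q \<in> ?I" "y \<in> Y q" for q y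
    using NB[of q "to_nat_on (Y q) y"] that by (simp add: KF_def Yc_def B'_def[abs_def])
  show ?thesis
    unfolding Let_def
    by (rule exI[of _ ?m], rule exI[of _ KF], rule exI[of _ A'], rule exI[of _ B'], rule exI[of _ V])
      (intro conjI ballI allI impI LA LB V main)
qed

end
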